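(* Let $J$ be an $\mathcal F$-measurable random variable with values in a Lusin space $(E,\mathcal B_E)$ and law $\gamma$, satisfying Jacod's density hypothesis (J), let $\mathbf G$ be the initial enlargement of $\mathbf F$ with respect to $J$, and let $p^x$, $\eta^x$ ($x\in E$) be as in the context. The following statements are equivalent: (1) For any $X:E\times\Omega\times\mathbb R_+\to\mathbb R_+$ that is $\mathcal B_E\otimes\mathcal O(\mathbf F)$-measurable, such that $X^x$ is càdlàg for every $x\in E$ and $X^x$ is a local martingale on $(\Omega,\mathbf F,\mathbb P)$ for $\gamma$-a.e. $x\in E$, the process $X^J/p^J$ is a local martingale on $(\Omega,\mathbf G,\mathbb P)$. (2) The process $1/p^J$ is a local martingale on $(\Omega,\mathbf G,\mathbb P)$. (3) $\mathbb P[\eta^x<\infty]=0$ holds for $\gamma$-a.e. $x\in E$.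
   Context: Let $(\Omega,\mathcal F,\mathbf F,\mathbb P)$ be a filtered probability space, where $\mathbf F=(\mathcal F_t)_{t\in\mathbb R_+}$ satisfies the usual hypotheses (right-continuity and saturation by $\mathbb P$-null sets); $\mathcal F_\infty\subseteq\mathcal F$, possibly strictly. $\mathcal O(\mathbf F)$ is the $\mathbf F$-optional $\sigma$-field on $\Omega\times\mathbb R_+$. Initial enlargement. $J:\Omega\to E$ is $\mathcal F$-measurable, with $(E,\mathcal B_E)$ a Lusin space with its Borel $\sigma$-field. $\mathbf G=(\mathcal G_t)_{t\in\mathbb R_+}$ is the right-continuous augmentation of $\mathbf G^0=(\mathcal G^0_t)_{t\in\mathbb R_+}$, $\mathcal G^0_t=\mathcal F_t\vee\sigma(J)$. $\gamma$ is the law of $J$, and $\gamma_t:\Omega\times\mathcal B_E\to[0,1]$ is a regular version of the $\mathcal F_t$-conditional law of $J$. Hypothesis (J): for all $t\in\mathbb R_+$, $\gamma_t\ll\gamma$ holds $\mathbb P$-a.s. Densities and stopping times. Under (J) there is a $\mathcal B_E\otimes\mathcal O(\mathbf F)$-measurable function $(x,\omega,t)\mapsto p^x_t(\omega)\in[0,\infty)$, càdlàg in $t$, such that (i) for every $t$, $\gamma_t(\mathrm dx)=p^x_t\,\gamma(\mathrm dx)$ $\mathbb P$-a.s., and (ii) for every $x\in E$, $p^x=(p^x_t)_{t\in\mathbb R_+}$ is a martingale on $(\Omega,\mathbf F,\mathbb P)$. Fix such a version. For $x\in E$ put $\zeta^x=\inf\{t\in\mathbb R_+:p^x_t=0\}$,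 $\Lambda^x=\{\zeta^x<\infty,\ p^x_{\zeta^x-}>0\}$ (with $p^x_{0-}=p^x_0$), and $\eta^x=\zeta^x\,\mathbb I_{\Lambda^x}+\infty\,\mathbb I_{\Omega\setminus\Lambda^x}$, an $\mathbf F$-stopping time (the time at which $p^x$ jumps to zero). For a function $X$ on $E\times\Omega\times\mathbb R_+$, $X^x=(X^x_t)_{t\in\mathbb R_+}$ is the process $(\omega,t)\mapsto X(x,\omega,t)$ and $X^J$ is the process $(\omega,t)\mapsto X^{J(\omega)}_t(\omega)$; likewise $p^J$ and $\zeta^J$. It is known that $\mathbb P[\zeta^J=\infty]=1$, so $1/p^J$ is well defined. *)

theory Defs
  imports "HOL-Probability.Probability"
begin

text \<open>
  Processes are functions \<open>X :: 'a \<Rightarrow> real \<Rightarrow> real\<close> with arguments \<open>\<omega>\<close>, \<open>t\<close>. The index set is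
  the half-line \<open>[0,\<infinity>)\<close>: filtrations and paths are indexed by \<open>real\<close>, but only their values at
  \<open>t \<ge> 0\<close> are ever constrained or used. Random times take values in \<open>[0,\<infinity>]\<close>, i.e. in \<open>ennreal\<close>.
  For a sub-\<open>\<sigma>\<close>-field given as a \<open>measure\<close>, only \<open>space\<close> and \<open>sets\<close> matter.
\<close>


section \<open>Lusin spaces\<close>

definition borel_of :: "'e topology \<Rightarrow> 'e measure" where
  "borel_of E = sigma (topspace E) {U. openin E U}"

definition Polish_topology :: "'e topology \<Rightarrow> bool" where
  "Polish_topology Y \<longleftrightarrow> completely_metrizable_space Y \<and> second_countable Y"

text \<open>
  Hausdorff and a continuous bijective image of a Polish space. Since the map is a bijection, the
  Polish space can be transported to the type of \<open>E\<close>, so taking \<open>Y\<close> on that type loses nothing.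
\<close>

definition Lusin_space :: "'e topology \<Rightarrow> bool" where
  "Lusin_space E \<longleftrightarrow> Hausdorff_space E \<and>
     (\<exists>(Y :: 'e topology) f. Polish_topology Y \<and> continuous_map Y E f \<and>
        bij_betw f (topspace Y) (topspace E))"


section \<open>Filtrations, stopping times, martingales\<close>

definition filtered_space :: "'a measure \<Rightarrow> (real \<Rightarrow> 'a measure) \<Rightarrow> bool" where
  "filtered_space M F \<longleftrightarrow>
     (\<forall>t\<ge>0. subalgebra M (F t)) \<and> (\<forall>s\<ge>0. \<forall>t\<ge>s. sets (F s) \<subseteq> sets (F t))"

text \<open>
  Saturation is the usual one: every subset of a \<open>\<P>\<close>-null set lies in \<open>F 0\<close>.
\<close>

definition usual_hypotheses :: "'a measure \<Rightarrow> (real \<Rightarrow> 'a measure) \<Rightarrow> bool" where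
  "usual_hypotheses M F \<longleftrightarrow>
     (\<forall>t\<ge>0. sets (F t) = (\<Inter>s\<in>{t<..}. sets (F s))) \<and>
     complete_measure M \<and> null_sets M \<subseteq> sets (F 0)"

definition cadlag :: "(real \<Rightarrow> real) \<Rightarrow> bool" where
  "cadlag f \<longleftrightarrow> (\<forall>t\<ge>0. (f \<longlongrightarrow> f t) (at_right t)) \<and> (\<forall>t>0. \<exists>l. (f \<longlongrightarrow> l) (at_left t))"

definition adapted :: "(real \<Rightarrow> 'a measure) \<Rightarrow> ('a \<Rightarrow> real \<Rightarrow> real) \<Rightarrow> bool" where
  "adapted F X \<longleftrightarrow> (\<forall>t\<ge>0. (\<lambda>\<omega>. X \<omega> t) \<in> borel_measurable (F t))"

definition optional_sigma :: "'a measure \<Rightarrow> (real \<Rightarrow> 'a measure) \<Rightarrow> ('a \<times> real) measure" where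
  "optional_sigma M F = sigma (space M \<times> {0..})
     {(\<lambda>(\<omega>, t). Y \<omega> t) -` B \<inter> (space M \<times> {0..}) | Y B.
        adapted F Y \<and> (\<forall>\<omega>\<in>space M. cadlag (Y \<omega>)) \<and> B \<in> sets (borel :: real measure)}"

text \<open>
  The library's \<open>stopping_time\<close> forces random times to take values in the index type of the
  filtration, which excludes \<open>\<infinity>\<close> here.
\<close>

definition ext_stopping_time :: "(real \<Rightarrow> 'a measure) \<Rightarrow> ('a \<Rightarrow> ennreal) \<Rightarrow> bool" where
  "ext_stopping_time F T \<longleftrightarrow> (\<forall>t\<ge>0. Measurable.pred (F t) (\<lambda>\<omega>. T \<omega> \<le> ennreal t))"

definition stopped :: "('a \<Rightarrow> real \<Rightarrow> real) \<Rightarrow> ('a \<Rightarrow> ennreal) \<Rightarrow> 'a \<Rightarrow> real \<Rightarrow> real" where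
  "stopped X T \<omega> t = X \<omega> (enn2real (min (ennreal t) (T \<omega>)))"

definition martingale :: "'a measure \<Rightarrow> (real \<Rightarrow> 'a measure) \<Rightarrow> ('a \<Rightarrow> real \<Rightarrow> real) \<Rightarrow> bool" where
  "martingale M F X \<longleftrightarrow> adapted F X \<and>
     (\<forall>t\<ge>0. integrable M (\<lambda>\<omega>. X \<omega> t)) \<and>
     (\<forall>s\<ge>0. \<forall>t\<ge>s. AE \<omega> in M. real_cond_exp M (F s) (\<lambda>\<omega>. X \<omega> t) \<omega> = X \<omega> s)"

text \<open>
  The factor \<open>1\<^bsub>{T n > 0}\<^esub>\<close> means that \<open>X\<^sub>0\<close> need not be integrable; this matters for processes
  such as \<open>X\<^sup>J / p\<^sup>J\<close>, whose initial value may depend on \<open>J\<close>. Paths are required to be cadlag only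
  almost surely, so that a process may be altered arbitrarily on a null set.
\<close>

definition local_martingale :: "'a measure \<Rightarrow> (real \<Rightarrow> 'a measure) \<Rightarrow> ('a \<Rightarrow> real \<Rightarrow> real) \<Rightarrow> bool" where
  "local_martingale M F X \<longleftrightarrow> adapted F X \<and> (AE \<omega> in M. cadlag (X \<omega>)) \<and>
     (\<exists>T :: nat \<Rightarrow> 'a \<Rightarrow> ennreal.
        (\<forall>n. ext_stopping_time F (T n)) \<and>
        (AE \<omega> in M. incseq (\<lambda>n. T n \<omega>) \<and> (\<lambda>n. T n \<omega>) \<longlonglongrightarrow> \<infinity>) \<and>
        (\<forall>n. martingale M F (\<lambda>\<omega> t. stopped X (T n) \<omega> t * indicator {\<omega>. T n \<omega> > 0} \<omega>)))"


section \<open>Initial enlargement and conditional laws\<close>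

definition initial_enlargement0 ::
    "'a measure \<Rightarrow> (real \<Rightarrow> 'a measure) \<Rightarrow> 'e topology \<Rightarrow> ('a \<Rightarrow> 'e) \<Rightarrow> real \<Rightarrow> 'a measure" where
  "initial_enlargement0 M F E J t =
     sigma (space M) (sets (F t) \<union> sets (vimage_algebra (space M) J (borel_of E)))"

definition initial_enlargement ::
    "'a measure \<Rightarrow> (real \<Rightarrow> 'a measure) \<Rightarrow> 'e topology \<Rightarrow> ('a \<Rightarrow> 'e) \<Rightarrow> real \<Rightarrow> 'a measure" where
  "initial_enlargement M F E J t =
     sigma (space M) (\<Inter>s\<in>{t<..}. sets (initial_enlargement0 M F E J s))"

definition regular_cond_law ::
    "'a measure \<Rightarrow> 'a measure \<Rightarrow> 'e measure \<Rightarrow> ('a \<Rightarrow> 'e) \<Rightarrow> ('a \<Rightarrow> 'e measure) \<Rightarrow> bool" where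
  "regular_cond_law M H N J \<kappa> \<longleftrightarrow> \<kappa> \<in> H \<rightarrow>\<^sub>M prob_algebra N \<and>
     (\<forall>A\<in>sets N. AE \<omega> in M.
        measure (\<kappa> \<omega>) A = real_cond_exp M H (\<lambda>\<omega>. indicator A (J \<omega>)) \<omega>)"

definition jacod_density ::
    "'a measure \<Rightarrow> (real \<Rightarrow> 'a measure) \<Rightarrow> 'e topology \<Rightarrow> ('a \<Rightarrow> 'e) \<Rightarrow>
     (real \<Rightarrow> 'a \<Rightarrow> 'e measure) \<Rightarrow> ('e \<Rightarrow> 'a \<Rightarrow> real \<Rightarrow> real) \<Rightarrow> bool" where
  "jacod_density M F E J \<kappa> p \<longleftrightarrow>
     (\<lambda>(x, \<omega>, t). p x \<omega> t) \<in> borel_measurable (borel_of E \<Otimes>\<^sub>M optional_sigma M F) \<and>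
     (\<forall>x\<in>topspace E. \<forall>\<omega>\<in>space M. (\<forall>t\<ge>0. 0 \<le> p x \<omega> t) \<and> cadlag (p x \<omega>)) \<and>
     (\<forall>t\<ge>0. AE \<omega> in M. \<kappa> t \<omega> = density (distr M (borel_of E) J) (\<lambda>x. ennreal (p x \<omega> t))) \<and>
     (\<forall>x\<in>topspace E. martingale M F (p x))"


section \<open>The time at which a density jumps to zero\<close>

definition zero_time :: "(real \<Rightarrow> real) \<Rightarrow> ennreal" where
  "zero_time f = Inf {ennreal t | t. t \<ge> 0 \<and> f t = 0}"

definition left_limit :: "(real \<Rightarrow> real) \<Rightarrow> real \<Rightarrow> real" where
  "left_limit f t = (if t = 0 then f 0 else Lim (at_left t) f)"

definition jump_to_zero_time :: "(real \<Rightarrow> real) \<Rightarrow> ennreal" where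
  "jump_to_zero_time f =
     (if zero_time f < \<infinity> \<and> left_limit f (enn2real (zero_time f)) > 0 then zero_time f else \<infinity>)"

end

theory Submission
  imports Defs
begin

text \<open>
  For nonnegative families \<open>X\<close> and times \<open>T\<^sup>x\<close>, disintegrating with respect to the law of \<open>J\<close>
  turns expectations under the enlarged filtration into expectations under \<open>\<bold>F\<close>:
  \<open>\<E>[X\<^sup>J\<^sub>T / p\<^sup>J\<^sub>T; A] = \<integral> \<E>[X\<^sup>x\<^sub>T; p\<^sup>x\<^sub>T > 0, A\<^sup>x] \<gamma>(dx)\<close>, because optional sampling replaces the density
  at a later time by \<open>p\<^sup>x\<^sub>T\<close>. Apply this to the first time \<open>T\<^sup>x\<^sub>n\<close> at which \<open>p\<^sup>x < 1/(n+1)\<close> or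
  \<open>X\<^sup>x > n+1\<close>. If \<open>p\<^sup>x\<close> never jumps to zero, then \<open>p\<^sup>x > 0\<close> at \<open>T\<^sup>x\<^sub>n\<close>, the restriction disappears,
  and the martingale property of the stopped \<open>X\<^sup>x\<close> passes to \<open>X\<^sup>J / p\<^sup>J\<close>; these times localize
  since \<open>p\<^sup>J\<close> stays away from zero on compacts. Conversely, for \<open>X = 1\<close>, a local martingale
  \<open>1 / p\<^sup>J\<close> stopped at \<open>T\<^sup>J\<^sub>n\<close> is a true martingale, so its expectation is constant, which forces
  \<open>\<integral> \<P>[T\<^sup>x\<^sub>n > 0, p\<^sup>x = 0 at T\<^sup>x\<^sub>n \<and> t] \<gamma>(dx) = 0\<close>, i.e. no jump to zero.
\<close>

section \<open>Optional sampling\<close>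

text \<open>The obstacle is uniformity in \<open>x\<close>. Each \<open>X x\<close> comes with a
  localizing sequence of its own, and nothing makes these sequences jointly measurable in
  \<open>x\<close>, so they cannot be evaluated at \<open>J\<close>. The times
  \<open>T\<^sup>x\<^sub>n\<close> are explicit functionals of the paths instead. Before such a time
  \<open>X x\<close> is at most \<open>n+1\<close>, which already yields optional stopping for a
  nonnegative local martingale: the value at the time itself may overshoot, but Fatou bounds its
  mean. The bound \<open>1 / p \<le> n+1\<close> before that time plays the same role in the
  converse. Disintegration is available only at deterministic times. A bounded continuous substitute
  for the quotient makes optional sampling applicable to \<open>p x\<close> without uniform
  integrability; multiplied by the density it tends to zero where the density vanishes, whence the
  restriction to a positive density. That \<open>p\<close> along \<open>J\<close> stays away from
  zero rests on an estimate: a nonnegative martingale that has dropped below \<open>1/(n+1)\<close>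
  keeps a mean of at most \<open>2/(n+1)\<close>, and disintegration turns this mean into a
  probability. The same estimate gives absorption at zero, which links a jump to zero with an exit
  time.\<close>

definition upper_grid :: "nat \<Rightarrow> real \<Rightarrow> real \<Rightarrow> real" where
  "upper_grid k t r = min t ((real (nat \<lfloor>real (Suc k) * r\<rfloor>) + 1) / real (Suc k))"

lemma nat_floor_eq_iff:
  fixes x :: real
  assumes "0 \<le> x"
  shows "nat \<lfloor>x\<rfloor> = i \<longleftrightarrow> real i \<le> x \<and> x < real i + 1"
  using assms by linarith

lemma grid_cell_iff:
  assumes "0 \<le> r"
  shows "nat \<lfloor>real (Suc k) * r\<rfloor> = i \<longleftrightarrow>
    real i / real (Suc k) \<le> r \<and> r < (real i + 1) / real (Suc k)"
  using assms by (subst nat_floor_eq_iff) (auto simp: field_simps)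

lemma upper_grid_le: "upper_grid k t r \<le> t"
  by (simp add: upper_grid_def)

lemma upper_grid_ge:
  assumes "0 \<le> r" "r \<le> t"
  shows "r \<le> upper_grid k t r" "r < t \<Longrightarrow> r < upper_grid k t r"
  using assms grid_cell_iff[of r k "nat \<lfloor>real (Suc k) * r\<rfloor>"] by (auto simp: upper_grid_def)

lemma upper_grid_upper:
  assumes "0 \<le> r"
  shows "upper_grid k t r \<le> r + inverse (real (Suc k))"
proof -
  have "real (nat \<lfloor>real (Suc k) * r\<rfloor>) / real (Suc k) \<le> r"
    using assms grid_cell_iff[of r k "nat \<lfloor>real (Suc k) * r\<rfloor>"] by auto
  then show ?thesis
    by (auto simp: upper_grid_def add_divide_distrib inverse_eq_divide min_le_iff_disj)
qed

lemma upper_grid_tendsto: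
  assumes "0 \<le> r" "r \<le> t"
  shows "(\<lambda>k. upper_grid k t r) \<longlonglongrightarrow> r"
proof (rule tendsto_sandwich)
  show "\<forall>\<^sub>F k in sequentially. r \<le> upper_grid k t r"
    using upper_grid_ge assms by simp
  show "\<forall>\<^sub>F k in sequentially. upper_grid k t r \<le> r + inverse (real (Suc k))"
    using upper_grid_upper assms by simp
  show "(\<lambda>k. r + inverse (real (Suc k))) \<longlonglongrightarrow> r"
    using LIMSEQ_inverse_real_of_nat_add[of r] .
qed simp

text \<open>The grid point lies strictly to the right of \<open>r\<close> when \<open>r < t\<close>,
  so the limit along \<open>at_right r\<close> applies. At \<open>r = t\<close> the truncation by
  \<open>t\<close> makes the sequence constant; it also ensures that no value of \<open>f\<close>
  after time \<open>t\<close> is used.\<close>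

lemma right_continuous_upper_grid:
  fixes f :: "real \<Rightarrow> 'b::topological_space"
  assumes "0 \<le> r" "r \<le> t" and "(f \<longlongrightarrow> f r) (at_right r)"
  shows "(\<lambda>k. f (upper_grid k t r)) \<longlonglongrightarrow> f r"
proof (cases "r = t")
  case True
  then have "upper_grid k t r = r" for k
    using upper_grid_ge(1)[OF assms(1,2)] upper_grid_le[of k t r] by (simp add: antisym)
  then show ?thesis by simp
next
  case False
  then have "\<And>k. upper_grid k t r \<in> {r<..}"
    using upper_grid_ge(2)[OF assms(1,2)] assms by auto
  then have "filterlim (\<lambda>k. upper_grid k t r) (at_right r) sequentially"
    using upper_grid_tendsto[OF assms(1,2)] unfolding filterlim_at
    by (auto intro!: always_eventually) (metis less_irrefl)
  then show ?thesis by (rule filterlim_compose[OF assms(3)])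
qed

text \<open>The discretized time takes countably many values, so sampling there is a countable
  composition, and right continuity carries measurability to the limit. Since the grid never passes
  \<open>t\<close>, the result can be used with \<open>H = F t\<close> or with a joint field at time
  \<open>t\<close>, not only with \<open>M\<close>.\<close>

lemma measurable_sample_right_continuous:
  fixes Y :: "'a \<Rightarrow> real \<Rightarrow> real"
  assumes R: "R \<in> borel_measurable H" "\<And>\<omega>. \<omega> \<in> space H \<Longrightarrow> 0 \<le> R \<omega> \<and> R \<omega> \<le> t"
    and Y: "\<And>u. 0 \<le> u \<Longrightarrow> u \<le> t \<Longrightarrow> (\<lambda>\<omega>. Y \<omega> u) \<in> borel_measurable H"
    and rc: "\<And>\<omega> u. \<omega> \<in> space H \<Longrightarrow> 0 \<le> u \<Longrightarrow> (Y \<omega> \<longlongrightarrow> Y \<omega> u) (at_right u)"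
  shows "(\<lambda>\<omega>. Y \<omega> (R \<omega>)) \<in> borel_measurable H"
proof (cases "0 \<le> t")
  case True
  show ?thesis
  proof (rule borel_measurable_LIMSEQ_real)
    fix k
    have "(\<lambda>\<omega>. nat \<lfloor>real (Suc k) * R \<omega>\<rfloor>) \<in> measurable H (count_space UNIV)"
      using R(1) by measurable
    then show "(\<lambda>\<omega>. Y \<omega> (upper_grid k t (R \<omega>))) \<in> borel_measurable H"
      unfolding upper_grid_def
      by (rule measurable_compose_countable[where f = "\<lambda>i \<omega>. Y \<omega> (min t ((real i + 1) / real (Suc k)))", rotated])
        (intro Y, use True in auto)
  next
    fix \<omega> assume "\<omega> \<in> space H"
    then show "(\<lambda>k. Y \<omega> (upper_grid k t (R \<omega>))) \<longlonglongrightarrow> Y \<omega> (R \<omega>)"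
      using R(2) rc by (intro right_continuous_upper_grid) auto
  qed
next
  case False
  then have "space H = {}" using R(2) by force
  then show ?thesis by (simp add: measurable_def)
qed

locale filtered_prob_space = prob_space M for M :: "'a measure" +
  fixes F :: "real \<Rightarrow> 'a measure"
  assumes filtered: "filtered_space M F"
begin

lemma subalgebra_F: "0 \<le> t \<Longrightarrow> subalgebra M (F t)"
  using filtered by (simp add: filtered_space_def)

lemma space_F [simp]: "0 \<le> t \<Longrightarrow> space (F t) = space M"
  using subalgebra_F by (simp add: subalgebra_def)

lemma sets_F_mono: "0 \<le> s \<Longrightarrow> s \<le> t \<Longrightarrow> A \<in> sets (F s) \<Longrightarrow> A \<in> sets (F t)"
  using filtered by (auto simp: filtered_space_def)

lemma sets_F_sets: "0 \<le> t \<Longrightarrow> A \<in> sets (F t) \<Longrightarrow> A \<in> sets M"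
  using subalgebra_F by (auto simp: subalgebra_def)

lemma subalgebra_F_mono:
  assumes "0 \<le> s" "s \<le> t"
  shows "subalgebra (F t) (F s)"
  using assms filtered unfolding subalgebra_def by (simp add: filtered_space_def subalgebra_def)

lemma measurable_F_mono:
  assumes "0 \<le> s" "s \<le> t" "f \<in> measurable (F s) N"
  shows "f \<in> measurable (F t) N"
  using measurable_from_subalg[OF subalgebra_F_mono[OF assms(1,2)] assms(3)] .

lemma measurable_F_M:
  assumes "0 \<le> t" "f \<in> measurable (F t) N"
  shows "f \<in> measurable M N"
  using measurable_from_subalg[OF subalgebra_F[OF assms(1)] assms(2)] .

lemma sigma_finite_F:
  assumes "0 \<le> t"
  shows "sigma_finite_subalgebra M (F t)"
proof -
  interpret finite_measure_subalgebra M "F t"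
    by unfold_locales (rule subalgebra_F[OF assms])
  show ?thesis by (rule sigma_finite_subalgebra_axioms)
qed

lemma martingaleD:
  assumes "martingale M F Y" "0 \<le> t"
  shows "(\<lambda>\<omega>. Y \<omega> t) \<in> borel_measurable M" "integrable M (\<lambda>\<omega>. Y \<omega> t)"
  using assms by (auto simp: martingale_def)

text \<open>Optional sampling weights the martingale by bounded random variables, hence the
  martingale property in this tested form.\<close>

lemma martingale_cond:
  assumes Y: "martingale M F Y" and st: "0 \<le> s" "s \<le> t"
    and f: "f \<in> borel_measurable (F s)" "\<And>\<omega>. \<omega> \<in> space M \<Longrightarrow> \<bar>f \<omega>\<bar> \<le> (c::real)"
  shows "(\<integral>\<omega>. f \<omega> * Y \<omega> t \<partial>M) = (\<integral>\<omega>. f \<omega> * Y \<omega> s \<partial>M)"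
    and "integrable M (\<lambda>\<omega>. f \<omega> * Y \<omega> t)"
proof -
  interpret sigma_finite_subalgebra M "F s" using sigma_finite_F st by simp
  have [measurable]: "f \<in> borel_measurable M" using measurable_F_M f st by blast
  have Yt: "integrable M (\<lambda>\<omega>. Y \<omega> t)" using Y st by (simp add: martingale_def)
  show int: "integrable M (\<lambda>\<omega>. f \<omega> * Y \<omega> t)"
  proof (rule Bochner_Integration.integrable_bound)
    show "integrable M (\<lambda>\<omega>. c * Y \<omega> t)" using Yt by simp
    show "AE \<omega> in M. norm (f \<omega> * Y \<omega> t) \<le> norm (c * Y \<omega> t)"
      using f(2) by (intro AE_I2) (force simp: abs_mult intro!: mult_right_mono)
    show "(\<lambda>\<omega>. f \<omega> * Y \<omega> t) \<in> borel_measurable M" using Yt by measurable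
  qed
  have "(\<integral>\<omega>. f \<omega> * Y \<omega> t \<partial>M) = (\<integral>\<omega>. f \<omega> * real_cond_exp M (F s) (\<lambda>\<omega>. Y \<omega> t) \<omega> \<partial>M)"
    using Yt by (intro real_cond_exp_intg(2)[symmetric] int f) auto
  also have "\<dots> = (\<integral>\<omega>. f \<omega> * Y \<omega> s \<partial>M)"
  proof (rule integral_cong_AE)
    have "AE \<omega> in M. real_cond_exp M (F s) (\<lambda>\<omega>. Y \<omega> t) \<omega> = Y \<omega> s"
      using Y st unfolding martingale_def by blast
    then show "AE \<omega> in M. f \<omega> * real_cond_exp M (F s) (\<lambda>\<omega>. Y \<omega> t) \<omega> = f \<omega> * Y \<omega> s"
      by eventually_elim simp
    show "(\<lambda>\<omega>. f \<omega> * Y \<omega> s) \<in> borel_measurable M"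
      using martingaleD(1)[OF Y st(1)] by measurable
  qed measurable
  finally show "(\<integral>\<omega>. f \<omega> * Y \<omega> t \<partial>M) = (\<integral>\<omega>. f \<omega> * Y \<omega> s \<partial>M)" .
qed

text \<open>
  The weight \<open>\<Phi>\<close> keeps both integrands dominated (by a multiple of \<open>Y\<close> at time \<open>v\<close> and by a constant), so
  no uniform integrability is needed to pass from the grid approximations of \<open>R\<close> to \<open>R\<close>.
\<close>

lemma optional_sampling:
  assumes Y: "martingale M F Y" and \<Phi>: "adapted F \<Phi>"
    and nonneg: "\<And>\<omega> u. \<omega> \<in> space M \<Longrightarrow> 0 \<le> u \<Longrightarrow> 0 \<le> Y \<omega> u"
      "\<And>\<omega> u. \<omega> \<in> space M \<Longrightarrow> 0 \<le> u \<Longrightarrow> 0 \<le> \<Phi> \<omega> u"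
    and bounded: "\<And>\<omega> u. \<omega> \<in> space M \<Longrightarrow> 0 \<le> u \<Longrightarrow> \<Phi> \<omega> u \<le> c"
      "\<And>\<omega> u. \<omega> \<in> space M \<Longrightarrow> 0 \<le> u \<Longrightarrow> \<Phi> \<omega> u * Y \<omega> u \<le> c"
    and rc: "AE \<omega> in M. \<forall>u\<ge>0. (Y \<omega> \<longlongrightarrow> Y \<omega> u) (at_right u)"
      "AE \<omega> in M. \<forall>u\<ge>0. (\<Phi> \<omega> \<longlongrightarrow> \<Phi> \<omega> u) (at_right u)"
    and times: "0 \<le> s" "s \<le> t" "t \<le> v"
    and R: "\<And>\<omega>. \<omega> \<in> space M \<Longrightarrow> 0 \<le> R \<omega> \<and> R \<omega> \<le> t"
      "\<And>u. 0 \<le> u \<Longrightarrow> u \<le> t \<Longrightarrow> {\<omega>\<in>space M. R \<omega> < u} \<in> sets (F u)"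
    and D: "D \<in> sets (F s)" "\<And>\<omega>. \<omega> \<in> D \<Longrightarrow> s \<le> R \<omega>"
    and meas [measurable]: "(\<lambda>\<omega>. Y \<omega> (R \<omega>)) \<in> borel_measurable M"
      "(\<lambda>\<omega>. \<Phi> \<omega> (R \<omega>)) \<in> borel_measurable M"
  shows "(\<integral>\<^sup>+\<omega>. indicator D \<omega> * ennreal (\<Phi> \<omega> (R \<omega>) * Y \<omega> v) \<partial>M) =
    (\<integral>\<^sup>+\<omega>. indicator D \<omega> * ennreal (\<Phi> \<omega> (R \<omega>) * Y \<omega> (R \<omega>)) \<partial>M)"
proof -
  define d where "d = (\<lambda>\<omega>. indicator D \<omega> :: real)"
  have DM: "D \<in> sets M" and Dsp: "D \<subseteq> space M"
    using D(1) times sets_F_sets sets.sets_into_space by blast+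
  have [measurable]: "d \<in> borel_measurable M" using DM by (simp add: d_def)
  have d01: "0 \<le> d \<omega>" "d \<omega> \<le> 1" for \<omega> by (auto simp: d_def)
  have Yv: "integrable M (\<lambda>\<omega>. Y \<omega> v)" using Y times by (simp add: martingale_def)
  have [measurable]: "(\<lambda>\<omega>. Y \<omega> v) \<in> borel_measurable M" using Yv by simp
  have c0: "0 \<le> c" using bounded(1) nonneg(2) not_empty times by (meson ex_in_conv order_trans)
  have t0: "0 \<le> t" using times by simp
  define a where "a = (\<lambda>k i. min t ((real i + 1) / real (Suc k)))"
  have a: "0 \<le> a k i" "a k i \<le> t" for k i using t0 by (auto simp: a_def)
  define C where "C = (\<lambda>k i. {\<omega>\<in>D. nat \<lfloor>real (Suc k) * R \<omega>\<rfloor> = i})"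
  \<comment> \<open>On the cell \<open>C k i\<close> the grid time is the constant
    \<open>a k i\<close>, so the cell must be an event at that time. An empty cell is treated apart
    because \<open>a k i\<close> may then precede \<open>s\<close>; a point of a nonempty cell gives
    \<open>s \<le> a k i\<close>, which places \<open>D\<close> in \<open>F (a k i)\<close>.\<close>
  have CF: "C k i \<in> sets (F (a k i))" for k i
  proof (cases "C k i = {}")
    case False
    then obtain \<omega>0 where "\<omega>0 \<in> C k i" by auto
    then have w0: "\<omega>0 \<in> D" "nat \<lfloor>real (Suc k) * R \<omega>0\<rfloor> = i" by (auto simp: C_def)
    have R0: "0 \<le> R \<omega>0" "R \<omega>0 \<le> t" "s \<le> R \<omega>0" using w0 Dsp R D by auto
    have cell0: "real i / real (Suc k) \<le> R \<omega>0" "R \<omega>0 < (real i + 1) / real (Suc k)"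
      using grid_cell_iff[OF R0(1), of k i] w0 by auto
    have sa: "s \<le> a k i" using cell0 R0 by (auto simp: a_def)
    have ia: "real i / real (Suc k) \<le> a k i" "real i / real (Suc k) \<le> t"
      using cell0 R0 by (auto simp: a_def divide_right_mono)
    have "{\<omega>\<in>space M. R \<omega> < (real i + 1) / real (Suc k)} \<in> sets (F (a k i))"
    proof (cases "(real i + 1) / real (Suc k) \<le> t")
      case True
      then have "a k i = (real i + 1) / real (Suc k)" by (simp add: a_def)
      then show ?thesis using R(2)[OF a(1)[of k i] a(2)[of k i]] by (simp only:)
    next
      case False
      then have "{\<omega>\<in>space M. R \<omega> < (real i + 1) / real (Suc k)} = space (F (a k i))"
        using R(1) a by (fastforce)
      then show ?thesis by (metis sets.top)
    qed
    moreover have "{\<omega>\<in>space M. R \<omega> < real i / real (Suc k)} \<in> sets (F (a k i))"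
      using R(2)[of "real i / real (Suc k)"] ia by (intro sets_F_mono[OF _ ia(1)]) auto
    moreover have "D \<in> sets (F (a k i))" using sets_F_mono D(1) sa times by blast
    moreover have "(nat \<lfloor>real (Suc k) * R \<omega>\<rfloor> = i) \<longleftrightarrow>
        real i / real (Suc k) \<le> R \<omega> \<and> R \<omega> < (real i + 1) / real (Suc k)" if "\<omega> \<in> D" for \<omega>
      using Dsp R(1) that by (intro grid_cell_iff) auto
    then have "C k i = {\<omega>\<in>D. real i / real (Suc k) \<le> R \<omega> \<and> R \<omega> < (real i + 1) / real (Suc k)}"
      unfolding C_def by blast
    then have "C k i = D \<inter> ({\<omega>\<in>space M. R \<omega> < (real i + 1) / real (Suc k)} -
        {\<omega>\<in>space M. R \<omega> < real i / real (Suc k)})"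
      using Dsp by (auto simp: not_less simp del: of_nat_Suc)
    ultimately show ?thesis by simp
  qed simp
  define g where "g = (\<lambda>k \<omega>. upper_grid k t (R \<omega>))"
  have g: "0 \<le> g k \<omega>" "g k \<omega> \<le> t" if "\<omega> \<in> space M" for k \<omega>
    using upper_grid_ge(1)[of "R \<omega>" t k] upper_grid_le R(1)[OF that] by (auto simp: g_def)
  define N where "N = (\<lambda>k. nat \<lfloor>real (Suc k) * t\<rfloor>)"
  \<comment> \<open>At most one cell contains a given \<open>\<omega>\<close>. Sampling at the
    random grid time thus becomes a finite sum over deterministic times, to which
    \<open>martingale_cond\<close> applies term by term.\<close>
  have decomp: "d \<omega> * f (g k \<omega>) = (\<Sum>i\<le>N k. indicator (C k i) \<omega> * f (a k i))"
    if "\<omega> \<in> space M" for \<omega> k and f :: "real \<Rightarrow> real"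
  proof -
    let ?i = "nat \<lfloor>real (Suc k) * R \<omega>\<rfloor>"
    have "?i \<le> N k" using R(1)[OF that] unfolding N_def
      by (intro nat_mono floor_mono mult_left_mono) auto
    have "(\<Sum>i\<le>N k. indicator (C k i) \<omega> * f (a k i)) = (\<Sum>i\<in>{?i}. indicator (C k i) \<omega> * f (a k i))"
      using \<open>?i \<le> N k\<close> by (intro sum.mono_neutral_right) (auto simp: C_def)
    also have "\<dots> = d \<omega> * f (g k \<omega>)"
      by (simp add: d_def C_def g_def upper_grid_def a_def indicator_def)
    finally show ?thesis by simp
  qed
  have term_meas: "(\<lambda>\<omega>. indicator (C k i) \<omega> * \<Phi> \<omega> (a k i)) \<in> borel_measurable (F (a k i))" for k i
    using CF \<Phi> a[of k i] by (auto simp: adapted_def)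
  have term_bound: "\<bar>indicator (C k i) \<omega> * \<Phi> \<omega> (a k i)\<bar> \<le> c" if "\<omega> \<in> space M" for k i \<omega>
    using bounded(1)[OF that a(1)] nonneg(2)[OF that a(1)] c0 by (auto simp: indicator_def)
  have step: "(\<integral>\<omega>. d \<omega> * (\<Phi> \<omega> (g k \<omega>) * Y \<omega> v) \<partial>M) = (\<integral>\<omega>. d \<omega> * (\<Phi> \<omega> (g k \<omega>) * Y \<omega> (g k \<omega>)) \<partial>M)" for k
  proof -
    have e1: "d \<omega> * (\<Phi> \<omega> (g k \<omega>) * Y \<omega> v) = (\<Sum>i\<le>N k. indicator (C k i) \<omega> * \<Phi> \<omega> (a k i) * Y \<omega> v)"
      and e2: "d \<omega> * (\<Phi> \<omega> (g k \<omega>) * Y \<omega> (g k \<omega>)) =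
        (\<Sum>i\<le>N k. indicator (C k i) \<omega> * \<Phi> \<omega> (a k i) * Y \<omega> (a k i))"
      if "\<omega> \<in> space M" for \<omega>
      using decomp[OF that, of "\<lambda>u. \<Phi> \<omega> u * Y \<omega> v" k] decomp[OF that, of "\<lambda>u. \<Phi> \<omega> u * Y \<omega> u" k]
      by (simp_all add: mult.assoc)
    have av: "a k i \<le> v" for i using a[of k i] times by simp
    have "(\<integral>\<omega>. d \<omega> * (\<Phi> \<omega> (g k \<omega>) * Y \<omega> v) \<partial>M) =
        (\<integral>\<omega>. (\<Sum>i\<le>N k. indicator (C k i) \<omega> * \<Phi> \<omega> (a k i) * Y \<omega> v) \<partial>M)"
      using e1 by (intro Bochner_Integration.integral_cong refl) simp
    also have "\<dots> = (\<Sum>i\<le>N k. \<integral>\<omega>. indicator (C k i) \<omega> * \<Phi> \<omega> (a k i) * Y \<omega> v \<partial>M)"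
      by (intro Bochner_Integration.integral_sum martingale_cond(2)[OF Y a(1) av term_meas term_bound])
    also have "\<dots> = (\<Sum>i\<le>N k. \<integral>\<omega>. indicator (C k i) \<omega> * \<Phi> \<omega> (a k i) * Y \<omega> (a k i) \<partial>M)"
      by (intro sum.cong refl martingale_cond(1)[OF Y a(1) av term_meas term_bound])
    also have "\<dots> = (\<integral>\<omega>. (\<Sum>i\<le>N k. indicator (C k i) \<omega> * \<Phi> \<omega> (a k i) * Y \<omega> (a k i)) \<partial>M)"
      by (intro Bochner_Integration.integral_sum[symmetric]
          martingale_cond(2)[OF Y a(1) order_refl term_meas term_bound])
    also have "\<dots> = (\<integral>\<omega>. d \<omega> * (\<Phi> \<omega> (g k \<omega>) * Y \<omega> (g k \<omega>)) \<partial>M)"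
      using e2 by (intro Bochner_Integration.integral_cong refl) simp
    finally show ?thesis .
  qed
  have meas_g: "(\<lambda>\<omega>. d \<omega> * \<Phi> \<omega> (g k \<omega>)) \<in> borel_measurable M" 
      "(\<lambda>\<omega>. d \<omega> * Y \<omega> (g k \<omega>)) \<in> borel_measurable M" for k
  proof -
    have "(\<lambda>\<omega>. \<Sum>i\<le>N k. indicator (C k i) \<omega> * Z \<omega> (a k i)) \<in> borel_measurable M"
      if "adapted F Z" for Z
    proof (intro borel_measurable_sum borel_measurable_times)
      fix i
      show "(\<lambda>\<omega>. Z \<omega> (a k i)) \<in> borel_measurable M"
        using that a(1) measurable_F_M[OF a(1)] unfolding adapted_def by blast
      show "indicator (C k i) \<in> borel_measurable M"
        using CF sets_F_sets a(1) by (intro borel_measurable_indicator) blast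
    qed
    then have *: "(\<lambda>\<omega>. d \<omega> * Z \<omega> (g k \<omega>)) \<in> borel_measurable M" if "adapted F Z" for Z
      using that by (subst measurable_cong[OF decomp])
    from *[OF \<Phi>] *[of Y] Y show "(\<lambda>\<omega>. d \<omega> * \<Phi> \<omega> (g k \<omega>)) \<in> borel_measurable M" 
      "(\<lambda>\<omega>. d \<omega> * Y \<omega> (g k \<omega>)) \<in> borel_measurable M"
      by (simp_all add: martingale_def)
  qed
  \<comment> \<open>\<open>d\<close> is idempotent, so the integrand with both sampled factors is a
    product of the two functions whose measurability is known from \<open>meas_g\<close>.\<close>
  have dd: "d \<omega> * d \<omega> = d \<omega>" for \<omega> by (simp add: d_def indicator_def)
  have lim1: "(\<lambda>k. \<integral>\<omega>. d \<omega> * (\<Phi> \<omega> (g k \<omega>) * Y \<omega> v) \<partial>M) \<longlonglongrightarrow> (\<integral>\<omega>. d \<omega> * (\<Phi> \<omega> (R \<omega>) * Y \<omega> v) \<partial>M)"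
  proof (rule integral_dominated_convergence[where w = "\<lambda>\<omega>. c * Y \<omega> v"])
    show "(\<lambda>\<omega>. d \<omega> * (\<Phi> \<omega> (g k \<omega>) * Y \<omega> v)) \<in> borel_measurable M" for k
      using borel_measurable_times[OF meas_g(1)[of k], of "\<lambda>\<omega>. Y \<omega> v"] by (simp add: mult.assoc)
    show "AE \<omega> in M. (\<lambda>k. d \<omega> * (\<Phi> \<omega> (g k \<omega>) * Y \<omega> v)) \<longlonglongrightarrow> d \<omega> * (\<Phi> \<omega> (R \<omega>) * Y \<omega> v)"
      using rc(2) AE_space
    proof eventually_elim
      case (elim \<omega>)
      then show ?case unfolding g_def
        using R(1) by (intro tendsto_intros right_continuous_upper_grid) auto
    qed
    show "AE \<omega> in M. norm (d \<omega> * (\<Phi> \<omega> (g k \<omega>) * Y \<omega> v)) \<le> c * Y \<omega> v" for k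
    proof (rule AE_I2)
      fix \<omega> assume w: "\<omega> \<in> space M"
      have "d \<omega> * (\<Phi> \<omega> (g k \<omega>) * Y \<omega> v) \<le> 1 * (c * Y \<omega> v)"
        using d01 bounded(1)[OF w g(1)[OF w]] nonneg(1)[OF w, of v] nonneg(2)[OF w g(1)[OF w]] times c0
        by (intro mult_mono) auto
      then show "norm (d \<omega> * (\<Phi> \<omega> (g k \<omega>) * Y \<omega> v)) \<le> c * Y \<omega> v"
        using d01 nonneg(1)[OF w, of v] nonneg(2)[OF w g(1)[OF w]] times by simp
    qed
  qed (use Yv in simp_all)
  have lim2: "(\<lambda>k. \<integral>\<omega>. d \<omega> * (\<Phi> \<omega> (g k \<omega>) * Y \<omega> (g k \<omega>)) \<partial>M) \<longlonglongrightarrow> (\<integral>\<omega>. d \<omega> * (\<Phi> \<omega> (R \<omega>) * Y \<omega> (R \<omega>)) \<partial>M)"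
  proof (rule integral_dominated_convergence[where w = "\<lambda>\<omega>. c"])
    show "(\<lambda>\<omega>. d \<omega> * (\<Phi> \<omega> (g k \<omega>) * Y \<omega> (g k \<omega>))) \<in> borel_measurable M" for k
    proof -
      have "(\<lambda>\<omega>. d \<omega> * (\<Phi> \<omega> (g k \<omega>) * Y \<omega> (g k \<omega>))) = (\<lambda>\<omega>. (d \<omega> * \<Phi> \<omega> (g k \<omega>)) * (d \<omega> * Y \<omega> (g k \<omega>)))"
        using dd by (auto simp: fun_eq_iff algebra_simps)
      then show ?thesis using meas_g by simp
    qed
    show "AE \<omega> in M. (\<lambda>k. d \<omega> * (\<Phi> \<omega> (g k \<omega>) * Y \<omega> (g k \<omega>))) \<longlonglongrightarrow> d \<omega> * (\<Phi> \<omega> (R \<omega>) * Y \<omega> (R \<omega>))"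
      using rc AE_space
    proof eventually_elim
      case (elim \<omega>)
      then show ?case unfolding g_def
        using R(1) by (intro tendsto_intros right_continuous_upper_grid) auto
    qed
    show "AE \<omega> in M. norm (d \<omega> * (\<Phi> \<omega> (g k \<omega>) * Y \<omega> (g k \<omega>))) \<le> c" for k
    proof (rule AE_I2)
      fix \<omega> assume w: "\<omega> \<in> space M"
      have "d \<omega> * (\<Phi> \<omega> (g k \<omega>) * Y \<omega> (g k \<omega>)) \<le> 1 * c"
        using d01 bounded(2)[OF w g(1)[OF w]] nonneg(1)[OF w g(1)[OF w]] nonneg(2)[OF w g(1)[OF w]]
        by (intro mult_mono) auto
      then show "norm (d \<omega> * (\<Phi> \<omega> (g k \<omega>) * Y \<omega> (g k \<omega>))) \<le> c"
        using d01 nonneg(1)[OF w g(1)[OF w]] nonneg(2)[OF w g(1)[OF w]] by simp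
    qed
  qed simp_all
  have eq: "(\<integral>\<omega>. d \<omega> * (\<Phi> \<omega> (R \<omega>) * Y \<omega> v) \<partial>M) = (\<integral>\<omega>. d \<omega> * (\<Phi> \<omega> (R \<omega>) * Y \<omega> (R \<omega>)) \<partial>M)"
    using LIMSEQ_unique[OF lim1[unfolded step] lim2] .
  have nn: "(\<integral>\<^sup>+\<omega>. indicator D \<omega> * ennreal (f \<omega>) \<partial>M) = ennreal (\<integral>\<omega>. d \<omega> * f \<omega> \<partial>M)"
    if "integrable M (\<lambda>\<omega>. d \<omega> * f \<omega>)" "\<And>\<omega>. \<omega> \<in> space M \<Longrightarrow> 0 \<le> f \<omega>" for f
    using that d01
    by (subst nn_integral_eq_integral[symmetric])
      (auto intro!: nn_integral_cong simp: d_def indicator_def)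
  have \<Phi>R: "0 \<le> \<Phi> \<omega> (R \<omega>)" "\<Phi> \<omega> (R \<omega>) \<le> c" "\<Phi> \<omega> (R \<omega>) * Y \<omega> (R \<omega>) \<le> c"
      "0 \<le> Y \<omega> (R \<omega>)" "0 \<le> Y \<omega> v" if "\<omega> \<in> space M" for \<omega>
    using nonneg bounded R(1) that times by auto
  have int1: "integrable M (\<lambda>\<omega>. d \<omega> * (\<Phi> \<omega> (R \<omega>) * Y \<omega> v))"
  proof (rule Bochner_Integration.integrable_bound)
    show "AE \<omega> in M. norm (d \<omega> * (\<Phi> \<omega> (R \<omega>) * Y \<omega> v)) \<le> norm (c * Y \<omega> v)"
    proof (rule AE_I2)
      fix \<omega> assume w: "\<omega> \<in> space M"
      have "d \<omega> * (\<Phi> \<omega> (R \<omega>) * Y \<omega> v) \<le> 1 * (c * Y \<omega> v)"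
        using d01 \<Phi>R[OF w] c0 by (intro mult_mono) auto
      then show "norm (d \<omega> * (\<Phi> \<omega> (R \<omega>) * Y \<omega> v)) \<le> norm (c * Y \<omega> v)"
        using d01 \<Phi>R[OF w] c0 by simp
    qed
  qed (use Yv in simp_all)
  have int2: "integrable M (\<lambda>\<omega>. d \<omega> * (\<Phi> \<omega> (R \<omega>) * Y \<omega> (R \<omega>)))"
  proof (rule integrable_const_bound[where B = c])
    show "AE \<omega> in M. norm (d \<omega> * (\<Phi> \<omega> (R \<omega>) * Y \<omega> (R \<omega>))) \<le> c"
    proof (rule AE_I2)
      fix \<omega> assume w: "\<omega> \<in> space M"
      have "d \<omega> * (\<Phi> \<omega> (R \<omega>) * Y \<omega> (R \<omega>)) \<le> 1 * c"
        using d01 \<Phi>R[OF w] c0 by (intro mult_mono) auto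
      then show "norm (d \<omega> * (\<Phi> \<omega> (R \<omega>) * Y \<omega> (R \<omega>))) \<le> c"
        using d01 \<Phi>R[OF w] by simp
    qed
  qed simp
  show ?thesis using eq nn[OF int1] nn[OF int2] \<Phi>R by simp
qed

end

section \<open>Times capped at a deterministic horizon\<close>

abbreviation cap :: "real \<Rightarrow> ennreal \<Rightarrow> real" where
  "cap t a \<equiv> enn2real (min (ennreal t) a)"

text \<open>The minimum is at most \<open>ennreal t\<close>, so the default value of
  \<open>enn2real\<close> at \<open>\<infinity>\<close> is never met, even for
  \<open>a = \<infinity>\<close>.\<close>

lemma ennreal_cap: "ennreal (cap t a) = min (ennreal t) a"
  by (simp add: min_less_iff_disj)

lemma cap_nonneg: "0 \<le> cap t a"
  by simp

lemma cap_le: "0 \<le> t \<Longrightarrow> cap t a \<le> t"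
  by (metis enn2real_ennreal enn2real_mono ennreal_less_top min.cobounded1)

text \<open>Below the horizon the cap is invisible: the events required by
  \<open>optional_sampling\<close> for a capped time are those of the time itself.\<close>

lemma cap_less_iff: "0 \<le> u \<Longrightarrow> u \<le> t \<Longrightarrow> cap t a < u \<longleftrightarrow> a < ennreal u"
  using ennreal_less_iff[OF cap_nonneg, of t a u]
  by (auto simp: ennreal_cap min_less_iff_disj ennreal_less_iff)

lemma cap_eq_left: "0 \<le> t \<Longrightarrow> ennreal t \<le> a \<Longrightarrow> cap t a = t"
  by (simp add: min_absorb1)

lemma cap_cap: "cap (cap t a) b = cap t (min a b)"
  by (simp add: ennreal_cap min.assoc)

lemma cap_min: "0 \<le> t \<Longrightarrow> cap t (min a b) = min (cap t a) (cap t b)"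
  by (smt (verit) cap_eq_left cap_le cap_less_iff cap_nonneg enn2real_mono ennreal_cap linorder_not_less
      min.absorb_iff2 min.assoc min.commute min_def)

lemma stopped_cap: "stopped X T \<omega> t = X \<omega> (cap t (T \<omega>))"
  by (simp add: stopped_def)

text \<open>Strictly before \<open>a\<close> the cap is inactive on a right neighbourhood, and from
  \<open>a\<close> on the stopped path is constant. The case \<open>a = \<infinity>\<close> is
  separate because no real endpoint bounds the neighbourhood.\<close>

lemma right_continuous_stop:
  fixes f :: "real \<Rightarrow> real"
  assumes rc: "\<And>u. 0 \<le> u \<Longrightarrow> (f \<longlongrightarrow> f u) (at_right u)" and u: "0 \<le> u"
  shows "((\<lambda>v. f (cap v a)) \<longlongrightarrow> f (cap u a)) (at_right u)"
proof (cases "ennreal u < a")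
  case True
  have "\<forall>\<^sub>F v in at_right u. cap v a = v"
  proof (cases "a = \<infinity>")
    case True
    then have "cap v a = v" if "u < v" for v using that u by simp
    then show ?thesis
      by (intro eventually_at_rightI[of u "u + 1"]) auto
  next
    case False
    then obtain r where r: "a = ennreal r" "0 \<le> r" by (cases a) auto
    then have "u < r" using True u by (simp add: ennreal_less_iff)
    show ?thesis
      using u r by (intro eventually_at_rightI[OF _ \<open>u < r\<close>]) (auto intro!: cap_eq_left ennreal_leI)
  qed
  then have "\<forall>\<^sub>F v in at_right u. f v = f (cap v a)" by eventually_elim simp
  moreover have "f (cap u a) = f u" using True u by (simp add: cap_eq_left less_imp_le)
  ultimately show ?thesis using rc[OF u] by (simp add: filterlim_cong)
next
  case False
  then have a: "a \<le> ennreal u" by simp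
  have h: "cap v a = cap u a" if "u < v" for v
  proof -
    have "a \<le> ennreal v" using a ennreal_leI[of u v] that by (meson less_imp_le order_trans)
    then show ?thesis using a by (simp only: min_absorb2)
  qed
  have "\<forall>\<^sub>F v in at_right u. f (cap v a) = f (cap u a)"
  proof (rule eventually_at_rightI)
    show "f (cap v a) = f (cap u a)" if "v \<in> {u<..<u + 1}" for v
      using h that by (metis greaterThanLessThan_iff)
  qed simp
  then show ?thesis by (rule tendsto_eventually)
qed

lemma measurable_cap:
  assumes "\<And>u. 0 \<le> u \<Longrightarrow> u \<le> t \<Longrightarrow> {\<omega>\<in>space H. T \<omega> < ennreal u} \<in> sets H" "0 \<le> t"
  shows "(\<lambda>\<omega>. cap t (T \<omega>)) \<in> borel_measurable H"
proof (subst borel_measurable_iff_less, intro allI)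
  fix a
  consider "a < 0" | "0 \<le> a" "a \<le> t" | "t < a" by linarith
  then show "{\<omega>\<in>space H. cap t (T \<omega>) < a} \<in> sets H"
  proof cases
    case 1
    then have "\<not> cap t (T \<omega>) < a" for \<omega> using cap_nonneg[of t "T \<omega>"] by linarith
    then have "{\<omega>\<in>space H. cap t (T \<omega>) < a} = {}" by blast
    then show ?thesis by (simp only: sets.empty_sets)
  next
    case 2
    then show ?thesis using assms(1)[of a] by (simp only: cap_less_iff[OF 2])
  next
    case 3
    then have "cap t (T \<omega>) < a" for \<omega> using cap_le[OF assms(2), of "T \<omega>"] by linarith
    then have "{\<omega>\<in>space H. cap t (T \<omega>) < a} = space H" by blast
    then show ?thesis by (simp only: sets.top)
  qed
qed

text \<open>The weight increases to 1 and equals 1 from some \<open>m\<close> on, so monotone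
  convergence removes it. Its purpose is that the weight times \<open>f\<close> never exceeds
  \<open>m + 1\<close>.\<close>

lemma nn_integral_truncation_tendsto:
  fixes f g :: "'a \<Rightarrow> real"
  assumes [measurable]: "D \<in> sets M" "f \<in> borel_measurable M" "g \<in> borel_measurable M"
  shows "(\<lambda>m. \<integral>\<^sup>+\<omega>. indicator D \<omega> * ennreal (1 / max 1 (f \<omega> / real (Suc m)) * g \<omega>) \<partial>M)
    \<longlonglongrightarrow> (\<integral>\<^sup>+\<omega>. indicator D \<omega> * ennreal (g \<omega>) \<partial>M)"
proof (rule nn_integral_LIMSEQ)
  have dec: "1 / max 1 (y / real (Suc m)) \<le> 1 / max 1 (y / real (Suc n))" if "m \<le> n" for y :: real and m n
  proof (cases "0 \<le> y")
    case True
    then have "y / real (Suc n) \<le> y / real (Suc m)" using that by (intro divide_left_mono) auto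
    then show ?thesis by (intro divide_left_mono) auto
  next
    case False
    then have "y / real (Suc i) \<le> 0" for i by (simp add: divide_nonpos_pos)
    then show ?thesis by (smt (verit))
  qed
  show "incseq (\<lambda>m \<omega>. indicator D \<omega> * ennreal (1 / max 1 (f \<omega> / real (Suc m)) * g \<omega>))"
  proof (rule incseq_SucI, rule le_funI, rule mult_left_mono)
    fix m \<omega>
    show "ennreal (1 / max 1 (f \<omega> / real (Suc m)) * g \<omega>)
        \<le> ennreal (1 / max 1 (f \<omega> / real (Suc (Suc m))) * g \<omega>)"
    proof (cases "0 \<le> g \<omega>")
      case True
      then show ?thesis by (intro ennreal_leI mult_right_mono dec) auto
    next
      case False
      then have "1 / max 1 (f \<omega> / real (Suc i)) * g \<omega> \<le> 0" for i
        by (intro mult_nonneg_nonpos) auto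
      then show ?thesis by (simp add: ennreal_neg)
    qed
  qed simp
  fix \<omega>
  have "\<forall>\<^sub>F m in sequentially. f \<omega> / real (Suc m) \<le> 1"
    using eventually_ge_at_top[of "nat \<lceil>f \<omega>\<rceil>"]
    by eventually_elim (use of_nat_ceiling in \<open>simp add: divide_le_eq\<close>)
  then have "\<forall>\<^sub>F m in sequentially. indicator D \<omega> * ennreal (1 / max 1 (f \<omega> / real (Suc m)) * g \<omega>)
      = indicator D \<omega> * ennreal (g \<omega>)"
    by eventually_elim (simp add: max_absorb1)
  then show "(\<lambda>m. indicator D \<omega> * ennreal (1 / max 1 (f \<omega> / real (Suc m)) * g \<omega>))
      \<longlonglongrightarrow> indicator D \<omega> * ennreal (g \<omega>)"
    by (rule tendsto_eventually)
qed measurable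

lemma nn_integral_indicator_eq_integral:
  fixes f :: "'a \<Rightarrow> real"
  assumes "D \<in> sets M" "integrable M f" "\<And>\<omega>. \<omega> \<in> space M \<Longrightarrow> 0 \<le> f \<omega>"
  shows "(\<integral>\<^sup>+\<omega>. indicator D \<omega> * ennreal (f \<omega>) \<partial>M) = ennreal (\<integral>\<omega>. indicator D \<omega> * f \<omega> \<partial>M)"
proof -
  have "integrable M (\<lambda>\<omega>. indicator D \<omega> * f \<omega>)"
    using integrable_mult_indicator[OF assms(1,2)] by simp
  then have "(\<integral>\<^sup>+\<omega>. ennreal (indicator D \<omega> * f \<omega>) \<partial>M) = ennreal (\<integral>\<omega>. indicator D \<omega> * f \<omega> \<partial>M)"
    using assms(3) by (intro nn_integral_eq_integral) auto
  then show ?thesis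
    by (simp add: ennreal_mult' ennreal_indicator)
qed

context filtered_prob_space
begin

text \<open>The weight in \<open>optional_sampling\<close> is taken as a function of
  \<open>Y\<close> itself, which bounds the weighted value at \<open>R\<close> by
  \<open>m + 1\<close>; letting \<open>m\<close> grow removes it on both sides. The time
  \<open>t\<close> is an intermediate point: the values at \<open>R\<close> and at \<open>s\<close>
  are both compared with the value at \<open>t\<close>.\<close>

lemma optional_sampling_eq:
  assumes Y: "martingale M F Y"
    and nonneg: "\<And>\<omega> u. \<omega> \<in> space M \<Longrightarrow> 0 \<le> u \<Longrightarrow> 0 \<le> Y \<omega> u"
    and rc: "AE \<omega> in M. \<forall>u\<ge>0. (Y \<omega> \<longlongrightarrow> Y \<omega> u) (at_right u)"
    and times: "0 \<le> s" "s \<le> t"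
    and R: "\<And>\<omega>. \<omega> \<in> space M \<Longrightarrow> 0 \<le> R \<omega> \<and> R \<omega> \<le> t"
      "\<And>u. 0 \<le> u \<Longrightarrow> u \<le> t \<Longrightarrow> {\<omega>\<in>space M. R \<omega> < u} \<in> sets (F u)"
    and D: "D \<in> sets (F s)" "\<And>\<omega>. \<omega> \<in> D \<Longrightarrow> s \<le> R \<omega>"
    and meas [measurable]: "(\<lambda>\<omega>. Y \<omega> (R \<omega>)) \<in> borel_measurable M"
  shows "(\<integral>\<^sup>+\<omega>. indicator D \<omega> * ennreal (Y \<omega> (R \<omega>)) \<partial>M) = (\<integral>\<^sup>+\<omega>. indicator D \<omega> * ennreal (Y \<omega> s) \<partial>M)"
proof -
  have DM [measurable]: "D \<in> sets M" using D(1) times sets_F_sets by blast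
  have int: "integrable M (\<lambda>\<omega>. Y \<omega> u)" if "0 \<le> u" for u using Y that by (simp add: martingale_def)
  then have [measurable]: "(\<lambda>\<omega>. Y \<omega> t) \<in> borel_measurable M" using times by simp
  define \<Phi> where "\<Phi> = (\<lambda>m \<omega> u. 1 / max 1 (Y \<omega> u / real (Suc m)))"
  have \<Phi>R [measurable]: "(\<lambda>\<omega>. \<Phi> m \<omega> (R \<omega>)) \<in> borel_measurable M" for m
    unfolding \<Phi>_def by measurable
  have eq: "(\<integral>\<^sup>+\<omega>. indicator D \<omega> * ennreal (\<Phi> m \<omega> (R \<omega>) * Y \<omega> t) \<partial>M) =
      (\<integral>\<^sup>+\<omega>. indicator D \<omega> * ennreal (\<Phi> m \<omega> (R \<omega>) * Y \<omega> (R \<omega>)) \<partial>M)" for m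
  proof (rule optional_sampling[OF Y, where s = s and t = t and c = "real (Suc m)"])
    show "adapted F (\<Phi> m)"
      using Y unfolding martingale_def adapted_def \<Phi>_def by auto
    show "AE \<omega> in M. \<forall>u\<ge>0. (\<Phi> m \<omega> \<longlongrightarrow> \<Phi> m \<omega> u) (at_right u)"
      using rc unfolding \<Phi>_def by eventually_elim (auto intro!: tendsto_intros)
    fix \<omega> u assume w: "\<omega> \<in> space M" and u: "0 \<le> (u::real)"
    show "0 \<le> \<Phi> m \<omega> u" by (simp add: \<Phi>_def)
    have "\<Phi> m \<omega> u \<le> 1" by (simp add: \<Phi>_def divide_le_eq)
    then show "\<Phi> m \<omega> u \<le> real (Suc m)" by simp
    show "\<Phi> m \<omega> u * Y \<omega> u \<le> real (Suc m)"
    proof -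
      have "Y \<omega> u \<le> real (Suc m) * max 1 (Y \<omega> u / real (Suc m))"
        using mult_left_mono[of "Y \<omega> u / real (Suc m)" "max 1 (Y \<omega> u / real (Suc m))" "real (Suc m)"]
        by (simp del: of_nat_Suc)
      then show ?thesis
        unfolding \<Phi>_def by (simp add: pos_divide_le_eq less_max_iff_disj del: of_nat_Suc)
    qed
  qed (use nonneg rc times R D meas \<Phi>R in auto)
  have "(\<integral>\<^sup>+\<omega>. indicator D \<omega> * ennreal (Y \<omega> (R \<omega>)) \<partial>M) = (\<integral>\<^sup>+\<omega>. indicator D \<omega> * ennreal (Y \<omega> t) \<partial>M)"
    using nn_integral_truncation_tendsto[of D M "\<lambda>\<omega>. Y \<omega> (R \<omega>)" "\<lambda>\<omega>. Y \<omega> (R \<omega>)"]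
      nn_integral_truncation_tendsto[of D M "\<lambda>\<omega>. Y \<omega> (R \<omega>)" "\<lambda>\<omega>. Y \<omega> t"]
      eq[unfolded \<Phi>_def]
    by (intro LIMSEQ_unique) simp_all
  also have "\<dots> = ennreal (\<integral>\<omega>. indicator D \<omega> * Y \<omega> t \<partial>M)"
    using int[of t] nonneg times by (subst nn_integral_indicator_eq_integral) auto
  also have "(\<integral>\<omega>. indicator D \<omega> * Y \<omega> t \<partial>M) = (\<integral>\<omega>. indicator D \<omega> * Y \<omega> s \<partial>M)"
    using D by (intro martingale_cond(1)[OF Y times, where c = 1]) (auto simp: indicator_def)
  also have "ennreal \<dots> = (\<integral>\<^sup>+\<omega>. indicator D \<omega> * ennreal (Y \<omega> s) \<partial>M)"
    using int[of s] nonneg times by (subst nn_integral_indicator_eq_integral) auto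
  finally show ?thesis .
qed

lemma ext_stopping_time_less:
  assumes "ext_stopping_time F T" "0 \<le> u"
  shows "{\<omega>\<in>space M. T \<omega> < ennreal u} \<in> sets (F u)"
proof -
  have "T \<omega> < ennreal u \<longleftrightarrow> (\<exists>q\<in>{q\<in>\<rat>. 0 \<le> q \<and> q < u}. T \<omega> \<le> ennreal q)" for \<omega>
  proof
    assume "T \<omega> < ennreal u"
    then obtain r where r: "T \<omega> = ennreal r" "0 \<le> r" "r < u"
      by (cases "T \<omega>") (auto simp: ennreal_less_iff)
    then obtain q where "q \<in> \<rat>" "r < q" "q < u" using Rats_dense_in_real by blast
    then show "\<exists>q\<in>{q\<in>\<rat>. 0 \<le> q \<and> q < u}. T \<omega> \<le> ennreal q"
      using r by (intro bexI[of _ q]) (auto intro: ennreal_leI)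
  next
    assume "\<exists>q\<in>{q\<in>\<rat>. 0 \<le> q \<and> q < u}. T \<omega> \<le> ennreal q"
    then obtain q where "0 \<le> q" "q < u" "T \<omega> \<le> ennreal q" by auto
    then show "T \<omega> < ennreal u" by (meson ennreal_lessI le_less_trans order_le_less_trans)
  qed
  then have "{\<omega>\<in>space M. T \<omega> < ennreal u} = (\<Union>q\<in>{q\<in>\<rat>. 0 \<le> q \<and> q < u}. {\<omega>\<in>space M. T \<omega> \<le> ennreal q})"
    by auto
  also have "\<dots> \<in> sets (F u)"
  proof (rule sets.countable_UN'')
    show "countable {q\<in>\<rat>. 0 \<le> q \<and> q < u}"
      by (rule countable_subset[OF _ countable_rat]) auto
    fix q assume q: "q \<in> {q\<in>\<rat>. 0 \<le> q \<and> q < u}"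
    then have "Measurable.pred (F q) (\<lambda>\<omega>. T \<omega> \<le> ennreal q)"
      using assms(1) by (simp add: ext_stopping_time_def)
    then have "{\<omega>\<in>space M. T \<omega> \<le> ennreal q} \<in> sets (F q)" using q by (simp add: pred_def)
    then show "{\<omega>\<in>space M. T \<omega> \<le> ennreal q} \<in> sets (F u)" using q by (intro sets_F_mono[of q u]) auto
  qed
  finally show ?thesis .
qed

lemma ext_stopping_time_pos:
  assumes "ext_stopping_time F T"
  shows "{\<omega>\<in>space M. 0 < T \<omega>} \<in> sets (F 0)"
proof -
  have "Measurable.pred (F 0) (\<lambda>\<omega>. T \<omega> \<le> ennreal 0)"
    using assms unfolding ext_stopping_time_def by blast
  then have "Measurable.pred (F 0) (\<lambda>\<omega>. \<not> T \<omega> \<le> ennreal 0)" by measurable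
  then show ?thesis by (simp add: pred_def zero_less_iff_neq_zero)
qed

end

section \<open>Nonnegative local martingales\<close>

context filtered_prob_space
begin

text \<open>The bound \<open>c\<close> holds only strictly before \<open>S\<close>, so the value at
  \<open>S\<close> may overshoot. Along the localizing sequence the stopped process is a martingale
  that starts below \<open>c\<close> on \<open>0 < S\<close>, and Fatou's lemma gives the
  integrability of that value. This in turn dominates all localized values, so the identity survives
  the limit whatever the localizing sequence is. Measurability of sampled values is a hypothesis,
  since \<open>local_martingale\<close> gives cadlag paths only almost surely.\<close>

lemma nonneg_local_martingale_optional_stopping:
  assumes lm: "local_martingale M F Z"
    and nonneg: "\<And>\<omega> u. \<omega> \<in> space M \<Longrightarrow> 0 \<le> u \<Longrightarrow> 0 \<le> Z \<omega> u"
    and meas: "\<And>R t. R \<in> borel_measurable M \<Longrightarrow> (\<And>\<omega>. \<omega> \<in> space M \<Longrightarrow> 0 \<le> R \<omega> \<and> R \<omega> \<le> t) \<Longrightarrow>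
      (\<lambda>\<omega>. Z \<omega> (R \<omega>)) \<in> borel_measurable M"
    and S: "ext_stopping_time F S"
    and bounded: "\<And>\<omega> u. \<omega> \<in> space M \<Longrightarrow> 0 \<le> u \<Longrightarrow> ennreal u < S \<omega> \<Longrightarrow> Z \<omega> u \<le> c"
  shows "0 \<le> t \<Longrightarrow>
      (\<integral>\<^sup>+\<omega>. indicator {\<omega>\<in>space M. 0 < S \<omega>} \<omega> * ennreal (Z \<omega> (cap t (S \<omega>))) \<partial>M) \<le> ennreal c"
    and "0 \<le> s \<Longrightarrow> s \<le> t \<Longrightarrow> D \<in> sets (F s) \<Longrightarrow>
      (\<And>\<omega>. \<omega> \<in> D \<Longrightarrow> ennreal s \<le> S \<omega> \<and> 0 < S \<omega>) \<Longrightarrow>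
      (\<integral>\<^sup>+\<omega>. indicator D \<omega> * ennreal (Z \<omega> (cap t (S \<omega>))) \<partial>M) =
      (\<integral>\<^sup>+\<omega>. indicator D \<omega> * ennreal (Z \<omega> s) \<partial>M)"
proof -
  obtain \<tau> :: "nat \<Rightarrow> 'a \<Rightarrow> ennreal" where \<tau>: "\<And>k. ext_stopping_time F (\<tau> k)"
    and \<tau>_lim: "AE \<omega> in M. incseq (\<lambda>k. \<tau> k \<omega>) \<and> (\<lambda>k. \<tau> k \<omega>) \<longlonglongrightarrow> \<infinity>"
    and \<tau>_mart: "\<And>k. martingale M F (\<lambda>\<omega> t. stopped Z (\<tau> k) \<omega> t * indicator {\<omega>. 0 < \<tau> k \<omega>} \<omega>)"
    using lm unfolding local_martingale_def by blast
  have cadlag: "AE \<omega> in M. cadlag (Z \<omega>)" using lm by (simp add: local_martingale_def)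
  define Y where "Y = (\<lambda>k \<omega> t. Z \<omega> (cap t (\<tau> k \<omega>)) * indicator {\<omega>. 0 < \<tau> k \<omega>} \<omega>)"
  have Y: "martingale M F (Y k)" for k
    using \<tau>_mart[of k] by (simp only: Y_def stopped_cap)
  have Y0: "0 \<le> Y k \<omega> u" if "\<omega> \<in> space M" for k \<omega> u
    using nonneg[OF that cap_nonneg] by (simp add: Y_def)
  have cap_meas: "(\<lambda>\<omega>. cap t (T \<omega>)) \<in> borel_measurable M"
    if "ext_stopping_time F T" "0 \<le> t" for T t
    using ext_stopping_time_less[OF that(1)] sets_F_sets that(2) by (intro measurable_cap) blast+
  have ZS: "(\<lambda>\<omega>. Z \<omega> (cap t (S \<omega>))) \<in> borel_measurable M" if "0 \<le> t" for t
    by (rule meas[OF cap_meas[OF S that], of t]) (use cap_nonneg cap_le[OF that] in blast)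
  have Y_meas: "(\<lambda>\<omega>. Y k \<omega> (cap t (S \<omega>))) \<in> borel_measurable M" if "0 \<le> t" for k t
  proof -
    have "(\<lambda>\<omega>. cap t (min (S \<omega>) (\<tau> k \<omega>))) \<in> borel_measurable M"
      using cap_meas[OF S that] cap_meas[OF \<tau> that, of k] unfolding cap_min[OF that] by measurable
    then have "(\<lambda>\<omega>. Z \<omega> (cap t (min (S \<omega>) (\<tau> k \<omega>)))) \<in> borel_measurable M"
      by (rule meas[of _ t]) (use cap_nonneg cap_le[OF that] in blast)
    moreover have "{\<omega>\<in>space M. 0 < \<tau> k \<omega>} \<in> sets M"
      by (rule sets_F_sets[OF order_refl ext_stopping_time_pos[OF \<tau>]])
    then have "(\<lambda>\<omega>. indicator {\<omega>. 0 < \<tau> k \<omega>} \<omega> :: real) \<in> borel_measurable M"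
      by (subst measurable_cong[where g = "indicator {\<omega>\<in>space M. 0 < \<tau> k \<omega>}"]) (auto simp: indicator_def)
    ultimately show ?thesis unfolding Y_def cap_cap by (rule borel_measurable_times)
  qed
  have Y_rc: "AE \<omega> in M. \<forall>u\<ge>0. (Y k \<omega> \<longlongrightarrow> Y k \<omega> u) (at_right u)" for k
    using cadlag
  proof eventually_elim
    case (elim \<omega>)
    then show ?case unfolding Y_def cadlag_def
      by (intro allI impI tendsto_intros right_continuous_stop) auto
  qed
  have step: "(\<integral>\<^sup>+\<omega>. indicator D \<omega> * ennreal (Y k \<omega> (cap t (S \<omega>))) \<partial>M) =
      (\<integral>\<^sup>+\<omega>. indicator D \<omega> * ennreal (Y k \<omega> s) \<partial>M)"
    if "0 \<le> s" "s \<le> t" "D \<in> sets (F s)" "\<And>\<omega>. \<omega> \<in> D \<Longrightarrow> ennreal s \<le> S \<omega>" for s t D k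
  proof (rule optional_sampling_eq[OF Y Y0 Y_rc that(1,2)])
    have t0: "0 \<le> t" using that by simp
    show "0 \<le> cap t (S \<omega>) \<and> cap t (S \<omega>) \<le> t" for \<omega> using cap_nonneg cap_le[OF t0] by blast
    show "{\<omega> \<in> space M. cap t (S \<omega>) < u} \<in> sets (F u)" if "0 \<le> u" "u \<le> t" for u
      using ext_stopping_time_less[OF S that(1)] by (simp only: cap_less_iff[OF that])
    show "D \<in> sets (F s)" by fact
    show "s \<le> cap t (S \<omega>)" if "\<omega> \<in> D" for \<omega>
      using cap_less_iff[OF \<open>0 \<le> s\<close> \<open>s \<le> t\<close>, of "S \<omega>"] \<open>\<And>\<omega>. \<omega> \<in> D \<Longrightarrow> ennreal s \<le> S \<omega>\<close>[OF that]
      by (meson not_le)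
    show "(\<lambda>\<omega>. Y k \<omega> (cap t (S \<omega>))) \<in> borel_measurable M" by (rule Y_meas[OF t0])
  qed
  have Y_lim: "AE \<omega> in M. (\<lambda>k. Y k \<omega> u) \<longlonglongrightarrow> Z \<omega> u \<and> (\<lambda>k. Y k \<omega> (cap u (S \<omega>))) \<longlonglongrightarrow> Z \<omega> (cap u (S \<omega>))"
    if u: "0 \<le> u" for u
    using \<tau>_lim
  proof eventually_elim
    case (elim \<omega>)
    have ev: "\<forall>\<^sub>F k in sequentially. Y k \<omega> v = Z \<omega> v" if v: "0 \<le> v" for v
    proof -
      have "\<forall>\<^sub>F k in sequentially. ennreal v < \<tau> k \<omega>"
        using elim by (intro order_tendstoD(1)[of _ \<infinity>]) auto
      then show ?thesis
      proof eventually_elim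
        case (elim k)
        then have "0 < \<tau> k \<omega>" by (rule le_less_trans[rotated]) simp
        then show ?case using cap_eq_left[OF v less_imp_le[OF elim]] by (simp add: Y_def)
      qed
    qed
    show ?case using ev[OF u] ev[OF cap_nonneg] by (intro conjI tendsto_eventually)
  qed
  let ?D0 = "{\<omega>\<in>space M. 0 < S \<omega>}"
  have D0: "?D0 \<in> sets (F 0)" by (rule ext_stopping_time_pos[OF S])
  then have D0M [measurable]: "?D0 \<in> sets M" by (rule sets_F_sets[rotated]) simp
  have fin: "(\<integral>\<^sup>+\<omega>. indicator ?D0 \<omega> * ennreal (Z \<omega> (cap t (S \<omega>))) \<partial>M) \<le> ennreal c" if t: "0 \<le> t" for t
  proof -
    have "(\<integral>\<^sup>+\<omega>. indicator ?D0 \<omega> * ennreal (Z \<omega> (cap t (S \<omega>))) \<partial>M) =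
        (\<integral>\<^sup>+\<omega>. liminf (\<lambda>k. indicator ?D0 \<omega> * ennreal (Y k \<omega> (cap t (S \<omega>)))) \<partial>M)"
    proof (rule nn_integral_cong_AE)
      show "AE \<omega> in M. indicator ?D0 \<omega> * ennreal (Z \<omega> (cap t (S \<omega>))) =
          liminf (\<lambda>k. indicator ?D0 \<omega> * ennreal (Y k \<omega> (cap t (S \<omega>))))"
        using Y_lim[OF t]
      proof eventually_elim
        case (elim \<omega>)
        have "(\<lambda>k. indicator ?D0 \<omega> * ennreal (Y k \<omega> (cap t (S \<omega>))))
            \<longlonglongrightarrow> indicator ?D0 \<omega> * ennreal (Z \<omega> (cap t (S \<omega>)))"
          using elim by (intro ennreal_tendsto_cmult tendsto_ennrealI) (auto simp: indicator_def)
        then show ?case by (rule lim_imp_Liminf[OF trivial_limit_sequentially, symmetric])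
      qed
    qed
    also have "\<dots> \<le> liminf (\<lambda>k. \<integral>\<^sup>+\<omega>. indicator ?D0 \<omega> * ennreal (Y k \<omega> (cap t (S \<omega>))) \<partial>M)"
      using Y_meas[OF t] by (intro nn_integral_liminf) measurable
    also have "\<dots> \<le> liminf (\<lambda>k::nat. ennreal c)"
    proof (intro Liminf_mono always_eventually allI)
      fix k
      have "(\<integral>\<^sup>+\<omega>. indicator ?D0 \<omega> * ennreal (Y k \<omega> (cap t (S \<omega>))) \<partial>M) =
          (\<integral>\<^sup>+\<omega>. indicator ?D0 \<omega> * ennreal (Y k \<omega> 0) \<partial>M)"
        by (rule step[OF _ t D0]) auto
      also have "\<dots> \<le> (\<integral>\<^sup>+\<omega>. ennreal c \<partial>M)"
      proof (rule nn_integral_mono)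
        fix \<omega> assume w: "\<omega> \<in> space M"
        show "indicator ?D0 \<omega> * ennreal (Y k \<omega> 0) \<le> ennreal c"
        proof (cases "0 < S \<omega>")
          case True
          then have "Z \<omega> 0 \<le> c" using bounded[OF w, of 0] by simp
          moreover have "Y k \<omega> 0 \<le> Z \<omega> 0"
            using nonneg[OF w, of 0] by (simp add: Y_def indicator_def)
          ultimately show ?thesis using w True by (simp add: ennreal_leI)
        qed simp
      qed
      also have "\<dots> = ennreal c" by (simp add: emeasure_space_1)
      finally show "(\<integral>\<^sup>+\<omega>. indicator ?D0 \<omega> * ennreal (Y k \<omega> (cap t (S \<omega>))) \<partial>M) \<le> ennreal c" .
    qed
    also have "\<dots> = ennreal c" by (simp add: Liminf_const)
    finally show ?thesis .
  qed
  show "0 \<le> t \<Longrightarrow>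
      (\<integral>\<^sup>+\<omega>. indicator ?D0 \<omega> * ennreal (Z \<omega> (cap t (S \<omega>))) \<partial>M) \<le> ennreal c"
    by (rule fin)
  show "(\<integral>\<^sup>+\<omega>. indicator D \<omega> * ennreal (Z \<omega> (cap t (S \<omega>))) \<partial>M) =
      (\<integral>\<^sup>+\<omega>. indicator D \<omega> * ennreal (Z \<omega> s) \<partial>M)"
    if s0: "0 \<le> s" and st: "s \<le> t" and D: "D \<in> sets (F s)"
      and DS: "\<And>\<omega>. \<omega> \<in> D \<Longrightarrow> ennreal s \<le> S \<omega> \<and> 0 < S \<omega>"
  proof -
    have t0: "0 \<le> t" using s0 st by simp
    have DM [measurable]: "D \<in> sets M" using D s0 sets_F_sets by blast
    have D_sub: "D \<subseteq> ?D0" using DS sets.sets_into_space[OF DM] by auto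
    have Zs [measurable]: "(\<lambda>\<omega>. Z \<omega> s) \<in> borel_measurable M"
      using s0 by (intro meas[of "\<lambda>_. s" s]) auto
    have Ys [measurable]: "(\<lambda>\<omega>. Y k \<omega> s) \<in> borel_measurable M" for k
      using martingaleD(1)[OF Y s0] .
    \<comment> \<open>\<open>v\<close> stands for both \<open>cap t (S \<omega>)\<close> and
      \<open>s\<close>, the latter being \<open>cap s (S \<omega>)\<close> on \<open>D\<close>. The
      localized time \<open>cap v (\<tau> k \<omega>)\<close> is either strictly before
      \<open>S \<omega>\<close>, where \<open>c\<close> is a bound, or equal to \<open>v\<close>,
      where the value is the one at the capped time.\<close>
    have dom: "Y k \<omega> v \<le> c + Z \<omega> (cap t' (S \<omega>))"
      if w: "\<omega> \<in> D" and v: "0 \<le> v" "cap t' (S \<omega>) = v" for k \<omega> v t'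
    proof (cases "0 < \<tau> k \<omega>")
      case True
      have w': "\<omega> \<in> space M" using w D_sub by auto
      have S0: "0 < S \<omega>" using DS[OF w] by simp
      have c0: "0 \<le> c" using bounded[OF w' order_refl] nonneg[OF w' order_refl] S0 by fastforce
      let ?r = "cap v (\<tau> k \<omega>)"
      have "ennreal v \<le> S \<omega>" using v(2) by (metis ennreal_cap min.cobounded2)
      show ?thesis
      proof (cases "ennreal ?r < S \<omega>")
        case True
        then have "Z \<omega> ?r \<le> c" using bounded[OF w' cap_nonneg] by blast
        then show ?thesis
          using nonneg[OF w' cap_nonneg, of t' "S \<omega>"] \<open>0 < \<tau> k \<omega>\<close> by (simp only: Y_def) simp
      next
        case False
        then have "S \<omega> \<le> ennreal ?r" by simp
        moreover have "ennreal ?r \<le> ennreal v" using cap_le[OF v(1)] by (rule ennreal_leI)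
        ultimately have "ennreal ?r = ennreal v" using \<open>ennreal v \<le> S \<omega>\<close> by simp
        then have "?r = v" using cap_nonneg v(1) by (simp only: ennreal_inj)
        then show ?thesis using v(2) c0 \<open>0 < \<tau> k \<omega>\<close> by (simp only: Y_def) simp
      qed
    next
      case False
      have w': "\<omega> \<in> space M" using w D_sub by auto
      have c0: "0 \<le> c" using bounded[OF w' order_refl] nonneg[OF w' order_refl] DS[OF w] by fastforce
      show ?thesis using False c0 nonneg[OF w' cap_nonneg, of t' "S \<omega>"] by (simp add: Y_def)
    qed
    have w_fin: "(\<integral>\<^sup>+\<omega>. indicator D \<omega> * ennreal (c + Z \<omega> (cap t' (S \<omega>))) \<partial>M) < \<infinity>" if t': "0 \<le> t'" for t'
    proof -
      have [measurable]: "(\<lambda>\<omega>. Z \<omega> (cap t' (S \<omega>))) \<in> borel_measurable M" by (rule ZS[OF t'])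
      have "(\<integral>\<^sup>+\<omega>. indicator D \<omega> * ennreal (c + Z \<omega> (cap t' (S \<omega>))) \<partial>M) \<le>
          (\<integral>\<^sup>+\<omega>. ennreal c + indicator ?D0 \<omega> * ennreal (Z \<omega> (cap t' (S \<omega>))) \<partial>M)"
        using D_sub by (intro nn_integral_mono) (auto simp: indicator_def ennreal_plus_if intro: ennreal_leI)
      also have "\<dots> = ennreal c + (\<integral>\<^sup>+\<omega>. indicator ?D0 \<omega> * ennreal (Z \<omega> (cap t' (S \<omega>))) \<partial>M)"
        by (subst nn_integral_add) (auto simp: emeasure_space_1)
      also have "\<dots> \<le> ennreal c + ennreal c" by (intro add_mono order_refl fin t')
      also have "\<dots> < \<infinity>" by simp
      finally show ?thesis .
    qed
    have lim1: "(\<lambda>k. \<integral>\<^sup>+\<omega>. indicator D \<omega> * ennreal (Y k \<omega> (cap t (S \<omega>))) \<partial>M)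
        \<longlonglongrightarrow> (\<integral>\<^sup>+\<omega>. indicator D \<omega> * ennreal (Z \<omega> (cap t (S \<omega>))) \<partial>M)"
    proof (rule nn_integral_dominated_convergence[OF _ _ _ _ w_fin[OF t0]])
      show "AE \<omega> in M. indicator D \<omega> * ennreal (Y k \<omega> (cap t (S \<omega>)))
          \<le> indicator D \<omega> * ennreal (c + Z \<omega> (cap t (S \<omega>)))" for k
      proof -
        have "Y k \<omega> (cap t (S \<omega>)) \<le> c + Z \<omega> (cap t (S \<omega>))" if "\<omega> \<in> D" for \<omega>
          by (rule dom[OF that cap_nonneg refl])
        then show ?thesis by (intro AE_I2) (auto simp: indicator_def intro!: ennreal_leI)
      qed
      show "AE \<omega> in M. (\<lambda>k. indicator D \<omega> * ennreal (Y k \<omega> (cap t (S \<omega>))))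
          \<longlonglongrightarrow> indicator D \<omega> * ennreal (Z \<omega> (cap t (S \<omega>)))"
        using Y_lim[OF t0]
        by eventually_elim (intro ennreal_tendsto_cmult tendsto_ennrealI, auto simp: indicator_def)
    qed (use ZS[OF t0] Y_meas[OF t0] in measurable)
    have caps: "cap s (S \<omega>) = s" if "\<omega> \<in> D" for \<omega> using DS[OF that] s0 by (intro cap_eq_left) auto
    have lim2: "(\<lambda>k. \<integral>\<^sup>+\<omega>. indicator D \<omega> * ennreal (Y k \<omega> s) \<partial>M)
        \<longlonglongrightarrow> (\<integral>\<^sup>+\<omega>. indicator D \<omega> * ennreal (Z \<omega> s) \<partial>M)"
    proof (rule nn_integral_dominated_convergence[OF _ _ _ _ w_fin[OF s0]])
      show "AE \<omega> in M. indicator D \<omega> * ennreal (Y k \<omega> s)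
          \<le> indicator D \<omega> * ennreal (c + Z \<omega> (cap s (S \<omega>)))" for k
      proof -
        have "Y k \<omega> s \<le> c + Z \<omega> (cap s (S \<omega>))" if "\<omega> \<in> D" for \<omega>
          by (rule dom[OF that s0 caps[OF that]])
        then show ?thesis by (intro AE_I2) (auto simp: indicator_def intro!: ennreal_leI)
      qed
      show "AE \<omega> in M. (\<lambda>k. indicator D \<omega> * ennreal (Y k \<omega> s)) \<longlonglongrightarrow> indicator D \<omega> * ennreal (Z \<omega> s)"
        using Y_lim[OF s0]
        by eventually_elim (intro ennreal_tendsto_cmult tendsto_ennrealI, auto simp: indicator_def)
    qed (use ZS[OF s0] in measurable)
    show ?thesis
      using LIMSEQ_unique[OF lim1] lim2 step[OF s0 st D] DS by simp
  qed
qed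

end

section \<open>Exit times and disintegration\<close>

text \<open>Intended for \<open>f = p x \<omega>\<close> and \<open>g = X x \<omega>\<close>, so
  that both \<open>g\<close> and \<open>g / f\<close> are bounded before this time. The inequalities
  are strict, which makes the set being entered open: an entrance before \<open>u\<close> is then
  visible at rational times, while at the exit time itself only weak inequalities can be
  expected.\<close>

definition exit_time :: "(real \<Rightarrow> real) \<Rightarrow> (real \<Rightarrow> real) \<Rightarrow> nat \<Rightarrow> ennreal" where
  "exit_time f g n = Inf (ennreal ` {u. 0 \<le> u \<and> (f u < 1 / real (Suc n) \<or> real (Suc n) < g u)})"

lemma exit_time_below:
  assumes "0 \<le> u" "ennreal u < exit_time f g n"
  shows "1 / real (Suc n) \<le> f u" "g u \<le> real (Suc n)"
proof -
  have "u \<notin> {u. 0 \<le> u \<and> (f u < 1 / real (Suc n) \<or> real (Suc n) < g u)}"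
    using assms(2) Inf_lower[of "ennreal u"] unfolding exit_time_def by (auto simp: not_less[symmetric])
  then show "1 / real (Suc n) \<le> f u" "g u \<le> real (Suc n)" using assms(1) by auto
qed

lemma exit_time_mono: "m \<le> n \<Longrightarrow> exit_time f g m \<le> exit_time f g n"
  unfolding exit_time_def
proof (intro Inf_superset_mono image_mono subsetI CollectI)
  fix u assume "m \<le> n" and u: "u \<in> {u. 0 \<le> u \<and> (f u < 1 / real (Suc n) \<or> real (Suc n) < g u)}"
  then have "1 / real (Suc n) \<le> 1 / real (Suc m)" "real (Suc m) \<le> real (Suc n)"
    by (auto intro: divide_left_mono)
  then show "0 \<le> u \<and> (f u < 1 / real (Suc m) \<or> real (Suc m) < g u)" using u by auto
qed

text \<open>A strict inequality at \<open>r\<close> persists on a right neighbourhood of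
  \<open>r\<close>, which contains a rational time before \<open>u\<close>. Countability then yields
  joint measurability in \<open>x\<close> and \<open>\<omega>\<close> without any debut
  theorem.\<close>

lemma exit_time_less_iff:
  assumes f: "\<And>u. 0 \<le> u \<Longrightarrow> (f \<longlongrightarrow> f u) (at_right u)"
    and g: "\<And>u. 0 \<le> u \<Longrightarrow> (g \<longlongrightarrow> g u) (at_right u)" and u: "0 \<le> u"
  shows "exit_time f g n < ennreal u \<longleftrightarrow>
    (\<exists>q\<in>{q\<in>\<rat>. 0 \<le> q \<and> q < u}. f q < 1 / real (Suc n) \<or> real (Suc n) < g q)"
proof
  let ?P = "\<lambda>r. f r < 1 / real (Suc n) \<or> real (Suc n) < g r"
  assume "exit_time f g n < ennreal u"
  then obtain r where r: "0 \<le> r" "r < u" "?P r"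
    by (auto simp: exit_time_def Inf_less_iff ennreal_less_iff)
  have "\<forall>\<^sub>F y in at_right r. ?P y"
    using r(3)
  proof
    assume "f r < 1 / real (Suc n)"
    then have "\<forall>\<^sub>F y in at_right r. f y < 1 / real (Suc n)" by (rule order_tendstoD(2)[OF f[OF r(1)]])
    then show ?thesis by eventually_elim blast
  next
    assume "real (Suc n) < g r"
    then have "\<forall>\<^sub>F y in at_right r. real (Suc n) < g y" by (rule order_tendstoD(1)[OF g[OF r(1)]])
    then show ?thesis by eventually_elim blast
  qed
  then obtain b where b: "r < b" "\<And>y. r < y \<Longrightarrow> y < b \<Longrightarrow> ?P y"
    unfolding eventually_at_right_field by blast
  then obtain q where "q \<in> \<rat>" "r < q" "q < min b u" using Rats_dense_in_real[of r "min b u"] r by auto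
  then show "\<exists>q\<in>{q\<in>\<rat>. 0 \<le> q \<and> q < u}. ?P q" using b r by (intro bexI[of _ q]) auto
next
  assume "\<exists>q\<in>{q\<in>\<rat>. 0 \<le> q \<and> q < u}. f q < 1 / real (Suc n) \<or> real (Suc n) < g q"
  then show "exit_time f g n < ennreal u"
    unfolding exit_time_def Inf_less_iff by (force intro: ennreal_lessI)
qed

text \<open>The infimum need not be attained, hence weak inequalities: if both thresholds were
  strictly respected at \<open>h\<close>, right continuity would keep them respected up to some
  \<open>b > h\<close>, and the infimum would be at least \<open>b\<close>.\<close>

lemma exit_time_value:
  assumes f: "\<And>u. 0 \<le> u \<Longrightarrow> (f \<longlongrightarrow> f u) (at_right u)"
    and g: "\<And>u. 0 \<le> u \<Longrightarrow> (g \<longlongrightarrow> g u) (at_right u)" and h: "0 \<le> h" "exit_time f g n = ennreal h"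
  shows "f h \<le> 1 / real (Suc n) \<or> real (Suc n) \<le> g h"
proof (rule ccontr)
  let ?P = "\<lambda>r. f r < 1 / real (Suc n) \<or> real (Suc n) < g r"
  assume "\<not> ?thesis"
  then have fh: "1 / real (Suc n) < f h" and gh: "g h < real (Suc n)" by auto
  have "\<forall>\<^sub>F y in at_right h. 1 / real (Suc n) < f y \<and> g y < real (Suc n)"
    by (intro eventually_conj order_tendstoD(1)[OF f[OF h(1)] fh] order_tendstoD(2)[OF g[OF h(1)] gh])
  then obtain b where b: "h < b" "\<And>y. h < y \<Longrightarrow> y < b \<Longrightarrow> 1 / real (Suc n) < f y \<and> g y < real (Suc n)"
    unfolding eventually_at_right_field by blast
  have "ennreal b \<le> exit_time f g n"
    unfolding exit_time_def
  proof (rule Inf_greatest)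
    fix a assume "a \<in> ennreal ` {u. 0 \<le> u \<and> ?P u}"
    then obtain u where u: "a = ennreal u" "0 \<le> u" "?P u" by auto
    then have "exit_time f g n \<le> ennreal u" unfolding exit_time_def by (intro Inf_lower) auto
    then have "h \<le> u" using h u by (simp add: ennreal_le_iff)
    moreover have "u \<noteq> h" using u(3) fh gh by auto
    ultimately have "b \<le> u" using b(2)[of u] u(3) by (meson less_le not_less order.asym)
    then show "ennreal b \<le> a" using u by (simp add: ennreal_leI)
  qed
  then show False using h b by (simp add: ennreal_le_iff2)
qed

lemma space_borel_of [simp]: "space (borel_of E) = topspace E"
  unfolding borel_of_def by (rule space_measure_of) (auto dest: openin_subset)

lemma nn_integral_LIMSEQ_AE:
  fixes f :: "nat \<Rightarrow> 'a \<Rightarrow> ennreal"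
  assumes [measurable]: "\<And>i. f i \<in> borel_measurable M"
    and AE: "AE x in M. incseq (\<lambda>i. f i x) \<and> (\<lambda>i. f i x) \<longlonglongrightarrow> g x"
  shows "(\<lambda>i. \<integral>\<^sup>+x. f i x \<partial>M) \<longlonglongrightarrow> (\<integral>\<^sup>+x. g x \<partial>M)"
proof -
  have "(\<integral>\<^sup>+x. g x \<partial>M) = (\<integral>\<^sup>+x. (SUP i. f i x) \<partial>M)"
    by (rule nn_integral_cong_AE, use AE in eventually_elim) (use LIMSEQ_unique LIMSEQ_SUP in blast)
  also have "\<dots> = (SUP i. \<integral>\<^sup>+x. f i x \<partial>M)"
    by (rule nn_integral_monotone_convergence_SUP_AE)
      (use AE in \<open>auto elim!: eventually_mono simp: incseq_Suc_iff\<close>)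
  finally show ?thesis
    using AE by (auto intro!: LIMSEQ_SUP incseq_SucI nn_integral_mono_AE elim!: eventually_mono
        simp: incseq_Suc_iff)
qed

context filtered_prob_space
begin

text \<open>Right continuity of the filtration closes the gap between \<open><\<close> and
  \<open>\<le>\<close>. For \<open>s > t\<close>, the event \<open>T \<omega> \<le> t\<close> is an
  intersection of events \<open>T \<omega> < u m\<close> with \<open>u m\<close> decreasing to
  \<open>t\<close> inside \<open>(t, s]\<close>, hence belongs to \<open>F s\<close>.\<close>

lemma ext_stopping_timeI:
  assumes T: "\<And>u. 0 \<le> u \<Longrightarrow> {\<omega>\<in>space M. T \<omega> < ennreal u} \<in> sets (F u)"
    and rc: "\<And>t. 0 \<le> t \<Longrightarrow> sets (F t) = (\<Inter>s\<in>{t<..}. sets (F s))"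
  shows "ext_stopping_time F T"
  unfolding ext_stopping_time_def
proof (intro allI impI)
  fix t :: real assume t: "0 \<le> t"
  have "{\<omega>\<in>space M. T \<omega> \<le> ennreal t} \<in> sets (F s)" if s: "t < s" for s
  proof -
    define u where "u = (\<lambda>m. t + (s - t) / real (Suc m))"
    have u: "t < u m" "u m \<le> s" for m using s by (auto simp: u_def field_simps intro!: mult_right_mono)
    have u_lim: "u \<longlonglongrightarrow> t"
      unfolding u_def using tendsto_add[OF tendsto_const[of t] lim_const_over_n[THEN LIMSEQ_Suc, of "s - t"]] by simp
    have "T \<omega> \<le> ennreal t \<longleftrightarrow> (\<forall>m. T \<omega> < ennreal (u m))" for \<omega>
    proof
      assume "T \<omega> \<le> ennreal t"
      then show "\<forall>m. T \<omega> < ennreal (u m)" using u t by (meson ennreal_lessI le_less_trans)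
    next
      assume "\<forall>m. T \<omega> < ennreal (u m)"
      then show "T \<omega> \<le> ennreal t"
        by (intro LIMSEQ_le_const[OF tendsto_ennrealI[OF u_lim]]) (auto intro: less_imp_le)
    qed
    then have "{\<omega>\<in>space M. T \<omega> \<le> ennreal t} = (\<Inter>m. {\<omega>\<in>space M. T \<omega> < ennreal (u m)})" by auto
    also have "\<dots> \<in> sets (F s)"
    proof (intro sets.countable_INT' subsetI)
      fix A assume "A \<in> range (\<lambda>m. {\<omega>\<in>space M. T \<omega> < ennreal (u m)})"
      then obtain m where m: "A = {\<omega>\<in>space M. T \<omega> < ennreal (u m)}" by blast
      have "0 \<le> u m" using u(1)[of m] t by simp
      then show "A \<in> sets (F s)" unfolding m using sets_F_mono[OF _ u(2)] T by blast
    qed simp_all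
    finally show ?thesis .
  qed
  then show "Measurable.pred (F t) (\<lambda>\<omega>. T \<omega> \<le> ennreal t)"
    unfolding pred_def using t by (subst rc) auto
qed

end

section \<open>Disintegration with respect to the law of \<open>J\<close>\<close>

locale jacod_setup = filtered_prob_space M F for M :: "'a measure" and F +
  fixes E :: "'e topology" and J :: "'a \<Rightarrow> 'e" and \<kappa> :: "real \<Rightarrow> 'a \<Rightarrow> 'e measure"
    and p :: "'e \<Rightarrow> 'a \<Rightarrow> real \<Rightarrow> real"
  assumes usual: "usual_hypotheses M F"
    and J: "J \<in> M \<rightarrow>\<^sub>M borel_of E"
    and cond_law: "\<And>t. 0 \<le> t \<Longrightarrow> regular_cond_law M (F t) (borel_of E) J (\<kappa> t)"
    and density: "jacod_density M F E J \<kappa> p"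
begin

abbreviation "joint t \<equiv> borel_of E \<Otimes>\<^sub>M F t"
abbreviation "law \<equiv> distr M (borel_of E) J"

sublocale law: prob_space law by (rule prob_space_distr[OF J])

sublocale law_M: pair_sigma_finite law M ..

lemma J_in: "\<omega> \<in> space M \<Longrightarrow> J \<omega> \<in> topspace E"
  using measurable_space[OF J] by simp

lemma F_right_continuous: "0 \<le> t \<Longrightarrow> sets (F t) = (\<Inter>s\<in>{t<..}. sets (F s))"
  using usual by (simp add: usual_hypotheses_def)

text \<open>For fixed \<open>t\<close> the map \<open>\<omega> \<mapsto> (\<omega>, t)\<close> pulls
  the generators of the optional field back into \<open>F t\<close>, by adaptedness of the
  generating processes. The parameter \<open>x\<close> is carried along unchanged.\<close>

lemma optional_section:
  assumes X: "(\<lambda>(x, \<omega>, t). X x \<omega> t) \<in> borel_measurable (borel_of E \<Otimes>\<^sub>M optional_sigma M F)"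
    and t: "0 \<le> t"
  shows "(\<lambda>(x, \<omega>). X x \<omega> t) \<in> borel_measurable (joint t)"
proof -
  have "(\<lambda>\<omega>. (\<omega>, t)) \<in> F t \<rightarrow>\<^sub>M optional_sigma M F"
    unfolding optional_sigma_def
  proof (rule measurable_measure_of)
    show "(\<lambda>\<omega>. (\<omega>, t)) -` y \<inter> space (F t) \<in> sets (F t)"
      if y: "y \<in> {(\<lambda>(\<omega>, t). Y \<omega> t) -` B \<inter> (space M \<times> {0..}) |Y B. adapted F Y \<and>
        (\<forall>\<omega>\<in>space M. cadlag (Y \<omega>)) \<and> B \<in> sets borel}" for y
    proof -
      obtain Y B where Y: "y = (\<lambda>(\<omega>, t). Y \<omega> t) -` B \<inter> (space M \<times> {0..})" "adapted F Y" "B \<in> sets borel"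
        using y by blast
      have "(\<lambda>\<omega>. Y \<omega> t) \<in> borel_measurable (F t)" using Y(2) t by (simp add: adapted_def)
      then have "(\<lambda>\<omega>. Y \<omega> t) -` B \<inter> space (F t) \<in> sets (F t)" using Y(3) by (rule measurable_sets)
      moreover have "(\<lambda>\<omega>. (\<omega>, t)) -` y \<inter> space (F t) = (\<lambda>\<omega>. Y \<omega> t) -` B \<inter> space (F t)"
        using t by (auto simp: Y(1))
      ultimately show ?thesis by simp
    qed
  qed (use t in auto)
  then have "(\<lambda>z. (fst z, snd z, t)) \<in> joint t \<rightarrow>\<^sub>M borel_of E \<Otimes>\<^sub>M optional_sigma M F"
    by (intro measurable_Pair measurable_fst measurable_compose[OF measurable_snd])
  from measurable_compose[OF this X] show ?thesis by (simp add: split_beta')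
qed

lemma measurable_pair_mono:
  assumes "0 \<le> s" "s \<le> t" "f \<in> joint s \<rightarrow>\<^sub>M N"
  shows "f \<in> joint t \<rightarrow>\<^sub>M N"
proof -
  have "(\<lambda>z. (fst z, snd z)) \<in> joint t \<rightarrow>\<^sub>M joint s"
    using assms by (intro measurable_Pair measurable_fst measurable_F_mono[OF assms(1,2) measurable_ident_sets[OF refl], THEN measurable_compose[OF measurable_snd]])
  from measurable_compose[OF this assms(3)] show ?thesis by simp
qed

lemma measurable_pair_M:
  assumes "0 \<le> s" "f \<in> joint s \<rightarrow>\<^sub>M N"
  shows "f \<in> borel_of E \<Otimes>\<^sub>M M \<rightarrow>\<^sub>M N"
proof -
  have "(\<lambda>z. (fst z, snd z)) \<in> borel_of E \<Otimes>\<^sub>M M \<rightarrow>\<^sub>M joint s"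
    using assms by (intro measurable_Pair measurable_fst measurable_F_M[OF assms(1) measurable_ident_sets[OF refl], THEN measurable_compose[OF measurable_snd]])
  from measurable_compose[OF this assms(2)] show ?thesis by simp
qed

lemma sets_pair_mono:
  assumes "0 \<le> s" "s \<le> t" "A \<in> sets (joint s)"
  shows "A \<in> sets (joint t)"
proof -
  have "space (joint s) = space (joint t)"
    using assms by (simp add: space_pair_measure)
  then show ?thesis
    using measurable_sets[OF measurable_pair_mono[OF assms(1,2) measurable_ident_sets[OF refl]] assms(3)]
      sets.sets_into_space[OF assms(3)] by (simp add: Int_absorb2)
qed

lemma measurable_J_pair:
  assumes "0 \<le> t"
  shows "(\<lambda>\<omega>. (J \<omega>, \<omega>)) \<in> M \<rightarrow>\<^sub>M joint t"
  using J measurable_F_M[OF assms measurable_ident_sets[OF refl]] by (rule measurable_Pair)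

lemma p_meas: "(\<lambda>(x, \<omega>, t). p x \<omega> t) \<in> borel_measurable (borel_of E \<Otimes>\<^sub>M optional_sigma M F)"
  and p_nonneg: "x \<in> topspace E \<Longrightarrow> \<omega> \<in> space M \<Longrightarrow> 0 \<le> t \<Longrightarrow> 0 \<le> p x \<omega> t"
  and p_cadlag: "x \<in> topspace E \<Longrightarrow> \<omega> \<in> space M \<Longrightarrow> cadlag (p x \<omega>)"
  and p_density: "0 \<le> t \<Longrightarrow> AE \<omega> in M. \<kappa> t \<omega> = density law (\<lambda>x. ennreal (p x \<omega> t))"
  and p_martingale: "x \<in> topspace E \<Longrightarrow> martingale M F (p x)"
  using density unfolding jacod_density_def by blast+

lemma p_section: "0 \<le> t \<Longrightarrow> (\<lambda>(x, \<omega>). p x \<omega> t) \<in> borel_measurable (joint t)"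
  by (rule optional_section[OF p_meas])

lemma p_pair_M: "0 \<le> t \<Longrightarrow> (\<lambda>(x, \<omega>). p x \<omega> t) \<in> borel_measurable (law \<Otimes>\<^sub>M M)"
  using measurable_pair_M[OF _ p_section] by (simp cong: measurable_cong_sets sets_pair_measure_cong)

text \<open>Two measures on the joint field at time \<open>v\<close> are compared: the image of
  \<open>M\<close> under \<open>\<omega> \<mapsto> (J \<omega>, \<omega>)\<close>, and the product
  \<open>law \<Otimes>\<^sub>M M\<close> with density \<open>p x \<omega> v\<close>. On a rectangle
  \<open>A \<times> C\<close> both give the integral over \<open>C\<close> of the conditional
  probability that \<open>J\<close> lies in \<open>A\<close>, and rectangles form an
  intersection-stable generator.\<close>

lemma disintegration:
  fixes f :: "'e \<times> 'a \<Rightarrow> ennreal"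
  assumes v: "0 \<le> v" and f: "f \<in> borel_measurable (joint v)"
  shows "(\<integral>\<^sup>+\<omega>. f (J \<omega>, \<omega>) \<partial>M) = (\<integral>\<^sup>+x. \<integral>\<^sup>+\<omega>. f (x, \<omega>) * ennreal (p x \<omega> v) \<partial>M \<partial>law)"
proof -
  let ?N = "joint v"
  let ?P = "density (law \<Otimes>\<^sub>M M) (\<lambda>(x, \<omega>). ennreal (p x \<omega> v))"
  have sets_law: "sets (law \<Otimes>\<^sub>M M) = sets (borel_of E \<Otimes>\<^sub>M M)"
    by (intro sets_pair_measure_cong) simp_all
  have pm [measurable]: "(\<lambda>(x, \<omega>). ennreal (p x \<omega> v)) \<in> borel_measurable (law \<Otimes>\<^sub>M M)"
    using measurable_compose[OF p_pair_M[OF v] measurable_ennreal] by (simp add: split_beta')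
  have idm: "(\<lambda>z. z) \<in> law \<Otimes>\<^sub>M M \<rightarrow>\<^sub>M ?N"
    using measurable_pair_M[OF v measurable_ident_sets[OF refl]] measurable_cong_sets[OF sets_law refl] by blast
  then have idP: "(\<lambda>z. z) \<in> ?P \<rightarrow>\<^sub>M ?N" by simp
  have Jm: "(\<lambda>\<omega>. (J \<omega>, \<omega>)) \<in> M \<rightarrow>\<^sub>M ?N" by (rule measurable_J_pair[OF v])
  have rect: "emeasure (distr M ?N (\<lambda>\<omega>. (J \<omega>, \<omega>))) (A \<times> C) = emeasure (distr ?P ?N (\<lambda>z. z)) (A \<times> C)"
    if A: "A \<in> sets (borel_of E)" and C: "C \<in> sets (F v)" for A C
  proof -
    interpret Fv: sigma_finite_subalgebra M "F v" by (rule sigma_finite_F[OF v])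
    have CM [measurable]: "C \<in> sets M" using C v sets_F_sets by blast
    have AC: "A \<times> C \<in> sets ?N" using A C by simp
    have kap: "\<kappa> v \<in> F v \<rightarrow>\<^sub>M prob_algebra (borel_of E)"
      and kcond: "AE \<omega> in M. measure (\<kappa> v \<omega>) A = real_cond_exp M (F v) (\<lambda>\<omega>. indicator A (J \<omega>)) \<omega>"
      using cond_law[OF v] A by (auto simp: regular_cond_law_def)
    have km: "(\<lambda>\<omega>. measure (\<kappa> v \<omega>) A) \<in> borel_measurable (F v)"
      using measurable_compose[OF kap measurable_measure_prob_algebra[OF A]] .
    have kmM [measurable]: "(\<lambda>\<omega>. measure (\<kappa> v \<omega>) A) \<in> borel_measurable M"
      by (rule measurable_F_M[OF v km])
    have kp: "prob_space (\<kappa> v \<omega>)" if "\<omega> \<in> space M" for \<omega>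
      using measurable_space[OF kap, of \<omega>] that v by (simp add: space_prob_algebra)
    have IA [measurable]: "(\<lambda>\<omega>. indicator A (J \<omega>) :: real) \<in> borel_measurable M"
      using measurable_compose[OF J borel_measurable_indicator[OF A]] .
    have kint: "integrable M (\<lambda>\<omega>. measure (\<kappa> v \<omega>) A)"
      using kp by (intro integrable_const_bound[where B = 1] AE_I2) (auto intro: prob_space.prob_le_1)
    have "emeasure (distr ?P ?N (\<lambda>z. z)) (A \<times> C) = emeasure ?P (A \<times> C)"
    proof -
      have "A \<times> C \<subseteq> topspace E \<times> space M"
        using sets.sets_into_space[OF A] sets.sets_into_space[OF CM] by auto
      then show ?thesis
        by (simp add: emeasure_distr[OF idP AC] space_pair_measure Int_absorb2)
    qed
    also have "\<dots> = (\<integral>\<^sup>+z. (case z of (x, \<omega>) \<Rightarrow> ennreal (p x \<omega> v)) * indicator (A \<times> C) z \<partial>(law \<Otimes>\<^sub>M M))"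
      using A CM by (intro emeasure_density pm) (simp add: sets_law)
    \<comment> \<open>\<open>x\<close> is integrated before \<open>\<omega>\<close>, because for
      fixed \<open>\<omega>\<close> the density in \<open>x\<close> reproduces the conditional law
      \<open>\<kappa> v \<omega>\<close>.\<close>
    also have "\<dots> = (\<integral>\<^sup>+\<omega>. \<integral>\<^sup>+x. ennreal (p x \<omega> v) * indicator (A \<times> C) (x, \<omega>) \<partial>law \<partial>M)"
      using A CM pm by (subst law_M.nn_integral_snd[symmetric]) (auto simp: sets_law intro!: borel_measurable_times_ennreal)
    also have "\<dots> = (\<integral>\<^sup>+\<omega>. indicator C \<omega> * ennreal (measure (\<kappa> v \<omega>) A) \<partial>M)"
    proof (rule nn_integral_cong_AE)
      show "AE \<omega> in M. (\<integral>\<^sup>+x. ennreal (p x \<omega> v) * indicator (A \<times> C) (x, \<omega>) \<partial>law) =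
          indicator C \<omega> * ennreal (measure (\<kappa> v \<omega>) A)"
        using p_density[OF v] AE_space
      proof eventually_elim
        case (elim \<omega>)
        have pw: "(\<lambda>x. ennreal (p x \<omega> v)) \<in> borel_measurable law"
          using measurable_Pair1[OF pm elim(2)] by simp
        have Al: "A \<in> sets law" using A by simp
        interpret k: prob_space "\<kappa> v \<omega>" by (rule kp[OF elim(2)])
        have "(\<integral>\<^sup>+x. ennreal (p x \<omega> v) * indicator (A \<times> C) (x, \<omega>) \<partial>law) =
            (\<integral>\<^sup>+x. indicator C \<omega> * (ennreal (p x \<omega> v) * indicator A x) \<partial>law)"
          by (intro nn_integral_cong) (auto simp: indicator_def)
        also have "\<dots> = indicator C \<omega> * (\<integral>\<^sup>+x. ennreal (p x \<omega> v) * indicator A x \<partial>law)"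
          using pw Al by (intro nn_integral_cmult borel_measurable_times_ennreal borel_measurable_indicator)
        also have "(\<integral>\<^sup>+x. ennreal (p x \<omega> v) * indicator A x \<partial>law) = emeasure (\<kappa> v \<omega>) A"
          unfolding elim(1) by (rule emeasure_density[OF pw Al, symmetric])
        finally show ?case by (simp add: k.emeasure_eq_measure)
      qed
    qed
    also have "\<dots> = ennreal (\<integral>\<omega>. indicator C \<omega> * measure (\<kappa> v \<omega>) A \<partial>M)"
      by (rule nn_integral_indicator_eq_integral[OF CM kint]) simp
    also have "(\<integral>\<omega>. indicator C \<omega> * measure (\<kappa> v \<omega>) A \<partial>M) =
        (\<integral>\<omega>. indicator C \<omega> * real_cond_exp M (F v) (\<lambda>\<omega>. indicator A (J \<omega>)) \<omega> \<partial>M)"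
    proof (rule integral_cong_AE)
      show "AE \<omega> in M. indicator C \<omega> * measure (\<kappa> v \<omega>) A =
          indicator C \<omega> * real_cond_exp M (F v) (\<lambda>\<omega>. indicator A (J \<omega>)) \<omega>"
        using kcond by eventually_elim simp
    qed measurable
    also have "\<dots> = (\<integral>\<omega>. indicator C \<omega> * indicator A (J \<omega>) \<partial>M)"
    proof (rule Fv.real_cond_exp_intg(2))
      show "integrable M (\<lambda>\<omega>. indicator C \<omega> * indicator A (J \<omega>) :: real)"
        by (intro integrable_const_bound[where B = 1] AE_I2 borel_measurable_times borel_measurable_indicator CM IA)
          (simp add: indicator_def)
      show "(\<lambda>\<omega>. indicator C \<omega> :: real) \<in> borel_measurable (F v)" using C by simp
    qed (rule IA)
    also have "\<dots> = (\<integral>\<omega>. indicator {\<omega>\<in>space M. (J \<omega>, \<omega>) \<in> A \<times> C} \<omega> \<partial>M)"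
      by (intro Bochner_Integration.integral_cong refl) (auto simp: indicator_def)
    also have "\<dots> = measure M {\<omega>\<in>space M. (J \<omega>, \<omega>) \<in> A \<times> C}" by (simp add: Int_absorb2 subsetI)
    also have "ennreal \<dots> = emeasure (distr M ?N (\<lambda>\<omega>. (J \<omega>, \<omega>))) (A \<times> C)"
      unfolding emeasure_distr[OF Jm AC]
      by (simp add: emeasure_eq_measure vimage_def Int_def conj_commute)
    finally show ?thesis by simp
  qed
  have eq: "distr M ?N (\<lambda>\<omega>. (J \<omega>, \<omega>)) = distr ?P ?N (\<lambda>z. z)"
  proof (rule measure_eqI_generator_eq[OF Int_stable_pair_measure_generator[of "borel_of E" "F v"],
      where \<Omega> = "space (borel_of E) \<times> space (F v)" and A = "\<lambda>_. space (borel_of E) \<times> space (F v)"])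
    interpret d: prob_space "distr M ?N (\<lambda>\<omega>. (J \<omega>, \<omega>))" by (rule prob_space_distr[OF Jm])
    show "emeasure (distr M ?N (\<lambda>\<omega>. (J \<omega>, \<omega>))) (space (borel_of E) \<times> space (F v)) \<noteq> \<infinity>"
      by (simp add: d.emeasure_eq_measure)
    show "{a \<times> b |a b. a \<in> sets (borel_of E) \<and> b \<in> sets (F v)} \<subseteq> Pow (space (borel_of E) \<times> space (F v))"
      by (rule pair_measure_closed)
    show "range (\<lambda>_::nat. space (borel_of E) \<times> space (F v)) \<subseteq> {a \<times> b |a b. a \<in> sets (borel_of E) \<and> b \<in> sets (F v)}"
      by blast
    show "emeasure (distr M ?N (\<lambda>\<omega>. (J \<omega>, \<omega>))) X = emeasure (distr ?P ?N (\<lambda>z. z)) X"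
      if "X \<in> {a \<times> b |a b. a \<in> sets (borel_of E) \<and> b \<in> sets (F v)}" for X
      using that rect by blast
  qed (simp_all add: sets_pair_measure)
  have fm: "f \<in> borel_measurable (law \<Otimes>\<^sub>M M)" using measurable_compose[OF idm f] .
  have "(\<integral>\<^sup>+\<omega>. f (J \<omega>, \<omega>) \<partial>M) = (\<integral>\<^sup>+z. f z \<partial>distr M ?N (\<lambda>\<omega>. (J \<omega>, \<omega>)))"
    using f by (intro nn_integral_distr[OF Jm, symmetric]) simp
  also have "\<dots> = (\<integral>\<^sup>+z. f z \<partial>?P)" unfolding eq using f by (intro nn_integral_distr[OF idP]) simp
  also have "\<dots> = (\<integral>\<^sup>+z. (case z of (x, \<omega>) \<Rightarrow> ennreal (p x \<omega> v)) * f z \<partial>(law \<Otimes>\<^sub>M M))"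
    by (rule nn_integral_density[OF pm fm])
  also have "\<dots> = (\<integral>\<^sup>+x. \<integral>\<^sup>+\<omega>. ennreal (p x \<omega> v) * f (x, \<omega>) \<partial>M \<partial>law)"
    using nn_integral_fst[OF borel_measurable_times_ennreal[OF pm fm]] by simp
  finally show ?thesis by (simp add: mult.commute)
qed

end

lemma cadlag_right: "cadlag f \<Longrightarrow> 0 \<le> u \<Longrightarrow> (f \<longlongrightarrow> f u) (at_right u)"
  by (simp add: cadlag_def)

locale jacod_family = jacod_setup M F E J \<kappa> p for M :: "'a measure" and F
    and E :: "'e topology" and J \<kappa> p +
  fixes X :: "'e \<Rightarrow> 'a \<Rightarrow> real \<Rightarrow> real"
  assumes X_nonneg: "\<And>x \<omega> t. x \<in> topspace E \<Longrightarrow> \<omega> \<in> space M \<Longrightarrow> 0 \<le> t \<Longrightarrow> 0 \<le> X x \<omega> t"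
    and X_meas: "(\<lambda>(x, \<omega>, t). X x \<omega> t) \<in> borel_measurable (borel_of E \<Otimes>\<^sub>M optional_sigma M F)"
    and X_cadlag: "\<And>x \<omega>. x \<in> topspace E \<Longrightarrow> \<omega> \<in> space M \<Longrightarrow> cadlag (X x \<omega>)"
begin

text \<open>The constant families 0 and 1 are instances used below: neither exceeds
  \<open>n + 1\<close>, so for them only the condition that the density falls below
  \<open>1 / (n + 1)\<close> matters.\<close>

definition exit :: "nat \<Rightarrow> 'e \<Rightarrow> 'a \<Rightarrow> ennreal" where
  "exit n x \<omega> = exit_time (p x \<omega>) (X x \<omega>) n"

lemma exit_less_iff:
  assumes "x \<in> topspace E" "\<omega> \<in> space M" "0 \<le> u"
  shows "exit n x \<omega> < ennreal u \<longleftrightarrow>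
    (\<exists>q\<in>{q\<in>\<rat>. 0 \<le> q \<and> q < u}. p x \<omega> q < 1 / real (Suc n) \<or> real (Suc n) < X x \<omega> q)"
  unfolding exit_def
  using cadlag_right[OF p_cadlag[OF assms(1,2)]] cadlag_right[OF X_cadlag[OF assms(1,2)]] assms(3)
  by (rule exit_time_less_iff)

text \<open>Composed with \<open>\<omega> \<mapsto> (J \<omega>, \<omega>)\<close>, joint
  measurability at time \<open>u\<close> is what turns the family of exit times into a single
  stopping time of the enlarged filtration.\<close>

lemma exit_joint:
  assumes u: "0 \<le> u"
  shows "{z\<in>space (joint u). exit n (fst z) (snd z) < ennreal u} \<in> sets (joint u)"
proof -
  let ?N = "joint u"
  have "{z\<in>space ?N. exit n (fst z) (snd z) < ennreal u} =
      (\<Union>q\<in>{q\<in>\<rat>. 0 \<le> q \<and> q < u}. {z\<in>space ?N. p (fst z) (snd z) q < 1 / real (Suc n) \<or>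
        real (Suc n) < X (fst z) (snd z) q})"
    using u exit_less_iff by (auto simp: space_pair_measure)
  also have "\<dots> \<in> sets ?N"
  proof (rule sets.countable_UN'')
    show "countable {q\<in>\<rat>. 0 \<le> q \<and> q < u}"
      by (rule countable_subset[OF _ countable_rat]) auto
    fix q assume "q \<in> {q\<in>\<rat>. 0 \<le> q \<and> q < u}"
    then have q: "0 \<le> q" "q \<le> u" by auto
    have [measurable]: "(\<lambda>z. p (fst z) (snd z) q) \<in> borel_measurable ?N"
        "(\<lambda>z. X (fst z) (snd z) q) \<in> borel_measurable ?N"
      using measurable_pair_mono[OF q p_section[OF q(1)]]
        measurable_pair_mono[OF q optional_section[OF X_meas q(1)]] by (simp_all add: split_beta')
    show "{z\<in>space ?N. p (fst z) (snd z) q < 1 / real (Suc n) \<or> real (Suc n) < X (fst z) (snd z) q} \<in> sets ?N"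
      by measurable
  qed
  finally show ?thesis .
qed

lemma exit_section_less:
  assumes x: "x \<in> topspace E" and u: "0 \<le> u"
  shows "{\<omega>\<in>space M. exit n x \<omega> < ennreal u} \<in> sets (F u)"
proof -
  have "Pair x -` {z\<in>space (joint u). exit n (fst z) (snd z) < ennreal u} =
      {\<omega>\<in>space M. exit n x \<omega> < ennreal u}"
    using x u by (auto simp: space_pair_measure)
  then show ?thesis using sets_Pair1[OF exit_joint[OF u, of n], of x] by simp
qed

lemma exit_stopping_time: "x \<in> topspace E \<Longrightarrow> ext_stopping_time F (exit n x)"
  using exit_section_less F_right_continuous by (intro ext_stopping_timeI)

lemma cap_exit_joint:
  assumes t: "0 \<le> t"
  shows "(\<lambda>z. cap t (exit n (fst z) (snd z))) \<in> borel_measurable (joint t)"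
proof (rule measurable_cap[OF _ t])
  fix u assume u: "0 \<le> u" "u \<le> t"
  have "space (joint t) = space (joint u)"
    using u t by (simp add: space_pair_measure)
  then show "{z\<in>space (joint t). exit n (fst z) (snd z) < ennreal u} \<in> sets (joint t)"
    using sets_pair_mono[OF u exit_joint[OF u(1)]] by simp
qed

lemma sample_joint:
  assumes t: "0 \<le> t"
    and Y: "(\<lambda>(x, \<omega>, t). Y x \<omega> t) \<in> borel_measurable (borel_of E \<Otimes>\<^sub>M optional_sigma M F)"
    and cad: "\<And>x \<omega>. x \<in> topspace E \<Longrightarrow> \<omega> \<in> space M \<Longrightarrow> cadlag (Y x \<omega>)"
  shows "(\<lambda>z. Y (fst z) (snd z) (cap t (exit n (fst z) (snd z)))) \<in> borel_measurable (joint t)"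
proof (rule measurable_sample_right_continuous[OF cap_exit_joint[OF t]])
  show "0 \<le> cap t (exit n (fst z) (snd z)) \<and> cap t (exit n (fst z) (snd z)) \<le> t" for z
    using cap_nonneg cap_le[OF t] by blast
  show "(\<lambda>z. Y (fst z) (snd z) u) \<in> borel_measurable (joint t)" if "0 \<le> u" "u \<le> t" for u
    using measurable_pair_mono[OF that optional_section[OF Y that(1)]] by (simp add: split_beta')
  show "(Y (fst z) (snd z) \<longlongrightarrow> Y (fst z) (snd z) u) (at_right u)"
    if "z \<in> space (joint t)" "0 \<le> u" for z u
    using that t by (intro cadlag_right cad) (auto simp: space_pair_measure)
qed

lemma section_measurable:
  assumes x: "x \<in> topspace E" and t: "0 \<le> t" and g: "g \<in> joint t \<rightarrow>\<^sub>M N"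
  shows "(\<lambda>\<omega>. g (x, \<omega>)) \<in> F t \<rightarrow>\<^sub>M N"
  using measurable_Pair2[OF g, of x] x by simp

lemma X_adapted:
  assumes x: "x \<in> topspace E"
  shows "adapted F (X x)"
  unfolding adapted_def
proof (intro allI impI)
  fix t :: real assume t: "0 \<le> t"
  show "(\<lambda>\<omega>. X x \<omega> t) \<in> borel_measurable (F t)"
    using section_measurable[OF x t optional_section[OF X_meas t]] by simp
qed

lemma exit_sampled_measurable:
  assumes x: "x \<in> topspace E" and t: "0 \<le> t"
  shows "(\<lambda>\<omega>. X x \<omega> (cap t (exit n x \<omega>))) \<in> borel_measurable M"
    and "(\<lambda>\<omega>. p x \<omega> (cap t (exit n x \<omega>))) \<in> borel_measurable M"
  using section_measurable[OF x t sample_joint[OF t X_meas X_cadlag], of n]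
    section_measurable[OF x t sample_joint[OF t p_meas p_cadlag], of n]
  by (auto intro!: measurable_F_M[OF t])

lemma cap_exit_less:
  assumes "x \<in> topspace E" "0 \<le> u" "u \<le> t"
  shows "{\<omega>\<in>space M. cap t (exit n x \<omega>) < u} \<in> sets (F u)"
  using exit_section_less[OF assms(1,2)] by (simp only: cap_less_iff[OF assms(2,3)])

end

section \<open>Densities near zero\<close>

context jacod_setup
begin

interpretation zero: jacod_family M F E J \<kappa> p "\<lambda>_ _ _. 0"
  by unfold_locales (auto simp: cadlag_def)

text \<open>A nonnegative martingale that has fallen to the level \<open>1 / (n + 1)\<close> keeps a
  mean of that order. Having fallen before \<open>N\<close> is not an event of one fixed earlier
  time, so its indicator is replaced by a continuous function of the density at the capped exit
  time, which \<open>optional_sampling\<close> accepts as a weight.\<close>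

lemma density_bound_after_small:
  assumes x: "x \<in> topspace E" and N: "0 \<le> N"
  shows "(\<integral>\<^sup>+\<omega>. indicator {\<omega>\<in>space M. zero.exit n x \<omega> < ennreal N} \<omega> * ennreal (p x \<omega> N) \<partial>M)
    \<le> ennreal (2 / real (Suc n))"
proof -
  \<comment> \<open>A continuous cutoff: 1 on nonnegative values up to \<open>1 / (n + 1)\<close>
    and 0 from \<open>2 / (n + 1)\<close> on. Hence \<open>\<psi> y * y \<le> 2 / (n + 1)\<close>,
    the origin of the factor 2; continuity keeps the weight right continuous along paths.\<close>
  define \<psi> where "\<psi> = (\<lambda>y. max 0 (min 1 (2 - y * real (Suc n))))"
  define R where "R = (\<lambda>\<omega>. cap N (zero.exit n x \<omega>))"
  have pR [measurable]: "(\<lambda>\<omega>. p x \<omega> (R \<omega>)) \<in> borel_measurable M"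
    unfolding R_def by (rule zero.exit_sampled_measurable(2)[OF x N])
  have \<psi>01: "0 \<le> \<psi> y" "\<psi> y \<le> 1" for y by (auto simp: \<psi>_def)
  have \<psi>y: "\<psi> y * y \<le> 2 / real (Suc n)" if "0 \<le> y" for y
  proof (cases "y * real (Suc n) \<le> 2")
    case True
    then have "y \<le> 2 / real (Suc n)" by (simp add: pos_le_divide_eq)
    then show ?thesis using mult_mono[OF \<psi>01(2)[of y] \<open>y \<le> 2 / real (Suc n)\<close>] that \<psi>01(1)[of y] by simp
  next
    case False
    then have "\<psi> y = 0" by (simp add: \<psi>_def)
    then show ?thesis by simp
  qed
  have adp: "adapted F (p x)" using p_martingale[OF x] by (simp add: martingale_def)
  have os: "(\<integral>\<^sup>+\<omega>. indicator (space M) \<omega> * ennreal (\<psi> (p x \<omega> (R \<omega>)) * p x \<omega> N) \<partial>M) =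
      (\<integral>\<^sup>+\<omega>. indicator (space M) \<omega> * ennreal (\<psi> (p x \<omega> (R \<omega>)) * p x \<omega> (R \<omega>)) \<partial>M)"
  proof (rule optional_sampling[OF p_martingale[OF x], where s = 0 and t = N and c = 2])
    show "adapted F (\<lambda>\<omega> u. \<psi> (p x \<omega> u))"
      using adp unfolding adapted_def \<psi>_def by auto
    show "\<psi> (p x \<omega> u) * p x \<omega> u \<le> 2" if "\<omega> \<in> space M" "0 \<le> u" for \<omega> u
    proof -
      have "2 / real (Suc n) \<le> 2" by (simp add: divide_le_eq)
      then show ?thesis using \<psi>y[OF p_nonneg[OF x that]] by linarith
    qed
    show "\<psi> (p x \<omega> u) \<le> 2" for \<omega> u using \<psi>01(2)[of "p x \<omega> u"] by linarith
    show "AE \<omega> in M. \<forall>u\<ge>0. (p x \<omega> \<longlongrightarrow> p x \<omega> u) (at_right u)"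
      using cadlag_right[OF p_cadlag[OF x]] by (intro AE_I2) auto
    show "AE \<omega> in M. \<forall>u\<ge>0. ((\<lambda>u. \<psi> (p x \<omega> u)) \<longlongrightarrow> \<psi> (p x \<omega> u)) (at_right u)"
      using cadlag_right[OF p_cadlag[OF x]] unfolding \<psi>_def by (intro AE_I2 allI impI tendsto_intros) auto
    show "0 \<le> R \<omega> \<and> R \<omega> \<le> N" for \<omega> unfolding R_def using cap_nonneg cap_le[OF N] by blast
    show "{\<omega> \<in> space M. R \<omega> < u} \<in> sets (F u)" if "0 \<le> u" "u \<le> N" for u
      unfolding R_def by (rule zero.cap_exit_less[OF x that])
    show "space M \<in> sets (F 0)" using sets.top[of "F 0"] by simp
    show "(\<lambda>\<omega>. \<psi> (p x \<omega> (R \<omega>))) \<in> borel_measurable M" unfolding \<psi>_def by measurable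
    show "0 \<le> R \<omega>" for \<omega> unfolding R_def by (rule cap_nonneg)
  qed (use p_nonneg[OF x] \<psi>01 N pR in auto)
  have "(\<integral>\<^sup>+\<omega>. indicator {\<omega>\<in>space M. zero.exit n x \<omega> < ennreal N} \<omega> * ennreal (p x \<omega> N) \<partial>M)
      \<le> (\<integral>\<^sup>+\<omega>. indicator (space M) \<omega> * ennreal (\<psi> (p x \<omega> (R \<omega>)) * p x \<omega> N) \<partial>M)"
  proof (rule nn_integral_mono)
    fix \<omega> assume w: "\<omega> \<in> space M"
    show "indicator {\<omega>\<in>space M. zero.exit n x \<omega> < ennreal N} \<omega> * ennreal (p x \<omega> N)
        \<le> indicator (space M) \<omega> * ennreal (\<psi> (p x \<omega> (R \<omega>)) * p x \<omega> N)"
    proof (cases "zero.exit n x \<omega> < ennreal N")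
      case True
      then have "zero.exit n x \<omega> = ennreal (R \<omega>)"
        unfolding R_def ennreal_cap by (simp add: min_absorb2 less_imp_le)
      \<comment> \<open>The second alternative comes from the constant process 0 and is
        void.\<close>
      then have "p x \<omega> (R \<omega>) \<le> 1 / real (Suc n) \<or> real (Suc n) \<le> 0"
        using cadlag_right[OF p_cadlag[OF x w]] cap_nonneg unfolding zero.exit_def
        by (intro exit_time_value[of "p x \<omega>" "\<lambda>_. 0" "R \<omega>" n]) (auto simp: R_def)
      then have "p x \<omega> (R \<omega>) * real (Suc n) \<le> 1" by (simp add: pos_le_divide_eq)
      then have "\<psi> (p x \<omega> (R \<omega>)) = 1" by (simp add: \<psi>_def)
      then show ?thesis using w True by simp
    qed simp
  qed
  also note os
  also have "(\<integral>\<^sup>+\<omega>. indicator (space M) \<omega> * ennreal (\<psi> (p x \<omega> (R \<omega>)) * p x \<omega> (R \<omega>)) \<partial>M)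
      \<le> (\<integral>\<^sup>+\<omega>. ennreal (2 / real (Suc n)) \<partial>M)"
    using \<psi>y p_nonneg[OF x] cap_nonneg by (intro nn_integral_mono) (auto simp: R_def intro!: ennreal_leI)
  also have "\<dots> = ennreal (2 / real (Suc n))" by (simp add: emeasure_space_1)
  finally show ?thesis .
qed

lemma ennreal_le_over_n_zero:
  assumes "\<And>n. a \<le> ennreal (2 / real (Suc n))"
  shows "a = 0"
proof -
  have "(\<lambda>n. 2 / real (Suc n)) \<longlonglongrightarrow> 0"
    using lim_const_over_n[THEN LIMSEQ_Suc, of 2] .
  then have "(\<lambda>n. ennreal (2 / real (Suc n))) \<longlonglongrightarrow> ennreal 0" by (rule tendsto_ennrealI)
  then have "a \<le> ennreal 0" using assms by (intro LIMSEQ_le_const) auto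
  then show ?thesis by simp
qed

text \<open>The preceding estimate holds for every \<open>n\<close>, so paths that come below every
  level before \<open>N\<close> carry no mass of \<open>p x\<close> at \<open>N\<close>. This covers
  paths whose left limit vanishes as well as paths that reach zero. Restricting \<open>N\<close> to
  rationals keeps the exceptional set a countable union of null sets.\<close>

lemma density_absorbed:
  assumes x: "x \<in> topspace E"
  shows "AE \<omega> in M. \<forall>N\<in>{q\<in>\<rat>. 0 \<le> q}. (\<forall>n. exit_time (p x \<omega>) (\<lambda>_. 0) n < ennreal N) \<longrightarrow> p x \<omega> N = 0"
proof (subst AE_ball_countable)
  show "countable {q\<in>\<rat>. 0 \<le> (q::real)}" by (rule countable_subset[OF _ countable_rat]) auto
  show "\<forall>N\<in>{q\<in>\<rat>. 0 \<le> q}. AE \<omega> in M. (\<forall>n. exit_time (p x \<omega>) (\<lambda>_. 0) n < ennreal N) \<longrightarrow> p x \<omega> N = 0"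
  proof
    fix N assume "N \<in> {q\<in>\<rat>. 0 \<le> (q::real)}"
    then have N: "0 \<le> N" by simp
    let ?A = "\<lambda>n. {\<omega>\<in>space M. zero.exit n x \<omega> < ennreal N}"
    have AM [measurable]: "?A n \<in> sets M" for n
      using zero.exit_section_less[OF x N] sets_F_sets[OF N] by blast
    have [measurable]: "(\<lambda>\<omega>. p x \<omega> N) \<in> borel_measurable M"
      by (rule martingaleD(1)[OF p_martingale[OF x] N])
    have "(\<integral>\<^sup>+\<omega>. indicator (\<Inter>n. ?A n) \<omega> * ennreal (p x \<omega> N) \<partial>M) \<le> ennreal (2 / real (Suc n))" for n
      by (rule order_trans[OF nn_integral_mono density_bound_after_small[OF x N]]) (auto simp: indicator_def)
    then have "(\<integral>\<^sup>+\<omega>. indicator (\<Inter>n. ?A n) \<omega> * ennreal (p x \<omega> N) \<partial>M) = 0"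
      by (rule ennreal_le_over_n_zero)
    then have "AE \<omega> in M. indicator (\<Inter>n. ?A n) \<omega> * ennreal (p x \<omega> N) = 0"
      by (subst (asm) nn_integral_0_iff_AE) auto
    then show "AE \<omega> in M. (\<forall>n. exit_time (p x \<omega>) (\<lambda>_. 0) n < ennreal N) \<longrightarrow> p x \<omega> N = 0"
      using AE_space
    proof eventually_elim
      case (elim \<omega>)
      show ?case
      proof
        assume "\<forall>n. exit_time (p x \<omega>) (\<lambda>_. 0) n < ennreal N"
        then have "\<omega> \<in> (\<Inter>n. ?A n)" using elim(2) by (simp add: zero.exit_def)
        then have "ennreal (p x \<omega> N) = 0" using elim(1) by simp
        then show "p x \<omega> N = 0" using p_nonneg[OF x elim(2) N] by simp
      qed
    qed
  qed
qed

text \<open>By disintegration the probability that the density along \<open>J\<close> drops below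
  \<open>1 / (n + 1)\<close> before \<open>N\<close> is the average over \<open>x\<close> of the
  mean bounded in \<open>density_bound_after_small\<close>, hence at most
  \<open>2 / (n + 1)\<close>. A lower bound on compacts controls left limits too, which positivity
  alone would not.\<close>

lemma p_J_bounded_below:
  "AE \<omega> in M. \<forall>t. \<exists>a>0. \<forall>u. 0 \<le> u \<and> u \<le> t \<longrightarrow> a \<le> p (J \<omega>) \<omega> u"
proof -
  have "AE \<omega> in M. \<exists>n. \<not> zero.exit n (J \<omega>) \<omega> < ennreal (real N)" for N
  proof -
    let ?A = "\<lambda>n. {z\<in>space (joint (real N)). zero.exit n (fst z) (snd z) < ennreal (real N)}"
    let ?B = "\<lambda>n. {\<omega>\<in>space M. zero.exit n (J \<omega>) \<omega> < ennreal (real N)}"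
    have A: "?A n \<in> sets (joint (real N))" for n by (rule zero.exit_joint) simp
    have B: "?B n = (\<lambda>\<omega>. (J \<omega>, \<omega>)) -` ?A n \<inter> space M" for n
      using J_in by (auto simp: space_pair_measure)
    have BM: "?B n \<in> sets M" for n
      unfolding B by (rule measurable_sets[OF measurable_J_pair A]) simp
    have "emeasure M (?B n) \<le> ennreal (2 / real (Suc n))" for n
    proof -
      have "emeasure M (?B n) = (\<integral>\<^sup>+\<omega>. indicator (?B n) \<omega> \<partial>M)" using BM by simp
      also have "\<dots> = (\<integral>\<^sup>+\<omega>. indicator (?A n) (J \<omega>, \<omega>) \<partial>M)"
        by (intro nn_integral_cong) (use J_in in \<open>auto simp: indicator_def space_pair_measure\<close>)
      also have "\<dots> = (\<integral>\<^sup>+x. \<integral>\<^sup>+\<omega>. indicator (?A n) (x, \<omega>) * ennreal (p x \<omega> (real N)) \<partial>M \<partial>law)"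
        using A by (intro disintegration) auto
      also have "\<dots> \<le> (\<integral>\<^sup>+x. ennreal (2 / real (Suc n)) \<partial>law)"
      proof (rule nn_integral_mono)
        fix x assume "x \<in> space law"
        then have x: "x \<in> topspace E" by simp
        have "(\<integral>\<^sup>+\<omega>. indicator (?A n) (x, \<omega>) * ennreal (p x \<omega> (real N)) \<partial>M) =
            (\<integral>\<^sup>+\<omega>. indicator {\<omega>\<in>space M. zero.exit n x \<omega> < ennreal (real N)} \<omega> * ennreal (p x \<omega> (real N)) \<partial>M)"
          by (intro nn_integral_cong) (use x in \<open>auto simp: indicator_def space_pair_measure\<close>)
        also have "\<dots> \<le> ennreal (2 / real (Suc n))" by (rule density_bound_after_small[OF x]) simp
        finally show "(\<integral>\<^sup>+\<omega>. indicator (?A n) (x, \<omega>) * ennreal (p x \<omega> (real N)) \<partial>M) \<le> ennreal (2 / real (Suc n))" .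
      qed
      also have "\<dots> = ennreal (2 / real (Suc n))" using law.emeasure_space_1 by simp
      finally show ?thesis .
    qed
    then have "emeasure M (\<Inter>n. ?B n) \<le> ennreal (2 / real (Suc n))" for n
      by (rule order_trans[rotated]) (rule emeasure_mono[OF _ BM], blast)
    then have "emeasure M (\<Inter>n. ?B n) = 0" by (rule ennreal_le_over_n_zero)
    moreover have "(\<Inter>n. ?B n) \<in> sets M" using BM by (intro sets.countable_INT) auto
    ultimately have "(\<Inter>n. ?B n) \<in> null_sets M" by (simp add: null_sets_def)
    then show ?thesis by (rule AE_I') auto
  qed
  then have "AE \<omega> in M. \<forall>N. \<exists>n. \<not> zero.exit n (J \<omega>) \<omega> < ennreal (real N)" by (simp add: AE_all_countable)
  then show ?thesis
  proof eventually_elim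
    case (elim \<omega>)
    show ?case
    proof
      fix t :: real
      obtain N where N: "t < real N" using reals_Archimedean2 by blast
      obtain n where n: "\<not> zero.exit n (J \<omega>) \<omega> < ennreal (real N)" using elim by blast
      have "1 / real (Suc n) \<le> p (J \<omega>) \<omega> u" if "0 \<le> u" "u \<le> t" for u
      proof (rule exit_time_below(1)[OF that(1)])
        have "ennreal u < ennreal (real N)" using that N by (intro ennreal_lessI) auto
        then show "ennreal u < exit_time (p (J \<omega>) \<omega>) (\<lambda>_. 0) n"
          using n unfolding zero.exit_def by (meson less_le_trans not_less)
      qed
      then show "\<exists>a>0. \<forall>u. 0 \<le> u \<and> u \<le> t \<longrightarrow> a \<le> p (J \<omega>) \<omega> u"
        by (intro exI[of _ "1 / real (Suc n)"]) simp
    qed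
  qed
qed

end

text \<open>A bounded substitute for the quotient that is continuous in both arguments: the
  numerator is capped, the denominator kept away from zero. It agrees with the quotient from some
  \<open>m\<close> on.\<close>

lemma truncated_quotient:
  fixes a b :: real
  assumes a: "0 \<le> a" and b: "0 < b"
  shows "incseq (\<lambda>m. min a (real (Suc m)) / max b (1 / real (Suc m)))"
    and "(\<lambda>m. min a (real (Suc m)) / max b (1 / real (Suc m))) \<longlonglongrightarrow> a / b"
proof -
  have "min a (real (Suc m)) / max b (1 / real (Suc m)) \<le> min a (real (Suc n)) / max b (1 / real (Suc n))"
    if "m \<le> n" for m n
  proof (rule frac_le)
    have "1 / real (Suc n) \<le> 1 / real (Suc m)" using that by (intro divide_left_mono) auto
    then show "max b (1 / real (Suc n)) \<le> max b (1 / real (Suc m))" by (intro max.mono) auto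
    show "min a (real (Suc m)) \<le> min a (real (Suc n))" using that by (intro min.mono) auto
  qed (use a b in auto)
  then show "incseq (\<lambda>m. min a (real (Suc m)) / max b (1 / real (Suc m)))" by (simp add: incseq_def)
  have "\<forall>\<^sub>F m in sequentially. min a (real (Suc m)) / max b (1 / real (Suc m)) = a / b"
    using eventually_ge_at_top[of "nat \<lceil>max a (1 / b)\<rceil>"]
  proof eventually_elim
    case (elim m)
    then have "a \<le> real (Suc m)" "1 / b \<le> real (Suc m)" using of_nat_ceiling[of "max a (1 / b)"] by linarith+
    moreover from this(2) have "1 / real (Suc m) \<le> b" using b by (simp add: field_simps)
    ultimately show ?case by (simp add: min_absorb1 max_absorb1)
  qed
  then show "(\<lambda>m. min a (real (Suc m)) / max b (1 / real (Suc m))) \<longlonglongrightarrow> a / b"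
    by (rule tendsto_eventually)
qed

text \<open>The product makes sense for \<open>b = 0\<close> and then vanishes for every
  \<open>m\<close>. The restriction to a positive density originates here.\<close>

lemma truncated_product:
  fixes a b :: real
  assumes a: "0 \<le> a" and b: "0 \<le> b"
  shows "incseq (\<lambda>m. min a (real (Suc m)) / max b (1 / real (Suc m)) * b)"
    and "(\<lambda>m. min a (real (Suc m)) / max b (1 / real (Suc m)) * b) \<longlonglongrightarrow> (if 0 < b then a else 0)"
proof -
  have "incseq (\<lambda>m. min a (real (Suc m)) / max b (1 / real (Suc m)) * b) \<and>
    (\<lambda>m. min a (real (Suc m)) / max b (1 / real (Suc m)) * b) \<longlonglongrightarrow> (if 0 < b then a else 0)"
  proof (cases "b = 0")
    case False
    then have b': "0 < b" using b by simp
    have "(\<lambda>m. min a (real (Suc m)) / max b (1 / real (Suc m)) * b) \<longlonglongrightarrow> a / b * b"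
      by (intro tendsto_intros truncated_quotient(2) a b')
    moreover have "incseq (\<lambda>m. min a (real (Suc m)) / max b (1 / real (Suc m)) * b)"
      using truncated_quotient(1)[OF a b'] unfolding incseq_def by (metis b mult_right_mono)
    ultimately show ?thesis using b' by simp
  qed (simp add: incseq_def)
  then show "incseq (\<lambda>m. min a (real (Suc m)) / max b (1 / real (Suc m)) * b)"
    "(\<lambda>m. min a (real (Suc m)) / max b (1 / real (Suc m)) * b) \<longlonglongrightarrow> (if 0 < b then a else 0)"
    by blast+
qed

lemma ennreal_indicator_LIMSEQ:
  assumes "incseq f" "f \<longlonglongrightarrow> (c::real)"
  shows "incseq (\<lambda>m. indicator D z * ennreal (f m)) \<and>
    (\<lambda>m. indicator D z * ennreal (f m)) \<longlonglongrightarrow> indicator D z * ennreal c"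
  using assms by (auto simp: incseq_def indicator_def intro!: ennreal_leI tendsto_ennrealI)

section \<open>Conditioning at exit times\<close>

context jacod_family
begin

text \<open>
  Joint measurability of \<open>D\<close> is asked for only at the later time \<open>v\<close>: an event like \<open>0 < exit n x \<omega>\<close> lies in
  \<open>F 0\<close> for each \<open>x\<close> by right-continuity, but right-continuity does not carry over to the product with
  \<open>borel_of E\<close>.
\<close>

lemma conditioning_at_exit:
  assumes times: "0 \<le> s" "s \<le> t" "t \<le> v"
    and D: "D \<in> sets (joint v)"
    and Dx: "\<And>x. x \<in> topspace E \<Longrightarrow> {\<omega>\<in>space M. (x, \<omega>) \<in> D} \<in> sets (F s)"
    and Ds: "\<And>x \<omega>. (x, \<omega>) \<in> D \<Longrightarrow> ennreal s \<le> exit n x \<omega>"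
  shows "(\<integral>\<^sup>+\<omega>. indicator D (J \<omega>, \<omega>) *
        ennreal (X (J \<omega>) \<omega> (cap t (exit n (J \<omega>) \<omega>)) / p (J \<omega>) \<omega> (cap t (exit n (J \<omega>) \<omega>))) \<partial>M) =
    (\<integral>\<^sup>+x. \<integral>\<^sup>+\<omega>. indicator D (x, \<omega>) *
        ennreal (if 0 < p x \<omega> (cap t (exit n x \<omega>)) then X x \<omega> (cap t (exit n x \<omega>)) else 0) \<partial>M \<partial>law)"
proof -
  let ?N = "joint v"
  define R where "R = (\<lambda>x \<omega>. cap t (exit n x \<omega>))"
  have t: "0 \<le> t" and v: "0 \<le> v" using times by auto
  have R: "0 \<le> R x \<omega>" "R x \<omega> \<le> t" for x \<omega>
    unfolding R_def by (rule cap_nonneg, rule cap_le[OF t])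
  have XR: "(\<lambda>z. X (fst z) (snd z) (R (fst z) (snd z))) \<in> borel_measurable ?N"
    unfolding R_def by (rule measurable_pair_mono[OF t times(3) sample_joint[OF t X_meas X_cadlag]])
  have pR: "(\<lambda>z. p (fst z) (snd z) (R (fst z) (snd z))) \<in> borel_measurable ?N"
    unfolding R_def by (rule measurable_pair_mono[OF t times(3) sample_joint[OF t p_meas p_cadlag]])
  \<comment> \<open>With numerator and denominator truncated, both \<open>\<Phi>\<close> and its
    product with the density are bounded by \<open>(m + 1) * (m + 1)\<close>, as
    \<open>optional_sampling\<close> requires for the martingale \<open>p x\<close>.\<close>
  define \<Phi> where "\<Phi> = (\<lambda>m x \<omega> u. min (X x \<omega> u) (real (Suc m)) / max (p x \<omega> u) (1 / real (Suc m)))"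
  have \<Phi>R [measurable]: "(\<lambda>z. \<Phi> m (fst z) (snd z) (R (fst z) (snd z))) \<in> borel_measurable ?N" for m
    unfolding \<Phi>_def using XR pR by measurable
  have \<Phi>0: "0 \<le> \<Phi> m x \<omega> u" if "x \<in> topspace E" "\<omega> \<in> space M" "0 \<le> u" for m x \<omega> u
    using X_nonneg[OF that] by (simp add: \<Phi>_def le_max_iff_disj)
  have \<Phi>c: "\<Phi> m x \<omega> u \<le> real (Suc m) * real (Suc m)" if "x \<in> topspace E" "\<omega> \<in> space M" "0 \<le> u" for m x \<omega> u
  proof -
    have "\<Phi> m x \<omega> u \<le> real (Suc m) / (1 / real (Suc m))"
      unfolding \<Phi>_def using X_nonneg[OF that] by (intro frac_le) auto
    then show ?thesis by simp
  qed
  have \<Phi>p: "\<Phi> m x \<omega> u * p x \<omega> u \<le> real (Suc m) * real (Suc m)"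
    if "x \<in> topspace E" "\<omega> \<in> space M" "0 \<le> u" for m x \<omega> u
  proof -
    have "p x \<omega> u / max (p x \<omega> u) (1 / real (Suc m)) \<le> 1"
      using p_nonneg[OF that] by (subst divide_le_eq_1_pos) (auto simp: less_max_iff_disj)
    then have "min (X x \<omega> u) (real (Suc m)) * (p x \<omega> u / max (p x \<omega> u) (1 / real (Suc m))) \<le> real (Suc m) * 1"
      using X_nonneg[OF that] p_nonneg[OF that] by (intro mult_mono) (auto simp: le_max_iff_disj)
    then have "\<Phi> m x \<omega> u * p x \<omega> u \<le> real (Suc m)" by (simp add: \<Phi>_def)
    also have "\<dots> \<le> real (Suc m) * real (Suc m)" by simp
    finally show ?thesis .
  qed
  have step: "(\<integral>\<^sup>+\<omega>. indicator D (J \<omega>, \<omega>) * ennreal (\<Phi> m (J \<omega>) \<omega> (R (J \<omega>) \<omega>)) \<partial>M) =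
      (\<integral>\<^sup>+x. \<integral>\<^sup>+\<omega>. indicator D (x, \<omega>) * ennreal (\<Phi> m x \<omega> (R x \<omega>) * p x \<omega> (R x \<omega>)) \<partial>M \<partial>law)" for m
  proof -
    define f where "f = (\<lambda>z. indicator D z * ennreal (\<Phi> m (fst z) (snd z) (R (fst z) (snd z))))"
    have fm: "f \<in> borel_measurable ?N" unfolding f_def using D by measurable
    have "(\<integral>\<^sup>+\<omega>. indicator D (J \<omega>, \<omega>) * ennreal (\<Phi> m (J \<omega>) \<omega> (R (J \<omega>) \<omega>)) \<partial>M) = (\<integral>\<^sup>+\<omega>. f (J \<omega>, \<omega>) \<partial>M)"
      by (simp add: f_def)
    also have "\<dots> = (\<integral>\<^sup>+x. \<integral>\<^sup>+\<omega>. f (x, \<omega>) * ennreal (p x \<omega> v) \<partial>M \<partial>law)" by (rule disintegration[OF v fm])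
    also have "\<dots> = (\<integral>\<^sup>+x. \<integral>\<^sup>+\<omega>. indicator D (x, \<omega>) * ennreal (\<Phi> m x \<omega> (R x \<omega>) * p x \<omega> (R x \<omega>)) \<partial>M \<partial>law)"
    proof (rule nn_integral_cong)
      fix x assume "x \<in> space law"
      then have x: "x \<in> topspace E" by simp
      let ?Dx = "{\<omega>\<in>space M. (x, \<omega>) \<in> D}"
      have "(\<integral>\<^sup>+\<omega>. f (x, \<omega>) * ennreal (p x \<omega> v) \<partial>M) =
          (\<integral>\<^sup>+\<omega>. indicator ?Dx \<omega> * ennreal (\<Phi> m x \<omega> (R x \<omega>) * p x \<omega> v) \<partial>M)"
        using \<Phi>0[OF x _ R(1)] by (intro nn_integral_cong) (auto simp: f_def indicator_def ennreal_mult')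
      also have "\<dots> = (\<integral>\<^sup>+\<omega>. indicator ?Dx \<omega> * ennreal (\<Phi> m x \<omega> (R x \<omega>) * p x \<omega> (R x \<omega>)) \<partial>M)"
      proof (rule optional_sampling[OF p_martingale[OF x] _ _ _ _ _ _ _ times,
            where c = "real (Suc m) * real (Suc m)"])
        have pa: "adapted F (p x)" using p_martingale[OF x] by (simp add: martingale_def)
        then show "adapted F (\<Phi> m x)"
          using X_adapted[OF x] unfolding adapted_def \<Phi>_def
          by (auto intro!: borel_measurable_divide borel_measurable_min borel_measurable_max)
        show "AE \<omega> in M. \<forall>u\<ge>0. (p x \<omega> \<longlongrightarrow> p x \<omega> u) (at_right u)"
          using cadlag_right[OF p_cadlag[OF x]] by (intro AE_I2) auto
        show "AE \<omega> in M. \<forall>u\<ge>0. (\<Phi> m x \<omega> \<longlongrightarrow> \<Phi> m x \<omega> u) (at_right u)"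
          using cadlag_right[OF p_cadlag[OF x]] cadlag_right[OF X_cadlag[OF x]] unfolding \<Phi>_def
          by (intro AE_I2 allI impI tendsto_intros) (auto simp: max_def)
        show "{\<omega> \<in> space M. R x \<omega> < u} \<in> sets (F u)" if "0 \<le> u" "u \<le> t" for u
          unfolding R_def by (rule cap_exit_less[OF x that])
        show "s \<le> R x \<omega>" if "\<omega> \<in> ?Dx" for \<omega>
          unfolding R_def using that Ds[of x \<omega>] cap_less_iff[OF times(1,2), of "exit n x \<omega>"]
          by (metis (no_types, lifting) mem_Collect_eq not_le)
        show "(\<lambda>\<omega>. p x \<omega> (R x \<omega>)) \<in> borel_measurable M"
          unfolding R_def by (rule exit_sampled_measurable(2)[OF x t])
        then show "(\<lambda>\<omega>. \<Phi> m x \<omega> (R x \<omega>)) \<in> borel_measurable M"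
          using exit_sampled_measurable(1)[OF x t, of n] unfolding \<Phi>_def R_def by measurable
      qed (use p_nonneg[OF x] \<Phi>0[OF x] \<Phi>c[OF x] \<Phi>p[OF x] R Dx[OF x] in auto)
      also have "\<dots> = (\<integral>\<^sup>+\<omega>. indicator D (x, \<omega>) * ennreal (\<Phi> m x \<omega> (R x \<omega>) * p x \<omega> (R x \<omega>)) \<partial>M)"
        by (intro nn_integral_cong) (auto simp: indicator_def)
      finally show "(\<integral>\<^sup>+\<omega>. f (x, \<omega>) * ennreal (p x \<omega> v) \<partial>M) =
        (\<integral>\<^sup>+\<omega>. indicator D (x, \<omega>) * ennreal (\<Phi> m x \<omega> (R x \<omega>) * p x \<omega> (R x \<omega>)) \<partial>M)" .
    qed
    finally show ?thesis .
  qed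
  \<comment> \<open>Along \<open>J\<close> the sampled density is almost surely positive, so the
    truncated quotients increase to a genuine quotient and the default value of division by zero is
    kept out. On the other side of the identity \<open>x\<close> is fixed and the density may
    vanish.\<close>
  have lim1: "(\<lambda>m. \<integral>\<^sup>+\<omega>. indicator D (J \<omega>, \<omega>) * ennreal (\<Phi> m (J \<omega>) \<omega> (R (J \<omega>) \<omega>)) \<partial>M) \<longlonglongrightarrow>
      (\<integral>\<^sup>+\<omega>. indicator D (J \<omega>, \<omega>) * ennreal (X (J \<omega>) \<omega> (R (J \<omega>) \<omega>) / p (J \<omega>) \<omega> (R (J \<omega>) \<omega>)) \<partial>M)"
  proof (rule nn_integral_LIMSEQ_AE)
    fix m
    have "(\<lambda>z. indicator D z * ennreal (\<Phi> m (fst z) (snd z) (R (fst z) (snd z)))) \<in> borel_measurable ?N"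
      using D by measurable
    from measurable_compose[OF measurable_J_pair[OF v] this]
    show "(\<lambda>\<omega>. indicator D (J \<omega>, \<omega>) * ennreal (\<Phi> m (J \<omega>) \<omega> (R (J \<omega>) \<omega>))) \<in> borel_measurable M" by simp
  next
    show "AE \<omega> in M. incseq (\<lambda>m. indicator D (J \<omega>, \<omega>) * ennreal (\<Phi> m (J \<omega>) \<omega> (R (J \<omega>) \<omega>))) \<and>
      (\<lambda>m. indicator D (J \<omega>, \<omega>) * ennreal (\<Phi> m (J \<omega>) \<omega> (R (J \<omega>) \<omega>))) \<longlonglongrightarrow>
        indicator D (J \<omega>, \<omega>) * ennreal (X (J \<omega>) \<omega> (R (J \<omega>) \<omega>) / p (J \<omega>) \<omega> (R (J \<omega>) \<omega>))"
      using p_J_bounded_below AE_space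
    proof eventually_elim
      case (elim \<omega>)
      then obtain a where a: "0 < a" "\<And>u. 0 \<le> u \<Longrightarrow> u \<le> t \<Longrightarrow> a \<le> p (J \<omega>) \<omega> u" by blast
      have "0 < p (J \<omega>) \<omega> (R (J \<omega>) \<omega>)" using a(1) a(2)[OF R] by (rule less_le_trans)
      then show ?case
        unfolding \<Phi>_def
        by (intro ennreal_indicator_LIMSEQ truncated_quotient X_nonneg J_in elim R)
    qed
  qed
  have hm: "(\<lambda>z. indicator D z * ennreal (\<Phi> m (fst z) (snd z) (R (fst z) (snd z)) * p (fst z) (snd z) (R (fst z) (snd z))))
      \<in> borel_measurable ?N" for m
    using D pR by measurable
  have lim2: "(\<lambda>m. \<integral>\<^sup>+x. \<integral>\<^sup>+\<omega>. indicator D (x, \<omega>) * ennreal (\<Phi> m x \<omega> (R x \<omega>) * p x \<omega> (R x \<omega>)) \<partial>M \<partial>law)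
      \<longlonglongrightarrow> (\<integral>\<^sup>+x. \<integral>\<^sup>+\<omega>. indicator D (x, \<omega>) * ennreal (if 0 < p x \<omega> (R x \<omega>) then X x \<omega> (R x \<omega>) else 0) \<partial>M \<partial>law)"
  proof (rule nn_integral_LIMSEQ_AE)
    fix m
    have "(\<lambda>z. indicator D z * ennreal (\<Phi> m (fst z) (snd z) (R (fst z) (snd z)) * p (fst z) (snd z) (R (fst z) (snd z))))
      \<in> borel_measurable (borel_of E \<Otimes>\<^sub>M M)" by (rule measurable_pair_M[OF v hm])
    from borel_measurable_nn_integral_fst[OF this]
    show "(\<lambda>x. \<integral>\<^sup>+\<omega>. indicator D (x, \<omega>) * ennreal (\<Phi> m x \<omega> (R x \<omega>) * p x \<omega> (R x \<omega>)) \<partial>M) \<in> borel_measurable law"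
      by simp
  next
    show "AE x in law. incseq (\<lambda>m. \<integral>\<^sup>+\<omega>. indicator D (x, \<omega>) * ennreal (\<Phi> m x \<omega> (R x \<omega>) * p x \<omega> (R x \<omega>)) \<partial>M) \<and>
      (\<lambda>m. \<integral>\<^sup>+\<omega>. indicator D (x, \<omega>) * ennreal (\<Phi> m x \<omega> (R x \<omega>) * p x \<omega> (R x \<omega>)) \<partial>M)
        \<longlonglongrightarrow> (\<integral>\<^sup>+\<omega>. indicator D (x, \<omega>) * ennreal (if 0 < p x \<omega> (R x \<omega>) then X x \<omega> (R x \<omega>) else 0) \<partial>M)"
    proof (rule AE_I2)
      fix x assume "x \<in> space law"
      then have x: "x \<in> topspace E" by simp
      have *: "incseq (\<lambda>m. indicator D (x, \<omega>) * ennreal (\<Phi> m x \<omega> (R x \<omega>) * p x \<omega> (R x \<omega>))) \<and>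
        (\<lambda>m. indicator D (x, \<omega>) * ennreal (\<Phi> m x \<omega> (R x \<omega>) * p x \<omega> (R x \<omega>))) \<longlonglongrightarrow>
        indicator D (x, \<omega>) * ennreal (if 0 < p x \<omega> (R x \<omega>) then X x \<omega> (R x \<omega>) else 0)" if w: "\<omega> \<in> space M" for \<omega>
        unfolding \<Phi>_def
        by (intro ennreal_indicator_LIMSEQ truncated_product X_nonneg p_nonneg x w R)
      have sm: "(\<lambda>\<omega>. indicator D (x, \<omega>) * ennreal (\<Phi> m x \<omega> (R x \<omega>) * p x \<omega> (R x \<omega>))) \<in> borel_measurable M" for m
        using measurable_F_M[OF v section_measurable[OF x v hm[of m]]] by simp
      show "incseq (\<lambda>m. \<integral>\<^sup>+\<omega>. indicator D (x, \<omega>) * ennreal (\<Phi> m x \<omega> (R x \<omega>) * p x \<omega> (R x \<omega>)) \<partial>M) \<and>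
        (\<lambda>m. \<integral>\<^sup>+\<omega>. indicator D (x, \<omega>) * ennreal (\<Phi> m x \<omega> (R x \<omega>) * p x \<omega> (R x \<omega>)) \<partial>M)
        \<longlonglongrightarrow> (\<integral>\<^sup>+\<omega>. indicator D (x, \<omega>) * ennreal (if 0 < p x \<omega> (R x \<omega>) then X x \<omega> (R x \<omega>) else 0) \<partial>M)"
      proof
        show "incseq (\<lambda>m. \<integral>\<^sup>+\<omega>. indicator D (x, \<omega>) * ennreal (\<Phi> m x \<omega> (R x \<omega>) * p x \<omega> (R x \<omega>)) \<partial>M)"
          using * by (intro incseq_SucI nn_integral_mono) (auto simp: incseq_Suc_iff)
      qed (rule nn_integral_LIMSEQ_AE[OF sm AE_I2[OF *]])
    qed
  qed
  show ?thesis
    using LIMSEQ_unique[OF lim1[unfolded step] lim2] unfolding R_def .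
qed

end

section \<open>Cadlag paths: exit times and jumps to zero\<close>

lemma cadlag_bounded_above:
  assumes f: "cadlag f"
  shows "\<exists>c. \<forall>u. 0 \<le> u \<and> u \<le> t \<longrightarrow> f u \<le> c"
proof (cases "0 \<le> t")
  case True
  \<comment> \<open>Boundedness above passes from two adjacent intervals to their union, so
    bisection reduces it to small neighbourhoods, where the left limit, the value and the right
    limit supply a bound.\<close>
  define P where "P = (\<lambda>a b. \<exists>c. \<forall>u. 0 \<le> u \<and> a \<le> u \<and> u \<le> b \<longrightarrow> f u \<le> c)"
  have "P 0 t"
    using True
  proof (induction rule: Bolzano)
    case (trans a b c)
    then obtain c1 c2 where "\<forall>u. 0 \<le> u \<and> a \<le> u \<and> u \<le> b \<longrightarrow> f u \<le> c1" "\<forall>u. 0 \<le> u \<and> b \<le> u \<and> u \<le> c \<longrightarrow> f u \<le> c2"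
      unfolding P_def by blast
    then show ?case unfolding P_def by (intro exI[of _ "max c1 c2"]) (metis le_max_iff_disj linear)
  next
    case (local x)
    have "\<forall>\<^sub>F y in at_right x. f y < f x + 1"
      using f local by (intro order_tendstoD(2)[of _ "f x"]) (auto simp: cadlag_def)
    then obtain b where b: "x < b" "\<And>y. x < y \<Longrightarrow> y < b \<Longrightarrow> f y < f x + 1"
      unfolding eventually_at_right_field by blast
    obtain a c where a: "a < x" "\<And>y. 0 \<le> y \<Longrightarrow> a < y \<Longrightarrow> y < x \<Longrightarrow> f y < c"
    proof (cases "x = 0")
      case True
      \<comment> \<open>No left limit is available at 0. The condition \<open>0 \<le> y\<close>
        leaves nothing to the left of 0, so any negative \<open>a\<close> and any bound will
        do.\<close>
      show ?thesis by (rule that[of "-1"]) (use True in auto)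
    next
      case False
      then obtain l where "(f \<longlongrightarrow> l) (at_left x)"
        using f local unfolding cadlag_def by (metis less_le)
      then have "\<forall>\<^sub>F y in at_left x. f y < l + 1" by (intro order_tendstoD(2)[of _ l]) auto
      then obtain a where "a < x" "\<And>y. a < y \<Longrightarrow> y < x \<Longrightarrow> f y < l + 1"
        unfolding eventually_at_left_field by blast
      then show ?thesis by (intro that[of a "l + 1"]) auto
    qed
    have "P a' b'" if "a' \<le> x" "x \<le> b'" "b' - a' < min (b - x) (x - a)" for a' b'
      unfolding P_def
    proof (intro exI[of _ "max c (f x + 1)"] allI impI)
      fix u assume u: "0 \<le> u \<and> a' \<le> u \<and> u \<le> b'"
      consider "u < x" | "u = x" | "x < u" by linarith
      then show "f u \<le> max c (f x + 1)"
      proof cases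
        case 1
        then have "f u < c" using u that by (intro a(2)) auto
        then show ?thesis by simp
      next
        case 3
        then have "f u < f x + 1" using u that by (intro b(2)) auto
        then show ?thesis by simp
      qed simp
    qed
    then show ?case using a(1) b(1) by (intro exI[of _ "min (b - x) (x - a)"]) auto
  qed
  then show ?thesis unfolding P_def by blast
qed auto

lemma exit_time_ge:
  assumes "\<And>u. 0 \<le> u \<Longrightarrow> u < t \<Longrightarrow> 1 / real (Suc n) \<le> f u \<and> g u \<le> real (Suc n)"
  shows "ennreal t \<le> exit_time f g n"
  unfolding exit_time_def
proof (rule Inf_greatest)
  fix a assume "a \<in> ennreal ` {u. 0 \<le> u \<and> (f u < 1 / real (Suc n) \<or> real (Suc n) < g u)}"
  then obtain u where u: "a = ennreal u" "0 \<le> u" "f u < 1 / real (Suc n) \<or> real (Suc n) < g u" by auto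
  then have "t \<le> u" using assms[of u] by (meson not_less)
  then show "ennreal t \<le> a" using u by (simp add: ennreal_leI)
qed

text \<open>Positivity of \<open>f\<close> would not be enough, as left limits could vanish: on each
  \<open>[0, t]\<close> some level \<open>1 / (n + 1)\<close> has to lie below the whole
  path.\<close>

lemma exit_time_tendsto:
  assumes f: "\<And>t. \<exists>a>0. \<forall>u. 0 \<le> u \<and> u \<le> t \<longrightarrow> a \<le> f u"
    and g: "cadlag g"
  shows "(\<lambda>n. exit_time f g n) \<longlonglongrightarrow> \<infinity>"
proof -
  have inc: "incseq (exit_time f g)" by (simp add: incseq_def exit_time_mono)
  have ex: "\<exists>n. ennreal t \<le> exit_time f g n" for t
  proof -
    obtain a where a: "0 < a" "\<And>u. 0 \<le> u \<Longrightarrow> u \<le> t \<Longrightarrow> a \<le> f u" using f by blast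
    obtain c where c: "\<And>u. 0 \<le> u \<Longrightarrow> u \<le> t \<Longrightarrow> g u \<le> c" using cadlag_bounded_above[OF g] by blast
    obtain n where n: "max c (1 / a) < real n" using reals_Archimedean2 by blast
    have na: "1 / real (Suc n) \<le> a" using n a(1) by (simp add: field_simps)
    have "ennreal t \<le> exit_time f g n"
    proof (intro exit_time_ge conjI)
      fix u assume u: "0 \<le> u" "u < t"
      show "1 / real (Suc n) \<le> f u" using na a(2)[of u] u by linarith
      show "g u \<le> real (Suc n)" using c[of u] u n by simp
    qed
    then show ?thesis by blast
  qed
  have "(SUP n. exit_time f g n) = \<infinity>"
  proof (rule ccontr)
    assume "(SUP n. exit_time f g n) \<noteq> \<infinity>"
    then obtain r where r: "0 \<le> r" "(SUP n. exit_time f g n) = ennreal r"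
      by (cases "SUP n. exit_time f g n") auto
    obtain n where "ennreal (r + 1) \<le> exit_time f g n" using ex by blast
    also have "\<dots> \<le> ennreal r" unfolding r(2)[symmetric] by (rule SUP_upper) simp
    finally show False using r(1) by simp
  qed
  then show ?thesis using LIMSEQ_SUP[OF inc] by (simp only:)
qed

lemma left_limit_tendsto:
  assumes "cadlag f" "0 < t"
  shows "(f \<longlongrightarrow> left_limit f t) (at_left t)"
proof -
  obtain l where l: "(f \<longlongrightarrow> l) (at_left t)" using assms by (auto simp: cadlag_def)
  then have "Lim (at_left t) f = l" by (intro tendsto_Lim) auto
  then show ?thesis using l assms by (simp add: left_limit_def)
qed

text \<open>A zero at the capped exit time \<open>r\<close> would make \<open>r\<close> both the
  exit time and the zero time of \<open>f\<close>. Before \<open>r\<close> the path is at least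
  \<open>1 / (n + 1)\<close>, so its left limit is positive and \<open>f\<close> would jump to zero.
  Positivity of the exit time gives \<open>r > 0\<close>, so that this is a genuine left
  limit.\<close>

lemma pos_at_exit_time:
  assumes f: "cadlag f" and nonneg: "\<And>u. 0 \<le> u \<Longrightarrow> 0 \<le> f u"
    and nojump: "\<not> jump_to_zero_time f < \<infinity>" and pos: "0 < exit_time f g n" and t: "0 \<le> t"
  shows "0 < f (cap t (exit_time f g n))"
proof (rule ccontr)
  define r where "r = cap t (exit_time f g n)"
  assume "\<not> 0 < f (cap t (exit_time f g n))"
  then have "\<not> 0 < f r" unfolding r_def .
  moreover have r0: "0 \<le> r" unfolding r_def by (rule cap_nonneg)
  ultimately have fr: "f r = 0" using nonneg[OF r0] by linarith
  have zeros: "exit_time f g n \<le> ennreal u" if "0 \<le> u" "f u = 0" for u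
    using exit_time_below(1)[OF that(1), of f g n] that(2) by (force simp: not_less[symmetric])
  have "ennreal r \<le> exit_time f g n" by (simp only: r_def ennreal_cap min.cobounded2)
  then have er: "exit_time f g n = ennreal r" using zeros[OF r0 fr] by simp
  then have r_pos: "0 < r" using pos by simp
  have "zero_time f = ennreal r"
  proof (rule antisym)
    show "zero_time f \<le> ennreal r" unfolding zero_time_def using r0 fr by (intro Inf_lower) blast
    show "ennreal r \<le> zero_time f" unfolding zero_time_def
      by (rule Inf_greatest) (use zeros er in auto)
  qed
  moreover have "1 / real (Suc n) \<le> left_limit f r"
  proof (rule tendsto_lowerbound[OF left_limit_tendsto[OF f r_pos]])
    show "\<forall>\<^sub>F u in at_left r. 1 / real (Suc n) \<le> f u"
    proof (rule eventually_at_leftI[OF _ r_pos])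
      fix u assume "u \<in> {0<..<r}"
      then show "1 / real (Suc n) \<le> f u"
        using exit_time_below(1)[of u f g n] er ennreal_lessI[OF r_pos, of u] by auto
    qed
  qed simp
  then have "0 < left_limit f r" by (rule less_le_trans[rotated]) simp
  ultimately have "jump_to_zero_time f = ennreal r"
    using r0 by (simp add: jump_to_zero_time_def)
  then show False using nojump by simp
qed

text \<open>If the value at the infimum were positive, right continuity would keep the path positive
  on a right neighbourhood and push the infimum up.\<close>

lemma zero_time_attained:
  assumes f: "\<And>u. 0 \<le> u \<Longrightarrow> (f \<longlongrightarrow> f u) (at_right u)" and nonneg: "\<And>u. 0 \<le> u \<Longrightarrow> 0 \<le> f u"
    and z: "0 \<le> z" "zero_time f = ennreal z"
  shows "f z = 0"
proof (rule ccontr)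
  assume "f z \<noteq> 0"
  then have fz: "0 < f z" using nonneg[OF z(1)] by simp
  have "\<forall>\<^sub>F y in at_right z. 0 < f y" by (rule order_tendstoD(1)[OF f[OF z(1)] fz])
  then obtain b where b: "z < b" "\<And>y. z < y \<Longrightarrow> y < b \<Longrightarrow> 0 < f y"
    unfolding eventually_at_right_field by blast
  have "ennreal b \<le> zero_time f"
    unfolding zero_time_def
  proof (rule Inf_greatest)
    fix a assume "a \<in> {ennreal t |t. 0 \<le> t \<and> f t = 0}"
    then obtain u where u: "a = ennreal u" "0 \<le> u" "f u = 0" by auto
    then have "zero_time f \<le> ennreal u" unfolding zero_time_def by (intro Inf_lower) auto
    then have "z \<le> u" using z u by (simp add: ennreal_le_iff)
    moreover have "u \<noteq> z" using u(3) fz by auto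
    ultimately have "b \<le> u" using b(2)[of u] u(3) by linarith
    then show "ennreal b \<le> a" using u by (simp add: ennreal_leI)
  qed
  then show False using z b by (simp add: ennreal_le_iff2)
qed

text \<open>The positive left limit bounds \<open>f\<close> below just before the zero time
  \<open>z\<close>. Farther back the bound comes from absorption: a path that had come below every
  level before \<open>q\<close> would vanish at \<open>q\<close>, although \<open>q < z\<close>.
  Together they give one level that is not undercut before \<open>z\<close>, so that some exit time
  equals \<open>z\<close>.\<close>

lemma jump_to_zero_exit_time:
  assumes f: "cadlag f" and nonneg: "\<And>u. 0 \<le> u \<Longrightarrow> 0 \<le> f u"
    and absorbed: "\<And>q. q \<in> \<rat> \<Longrightarrow> 0 \<le> q \<Longrightarrow> (\<And>n. exit_time f (\<lambda>_. 0) n < ennreal q) \<Longrightarrow> f q = 0"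
    and jump: "jump_to_zero_time f < \<infinity>"
  shows "\<exists>n N::nat. 0 < exit_time f (\<lambda>_. 1) n \<and> f (cap (real N) (exit_time f (\<lambda>_. 1) n)) = 0"
proof -
  have fin: "zero_time f < \<infinity>" and ll: "0 < left_limit f (enn2real (zero_time f))"
    using jump by (auto simp: jump_to_zero_time_def split: if_splits)
  define z where "z = enn2real (zero_time f)"
  have z: "zero_time f = ennreal z" "0 \<le> z" using fin by (auto simp: z_def)
  have fz: "f z = 0" by (rule zero_time_attained[OF cadlag_right[OF f] nonneg z(2,1)])
  \<comment> \<open>At time 0 the left limit is by convention the value itself, which is zero at
    \<open>z\<close>; a jump at time 0 is thereby excluded.\<close>
  have z_pos: "0 < z"
  proof (rule ccontr)
    assume "\<not> 0 < z"
    then have "z = 0" using z(2) by simp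
    then show False using ll fz by (simp add: left_limit_def flip: z_def)
  qed
  define l where "l = left_limit f z"
  have l: "0 < l" using ll by (simp add: l_def z_def)
  have "\<forall>\<^sub>F y in at_left z. l / 2 < f y"
    using left_limit_tendsto[OF f z_pos] l unfolding l_def by (intro order_tendstoD(1)) auto
  then obtain b where b: "b < z" "\<And>y. b < y \<Longrightarrow> y < z \<Longrightarrow> l / 2 < f y"
    unfolding eventually_at_left_field by blast
  obtain q where q: "q \<in> \<rat>" "max 0 b < q" "q < z"
    using Rats_dense_in_real[of "max 0 b" z] b(1) z_pos by auto
  have "f q \<noteq> 0" using b(2)[of q] q l by auto
  then obtain n where n: "\<not> exit_time f (\<lambda>_. 0) n < ennreal q"
    using absorbed[of q] q by auto
  obtain k where k: "2 / l < real k" using reals_Archimedean2 by blast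
  \<comment> \<open>\<open>n\<close> serves before \<open>q\<close>, and \<open>k\<close> puts the
    level below half the left limit, which serves between \<open>q\<close> and \<open>z\<close>; the
    larger index serves both.\<close>
  define m where "m = max n k"
  have m: "1 / real (Suc m) \<le> 1 / real (Suc n)" "1 / real (Suc m) \<le> l / 2"
  proof -
    show "1 / real (Suc m) \<le> 1 / real (Suc n)" by (intro divide_left_mono) (auto simp: m_def)
    have "2 / l \<le> real (Suc m)" using k by (simp add: m_def)
    then show "1 / real (Suc m) \<le> l / 2" using l by (simp add: field_simps)
  qed
  have "1 / real (Suc m) \<le> f u" if u: "0 \<le> u" "u < z" for u
  proof (cases "u < q")
    case True
    then have "ennreal u < exit_time f (\<lambda>_. 0) n"
      using n u by (meson ennreal_lessI le_less_trans less_le_trans not_less)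
    from exit_time_below(1)[OF u(1) this] show ?thesis using m(1) by linarith
  next
    case False
    then have "l / 2 < f u" using q u by (intro b(2)) auto
    then show ?thesis using m(2) by linarith
  qed
  then have "ennreal z \<le> exit_time f (\<lambda>_. 1) m" by (intro exit_time_ge) auto
  moreover have "exit_time f (\<lambda>_. 1) m \<le> ennreal z"
    unfolding exit_time_def using fz z(2) by (intro Inf_lower) auto
  ultimately have ez: "exit_time f (\<lambda>_. 1) m = ennreal z" by simp
  obtain N where N: "z < real N" using reals_Archimedean2 by blast
  have "cap (real N) (ennreal z) = z" using N z(2) by (simp add: min_absorb2 ennreal_leI)
  then show ?thesis using ez fz z_pos by (intro exI[of _ m] exI[of _ N]) simp
qed

section \<open>The enlarged filtration\<close>

context jacod_setup
begin

abbreviation "G0 \<equiv> initial_enlargement0 M F E J"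
abbreviation "G \<equiv> initial_enlargement M F E J"

lemma G0_generator:
  assumes "0 \<le> t"
  shows "sets (F t) \<union> sets (vimage_algebra (space M) J (borel_of E)) \<subseteq> Pow (space M)"
  using assms sets.space_closed[of "F t"] sets.space_closed[of "vimage_algebra (space M) J (borel_of E)"]
  by simp

lemma space_G0 [simp]: "0 \<le> t \<Longrightarrow> space (G0 t) = space M"
  unfolding initial_enlargement0_def using G0_generator by (rule space_measure_of)

lemma sets_G0:
  "0 \<le> t \<Longrightarrow> sets (G0 t) = sigma_sets (space M) (sets (F t) \<union> sets (vimage_algebra (space M) J (borel_of E)))"
  unfolding initial_enlargement0_def using G0_generator by (rule sets_measure_of)

lemma sets_J: "sets (vimage_algebra (space M) J (borel_of E)) = {J -` A \<inter> space M |A. A \<in> sets (borel_of E)}"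
  using J_in by (intro sets_vimage_algebra2) auto

lemma measurable_J_pair_G0:
  assumes t: "0 \<le> t"
  shows "(\<lambda>\<omega>. (J \<omega>, \<omega>)) \<in> G0 t \<rightarrow>\<^sub>M joint t"
proof (rule measurable_Pair)
  show "J \<in> G0 t \<rightarrow>\<^sub>M borel_of E"
    using J_in t sets_J by (intro measurableI) (auto simp: sets_G0 intro!: sigma_sets.Basic)
  show "(\<lambda>\<omega>. \<omega>) \<in> G0 t \<rightarrow>\<^sub>M F t"
    using t sets.sets_into_space[of _ "F t"]
    by (intro measurableI) (auto simp: sets_G0 Int_absorb2 intro!: sigma_sets.Basic)
qed

text \<open>The preimages of joint events under
  \<open>\<omega> \<mapsto> (J \<omega>, \<omega>)\<close> form a \<open>\<sigma>\<close>-field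
  containing both generating fields. Events of \<open>G0 t\<close> thereby become sets of pairs, to
  which disintegration applies.\<close>

lemma G0_setE:
  assumes t: "0 \<le> t" and A: "A \<in> sets (G0 t)"
  obtains D where "D \<in> sets (joint t)" "A = {\<omega>\<in>space M. (J \<omega>, \<omega>) \<in> D}"
proof -
  let ?V = "vimage_algebra (space M) (\<lambda>\<omega>. (J \<omega>, \<omega>)) (joint t)"
  have V: "sets ?V = {(\<lambda>\<omega>. (J \<omega>, \<omega>)) -` D \<inter> space M |D. D \<in> sets (joint t)}"
    using J_in t by (intro sets_vimage_algebra2) (auto simp: space_pair_measure)
  have "sets (F t) \<union> sets (vimage_algebra (space M) J (borel_of E)) \<subseteq> sets ?V"
  proof safe
    fix C assume C: "C \<in> sets (F t)"
    then have "C = (\<lambda>\<omega>. (J \<omega>, \<omega>)) -` (topspace E \<times> C) \<inter> space M"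
      using sets.sets_into_space[OF C] J_in t by auto
    moreover have "topspace E \<times> C \<in> sets (joint t)"
      using C sets.top[of "borel_of E"] by simp
    ultimately show "C \<in> sets ?V" unfolding V by blast
  next
    fix C assume "C \<in> sets (vimage_algebra (space M) J (borel_of E))"
    then obtain A where A: "A \<in> sets (borel_of E)" "C = J -` A \<inter> space M" unfolding sets_J by blast
    then have "C = (\<lambda>\<omega>. (J \<omega>, \<omega>)) -` (A \<times> space M) \<inter> space M" by auto
    moreover have "A \<times> space M \<in> sets (joint t)"
      using A sets.top[of "F t"] t by simp
    ultimately show "C \<in> sets ?V" unfolding V by blast
  qed
  then have "sigma_sets (space M) (sets (F t) \<union> sets (vimage_algebra (space M) J (borel_of E))) \<subseteq> sets ?V"
    using sets.sigma_sets_subset[of _ ?V] by simp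
  then have "A \<in> sets ?V" using A t by (auto simp: sets_G0)
  then obtain D where "D \<in> sets (joint t)" "A = (\<lambda>\<omega>. (J \<omega>, \<omega>)) -` D \<inter> space M"
    unfolding V by blast
  then show ?thesis by (intro that[of D]) auto
qed

lemma sets_G0_mono:
  assumes "0 \<le> s" "s \<le> t"
  shows "sets (G0 s) \<subseteq> sets (G0 t)"
  using assms sets_F_mono[OF assms] by (auto simp: sets_G0 intro!: sigma_sets_mono')

lemma sets_G0_M:
  assumes t: "0 \<le> t"
  shows "sets (G0 t) \<subseteq> sets M"
proof
  fix A assume "A \<in> sets (G0 t)"
  then obtain D where D: "D \<in> sets (joint t)" "A = {\<omega>\<in>space M. (J \<omega>, \<omega>) \<in> D}"
    by (rule G0_setE[OF t])
  then have "A = (\<lambda>\<omega>. (J \<omega>, \<omega>)) -` D \<inter> space M" by auto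
  then show "A \<in> sets M" using measurable_sets[OF measurable_J_pair[OF t] D(1)] by simp
qed

text \<open>An intersection of \<open>\<sigma>\<close>-fields on one space is already a
  \<open>\<sigma>\<close>-field, so the closure taken in the definition adds no sets.\<close>

lemma sets_G:
  assumes t: "0 \<le> t"
  shows "sets (G t) = (\<Inter>s\<in>{t<..}. sets (G0 s))"
proof -
  have sub: "(\<Inter>s\<in>{t<..}. sets (G0 s)) \<subseteq> Pow (space M)"
  proof
    fix A assume "A \<in> (\<Inter>s\<in>{t<..}. sets (G0 s))"
    then have "A \<in> sets (G0 (t + 1))" by simp
    then show "A \<in> Pow (space M)" using sets.sets_into_space t by fastforce
  qed
  have "sigma_sets (space M) (\<Inter>s\<in>{t<..}. sets (G0 s)) \<subseteq> sets (G0 s)" if "t < s" for s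
    using sets.sigma_sets_subset[of "\<Inter>s\<in>{t<..}. sets (G0 s)" "G0 s"] that t by auto
  then have "sigma_sets (space M) (\<Inter>s\<in>{t<..}. sets (G0 s)) = (\<Inter>s\<in>{t<..}. sets (G0 s))"
    by (auto intro: sigma_sets.Basic)
  then show ?thesis unfolding initial_enlargement_def using sub by (simp add: sets_measure_of)
qed

lemma space_G: "0 \<le> t \<Longrightarrow> space (G t) = space M"
  unfolding initial_enlargement_def
proof (rule space_measure_of)
  assume t: "0 \<le> t"
  have "(\<Inter>s\<in>{t<..}. sets (G0 s)) \<subseteq> sets (G0 (t + 1))" by (rule INT_lower) simp
  then show "(\<Inter>s\<in>{t<..}. sets (G0 s)) \<subseteq> Pow (space M)" using sets.space_closed[of "G0 (t + 1)"] t by auto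
qed

lemma sets_G0_G: "0 \<le> t \<Longrightarrow> sets (G0 t) \<subseteq> sets (G t)"
  unfolding sets_G by (intro INT_greatest sets_G0_mono) auto

lemma G_right_continuous:
  assumes t: "0 \<le> t"
  shows "sets (G t) = (\<Inter>s\<in>{t<..}. sets (G s))"
proof
  show "sets (G t) \<subseteq> (\<Inter>s\<in>{t<..}. sets (G s))"
  proof (rule INT_greatest)
    fix s assume "s \<in> {t<..}"
    then show "sets (G t) \<subseteq> sets (G s)" using t by (auto simp: sets_G)
  qed
  show "(\<Inter>s\<in>{t<..}. sets (G s)) \<subseteq> sets (G t)"
  proof
    fix A assume A: "A \<in> (\<Inter>s\<in>{t<..}. sets (G s))"
    have "A \<in> sets (G0 s)" if "t < s" for s
    proof -
      obtain r where r: "t < r" "r < s" using dense[OF \<open>t < s\<close>] by auto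
      then have "A \<in> sets (G r)" using A by simp
      then show ?thesis using r t by (simp add: sets_G)
    qed
    then show "A \<in> sets (G t)" using t by (simp add: sets_G)
  qed
qed

lemma filtered_G: "filtered_space M G"
  unfolding filtered_space_def subalgebra_def
proof (intro conjI allI impI)
  fix t :: real assume t: "0 \<le> t"
  show "space (G t) = space M" by (rule space_G[OF t])
  have "sets (G t) \<subseteq> sets (G0 (t + 1))" unfolding sets_G[OF t] by (rule INT_lower) simp
  then show "sets (G t) \<subseteq> sets M" using sets_G0_M[of "t + 1"] t by auto
next
  fix s t :: real assume "0 \<le> s" "s \<le> t"
  then show "sets (G s) \<subseteq> sets (G t)" by (auto simp: sets_G)
qed

sublocale G: filtered_prob_space M G
  by unfold_locales (rule filtered_G)

lemma measurable_G0_G: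
  assumes t: "0 \<le> t" and f: "f \<in> G0 t \<rightarrow>\<^sub>M N"
  shows "f \<in> G t \<rightarrow>\<^sub>M N"
proof -
  have "subalgebra (G t) (G0 t)" using t sets_G0_G space_G by (simp add: subalgebra_def)
  then show ?thesis using f by (rule measurable_from_subalg)
qed

lemma measurable_J_compose_G:
  assumes t: "0 \<le> t" and g: "g \<in> joint t \<rightarrow>\<^sub>M N"
  shows "(\<lambda>\<omega>. g (J \<omega>, \<omega>)) \<in> G t \<rightarrow>\<^sub>M N"
  by (rule measurable_G0_G[OF t measurable_compose[OF measurable_J_pair_G0[OF t] g]])

end

section \<open>From no jumps to local martingales\<close>

lemma cap_pos_iff: "0 < v \<Longrightarrow> 0 < cap v a \<longleftrightarrow> 0 < a"
  by (simp add: enn2real_positive_iff min_less_iff_disj)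

lemma le_cap_iff: "0 \<le> s \<Longrightarrow> s \<le> v \<Longrightarrow> s \<le> cap v a \<longleftrightarrow> ennreal s \<le> a"
  using cap_less_iff[of s v a] by (metis not_le)

text \<open>The lower bound passes to the left limits of \<open>g\<close>; mere positivity would
  allow a zero left limit, at which the quotient may diverge.\<close>

lemma cadlag_divide:
  assumes f: "cadlag f" and g: "cadlag g"
    and below: "\<And>t. \<exists>a>0. \<forall>u. 0 \<le> u \<and> u \<le> t \<longrightarrow> a \<le> g u"
  shows "cadlag (\<lambda>u. f u / g u)"
  unfolding cadlag_def
proof (intro conjI allI impI)
  fix t :: real assume t: "0 \<le> t"
  have "0 < g t" using below[of t] t by force
  then show "((\<lambda>u. f u / g u) \<longlongrightarrow> f t / g t) (at_right t)"
    using cadlag_right[OF f t] cadlag_right[OF g t] by (intro tendsto_divide) auto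
next
  fix t :: real assume t: "0 < t"
  obtain a where a: "0 < a" "\<And>u. 0 \<le> u \<Longrightarrow> u \<le> t \<Longrightarrow> a \<le> g u" using below by blast
  have "\<forall>\<^sub>F u in at_left t. a \<le> g u"
    by (rule eventually_at_leftI[OF _ t]) (use a(2) in auto)
  then have "a \<le> left_limit g t" by (intro tendsto_lowerbound[OF left_limit_tendsto[OF g t]]) auto
  then have "((\<lambda>u. f u / g u) \<longlongrightarrow> left_limit f t / left_limit g t) (at_left t)"
    using a(1) by (intro tendsto_divide left_limit_tendsto f g t) auto
  then show "\<exists>l. ((\<lambda>u. f u / g u) \<longlongrightarrow> l) (at_left t)" by blast
qed

context jacod_family
begin

abbreviation "exitJ n \<omega> \<equiv> exit n (J \<omega>) \<omega>"
abbreviation "quotJ \<omega> u \<equiv> X (J \<omega>) \<omega> u / p (J \<omega>) \<omega> u"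

lemma quotJ_nonneg: "\<omega> \<in> space M \<Longrightarrow> 0 \<le> u \<Longrightarrow> 0 \<le> quotJ \<omega> u"
  by (intro divide_nonneg_nonneg X_nonneg p_nonneg J_in)

text \<open>Joint measurability provides only the events with strict inequality; the passage to
  \<open>\<le>\<close> rests on \<open>G\<close> being right continuous by construction.\<close>

lemma exitJ_stopping_time: "ext_stopping_time G (exitJ n)"
proof (rule G.ext_stopping_timeI[OF _ G_right_continuous])
  fix u :: real assume u: "0 \<le> u"
  have "{\<omega>\<in>space M. exitJ n \<omega> < ennreal u} =
      (\<lambda>\<omega>. (J \<omega>, \<omega>)) -` {z\<in>space (joint u). exit n (fst z) (snd z) < ennreal u} \<inter> space (G0 u)"
    using u J_in by (auto simp: space_pair_measure)
  also have "\<dots> \<in> sets (G0 u)" by (rule measurable_sets[OF measurable_J_pair_G0[OF u] exit_joint[OF u]])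
  finally show "{\<omega>\<in>space M. exitJ n \<omega> < ennreal u} \<in> sets (G u)" using sets_G0_G[OF u] by blast
qed

lemma quotJ_adapted: "adapted G quotJ"
  unfolding adapted_def
proof (intro allI impI)
  fix t :: real assume t: "0 \<le> t"
  show "(\<lambda>\<omega>. quotJ \<omega> t) \<in> borel_measurable (G t)"
    using measurable_J_compose_G[OF t optional_section[OF X_meas t]]
      measurable_J_compose_G[OF t p_section[OF t]] by (simp add: borel_measurable_divide)
qed

lemma quotJ_cadlag: "AE \<omega> in M. cadlag (quotJ \<omega>)"
  using p_J_bounded_below AE_space
proof eventually_elim
  case (elim \<omega>)
  then show ?case by (intro cadlag_divide X_cadlag p_cadlag J_in) auto
qed

lemma quotJ_sampled:
  assumes t: "0 \<le> t"
  shows "(\<lambda>\<omega>. quotJ \<omega> (cap t (exitJ n \<omega>))) \<in> borel_measurable (G t)"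
  using measurable_J_compose_G[OF t sample_joint[OF t X_meas X_cadlag], of n]
    measurable_J_compose_G[OF t sample_joint[OF t p_meas p_cadlag], of n]
  by (intro borel_measurable_divide) simp_all

lemma exitJ_tendsto: "AE \<omega> in M. incseq (\<lambda>n. exitJ n \<omega>) \<and> (\<lambda>n. exitJ n \<omega>) \<longlonglongrightarrow> \<infinity>"
  using p_J_bounded_below AE_space
proof eventually_elim
  case (elim \<omega>)
  have "(\<lambda>n. exitJ n \<omega>) \<longlonglongrightarrow> \<infinity>"
    unfolding exit_def using elim by (intro exit_time_tendsto X_cadlag J_in) auto
  then show ?case by (simp add: exit_def incseq_def exit_time_mono)
qed

text \<open>For \<open>s > 0\<close> the second condition follows from the first. At
  \<open>s = 0\<close> it excludes an immediate exit, matching the indicator in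
  \<open>local_martingale\<close>.\<close>

definition exit_after :: "real \<Rightarrow> nat \<Rightarrow> ('e \<times> 'a) set" where
  "exit_after s n = {z\<in>topspace E \<times> space M. ennreal s \<le> exit n (fst z) (snd z) \<and> 0 < exit n (fst z) (snd z)}"

lemma exit_after_joint:
  assumes s: "0 \<le> s" "s < v" and D: "D \<in> sets (joint s)"
  shows "D \<inter> exit_after s n \<in> sets (joint v)"
proof -
  let ?N = "joint v"
  have v: "0 \<le> v" "0 < v" using s by auto
  have [measurable]: "(\<lambda>z. cap v (exit n (fst z) (snd z))) \<in> borel_measurable ?N"
    by (rule cap_exit_joint[OF v(1)])
  have "exit_after s n = {z\<in>space ?N. s \<le> cap v (exit n (fst z) (snd z)) \<and> 0 < cap v (exit n (fst z) (snd z))}"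
    unfolding exit_after_def cap_pos_iff[OF v(2)] le_cap_iff[OF s(1) less_imp_le[OF s(2)]]
    using v by (simp add: space_pair_measure)
  also have "\<dots> \<in> sets ?N" by measurable
  finally show ?thesis using sets_pair_mono[OF s(1) less_imp_le[OF s(2)] D] by blast
qed

lemma exit_after_section:
  assumes s: "0 \<le> s" and D: "D \<in> sets (joint s)" and x: "x \<in> topspace E"
  shows "{\<omega>\<in>space M. (x, \<omega>) \<in> D \<inter> exit_after s n} \<in> sets (F s)"
proof -
  have "Pair x -` D \<in> sets (F s)" by (rule sets_Pair1[OF D])
  moreover have "space M - {\<omega>\<in>space M. exit n x \<omega> < ennreal s} \<in> sets (F s)"
    using sets.compl_sets[OF exit_section_less[OF x s]] s by simp
  moreover have "{\<omega>\<in>space M. 0 < exit n x \<omega>} \<in> sets (F s)"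
    by (rule sets_F_mono[OF order_refl s ext_stopping_time_pos[OF exit_stopping_time[OF x]]])
  ultimately have "Pair x -` D \<inter> (space M - {\<omega>\<in>space M. exit n x \<omega> < ennreal s}) \<inter> {\<omega>\<in>space M. 0 < exit n x \<omega>} \<in> sets (F s)"
    by blast
  also have "Pair x -` D \<inter> (space M - {\<omega>\<in>space M. exit n x \<omega> < ennreal s}) \<inter> {\<omega>\<in>space M. 0 < exit n x \<omega>} =
      {\<omega>\<in>space M. (x, \<omega>) \<in> D \<inter> exit_after s n}"
    using x by (auto simp: exit_after_def not_less)
  finally show ?thesis .
qed

text \<open>On \<open>exit_after s n\<close> the exit time is positive, so without jumps to zero the
  density is positive at the capped exit time. The case distinction left by
  \<open>conditioning_at_exit\<close> disappears.\<close>

lemma quotJ_conditioning: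
  assumes nojump: "AE x in law. AE \<omega> in M. \<not> jump_to_zero_time (p x \<omega>) < \<infinity>"
    and s: "0 \<le> s" "s \<le> t" and D: "D \<in> sets (joint s)"
  shows "(\<integral>\<^sup>+\<omega>. indicator (D \<inter> exit_after s n) (J \<omega>, \<omega>) * ennreal (quotJ \<omega> (cap t (exitJ n \<omega>))) \<partial>M) =
    (\<integral>\<^sup>+x. \<integral>\<^sup>+\<omega>. indicator {\<omega>\<in>space M. (x, \<omega>) \<in> D \<inter> exit_after s n} \<omega> *
      ennreal (X x \<omega> (cap t (exit n x \<omega>))) \<partial>M \<partial>law)"
proof -
  have t: "0 \<le> t" using s by simp
  have "(\<integral>\<^sup>+\<omega>. indicator (D \<inter> exit_after s n) (J \<omega>, \<omega>) * ennreal (quotJ \<omega> (cap t (exitJ n \<omega>))) \<partial>M) =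
      (\<integral>\<^sup>+x. \<integral>\<^sup>+\<omega>. indicator (D \<inter> exit_after s n) (x, \<omega>) *
        ennreal (if 0 < p x \<omega> (cap t (exit n x \<omega>)) then X x \<omega> (cap t (exit n x \<omega>)) else 0) \<partial>M \<partial>law)"
  \<comment> \<open>Any time strictly after \<open>t\<close> would serve as \<open>v\<close>; being
    strictly later than \<open>s\<close> is what makes the set of pairs jointly measurable.\<close>
  proof (rule conditioning_at_exit[OF s, where v = "t + 1"])
    show "D \<inter> exit_after s n \<in> sets (joint (t + 1))"
      using s by (intro exit_after_joint D) auto
    show "{\<omega>\<in>space M. (x, \<omega>) \<in> D \<inter> exit_after s n} \<in> sets (F s)" if "x \<in> topspace E" for x
      by (rule exit_after_section[OF s(1) D that])
    show "ennreal s \<le> exit n x \<omega>" if "(x, \<omega>) \<in> D \<inter> exit_after s n" for x \<omega>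
      using that by (simp add: exit_after_def)
  qed simp
  also have "\<dots> = (\<integral>\<^sup>+x. \<integral>\<^sup>+\<omega>. indicator {\<omega>\<in>space M. (x, \<omega>) \<in> D \<inter> exit_after s n} \<omega> *
      ennreal (X x \<omega> (cap t (exit n x \<omega>))) \<partial>M \<partial>law)"
  proof (rule nn_integral_cong_AE, use nojump AE_space in eventually_elim)
    case (elim x)
    then have x: "x \<in> topspace E" by simp
    show ?case
    proof (rule nn_integral_cong_AE, use elim(1) AE_space in eventually_elim)
      case (elim \<omega>)
      show ?case
      proof (cases "0 < exit n x \<omega>")
        case True
        then have "0 < p x \<omega> (cap t (exit n x \<omega>))"
          using elim t unfolding exit_def by (intro pos_at_exit_time p_cadlag p_nonneg x)
        then show ?thesis using elim(2) by (simp only: if_True) (simp add: indicator_def)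
      next
        case False
        then show ?thesis by (simp add: exit_after_def)
      qed
    qed
  qed
  finally show ?thesis .
qed

lemma X_sample_M:
  assumes x: "x \<in> topspace E" and R: "R \<in> borel_measurable M" "\<And>\<omega>. \<omega> \<in> space M \<Longrightarrow> 0 \<le> R \<omega> \<and> R \<omega> \<le> t"
  shows "(\<lambda>\<omega>. X x \<omega> (R \<omega>)) \<in> borel_measurable M"
proof (rule measurable_sample_right_continuous[OF R])
  show "(\<lambda>\<omega>. X x \<omega> u) \<in> borel_measurable M" if "0 \<le> u" for u
    using X_adapted[OF x] that measurable_F_M[OF that] unfolding adapted_def by blast
  show "(X x \<omega> \<longlongrightarrow> X x \<omega> u) (at_right u)" if "\<omega> \<in> space M" "0 \<le> u" for \<omega> u
    by (rule cadlag_right[OF X_cadlag[OF x that(1)] that(2)])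
qed

text \<open>The threshold of the exit time plays the role of the constant \<open>c\<close> in the
  general statement: \<open>X x\<close> is at most \<open>n + 1\<close> strictly before the
  exit.\<close>

lemma X_optional_stopping:
  assumes lm: "local_martingale M F (X x)" and x: "x \<in> topspace E"
  shows "0 \<le> t \<Longrightarrow> (\<integral>\<^sup>+\<omega>. indicator {\<omega>\<in>space M. 0 < exit n x \<omega>} \<omega> *
      ennreal (X x \<omega> (cap t (exit n x \<omega>))) \<partial>M) \<le> ennreal (real (Suc n))"
    and "0 \<le> s \<Longrightarrow> s \<le> t \<Longrightarrow> C \<in> sets (F s) \<Longrightarrow>
      (\<And>\<omega>. \<omega> \<in> C \<Longrightarrow> ennreal s \<le> exit n x \<omega> \<and> 0 < exit n x \<omega>) \<Longrightarrow>
      (\<integral>\<^sup>+\<omega>. indicator C \<omega> * ennreal (X x \<omega> (cap t (exit n x \<omega>))) \<partial>M) =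
      (\<integral>\<^sup>+\<omega>. indicator C \<omega> * ennreal (X x \<omega> s) \<partial>M)"
proof -
  have bnd: "X x \<omega> u \<le> real (Suc n)" if "\<omega> \<in> space M" "0 \<le> u" "ennreal u < exit n x \<omega>" for \<omega> u
    using exit_time_below(2)[OF that(2)] that(3) unfolding exit_def by blast
  note L = nonneg_local_martingale_optional_stopping[OF lm X_nonneg[OF x] X_sample_M[OF x]
      exit_stopping_time[OF x, of n] bnd]
  show "0 \<le> t \<Longrightarrow> (\<integral>\<^sup>+\<omega>. indicator {\<omega>\<in>space M. 0 < exit n x \<omega>} \<omega> *
      ennreal (X x \<omega> (cap t (exit n x \<omega>))) \<partial>M) \<le> ennreal (real (Suc n))"
    using bnd by (intro L(1))
  show "0 \<le> s \<Longrightarrow> s \<le> t \<Longrightarrow> C \<in> sets (F s) \<Longrightarrow>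
      (\<And>\<omega>. \<omega> \<in> C \<Longrightarrow> ennreal s \<le> exit n x \<omega> \<and> 0 < exit n x \<omega>) \<Longrightarrow>
      (\<integral>\<^sup>+\<omega>. indicator C \<omega> * ennreal (X x \<omega> (cap t (exit n x \<omega>))) \<partial>M) =
      (\<integral>\<^sup>+\<omega>. indicator C \<omega> * ennreal (X x \<omega> s) \<partial>M)"
    using bnd by (intro L(2))
qed

text \<open>Disintegration cancels the division by the density. What remains is the bound
  \<open>n + 1\<close> for the expectation of \<open>X x\<close> at its capped exit time, including
  a possible overshoot; it supplies integrability and domination below.\<close>

lemma quotJ_exit_bound:
  assumes nojump: "AE x in law. AE \<omega> in M. \<not> jump_to_zero_time (p x \<omega>) < \<infinity>"
    and lm: "AE x in law. local_martingale M F (X x)" and t: "0 \<le> t"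
  shows "(\<integral>\<^sup>+\<omega>. indicator {\<omega>\<in>space M. 0 < exitJ n \<omega>} \<omega> * ennreal (quotJ \<omega> (cap t (exitJ n \<omega>))) \<partial>M)
    \<le> ennreal (real (Suc n))"
proof -
  let ?D = "space (joint 0)"
  have D: "?D = topspace E \<times> space M" by (simp add: space_pair_measure)
  have "(\<integral>\<^sup>+\<omega>. indicator {\<omega>\<in>space M. 0 < exitJ n \<omega>} \<omega> * ennreal (quotJ \<omega> (cap t (exitJ n \<omega>))) \<partial>M) =
      (\<integral>\<^sup>+\<omega>. indicator (?D \<inter> exit_after 0 n) (J \<omega>, \<omega>) * ennreal (quotJ \<omega> (cap t (exitJ n \<omega>))) \<partial>M)"
    by (intro nn_integral_cong) (use J_in in \<open>auto simp: D exit_after_def indicator_def\<close>)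
  also have "\<dots> = (\<integral>\<^sup>+x. \<integral>\<^sup>+\<omega>. indicator {\<omega>\<in>space M. (x, \<omega>) \<in> ?D \<inter> exit_after 0 n} \<omega> *
      ennreal (X x \<omega> (cap t (exit n x \<omega>))) \<partial>M \<partial>law)"
    by (rule quotJ_conditioning[OF nojump order_refl t sets.top])
  also have "\<dots> \<le> (\<integral>\<^sup>+x. ennreal (real (Suc n)) \<partial>law)"
  proof (rule nn_integral_mono_AE, use lm AE_space in eventually_elim)
    case (elim x)
    then have x: "x \<in> topspace E" by simp
    have "{\<omega>\<in>space M. (x, \<omega>) \<in> ?D \<inter> exit_after 0 n} = {\<omega>\<in>space M. 0 < exit n x \<omega>}"
      using x by (auto simp: D exit_after_def)
    then show ?case using X_optional_stopping(1)[OF elim(1) x t, of n] by (simp only:)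
  qed
  also have "\<dots> = ennreal (real (Suc n))" using law.emeasure_space_1 by simp
  finally show ?thesis .
qed

text \<open>Conditioning turns both sides into integrals over \<open>x\<close> of expectations for
  the original filtration. There optional stopping applies for almost every \<open>x\<close>, once
  with horizon \<open>t\<close> and once with horizon \<open>s\<close>, and both expectations equal
  that of \<open>X x\<close> at time \<open>s\<close>.\<close>

lemma quotJ_exit_eq:
  assumes nojump: "AE x in law. AE \<omega> in M. \<not> jump_to_zero_time (p x \<omega>) < \<infinity>"
    and lm: "AE x in law. local_martingale M F (X x)" and s: "0 \<le> s" "s \<le> t"
    and A: "A \<in> sets (G0 s)"
  shows "(\<integral>\<^sup>+\<omega>. indicator (A \<inter> {\<omega>. ennreal s \<le> exitJ n \<omega> \<and> 0 < exitJ n \<omega>}) \<omega> *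
      ennreal (quotJ \<omega> (cap t (exitJ n \<omega>))) \<partial>M) =
    (\<integral>\<^sup>+\<omega>. indicator (A \<inter> {\<omega>. ennreal s \<le> exitJ n \<omega> \<and> 0 < exitJ n \<omega>}) \<omega> *
      ennreal (quotJ \<omega> (cap s (exitJ n \<omega>))) \<partial>M)"
proof -
  obtain D where D: "D \<in> sets (joint s)" "A = {\<omega>\<in>space M. (J \<omega>, \<omega>) \<in> D}"
    by (rule G0_setE[OF s(1) A])
  have ind: "indicator (A \<inter> {\<omega>. ennreal s \<le> exitJ n \<omega> \<and> 0 < exitJ n \<omega>}) \<omega> =
      (indicator (D \<inter> exit_after s n) (J \<omega>, \<omega>) :: ennreal)" if "\<omega> \<in> space M" for \<omega>
    using that J_in by (auto simp: D(2) exit_after_def indicator_def)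
  let ?C = "\<lambda>x. {\<omega>\<in>space M. (x, \<omega>) \<in> D \<inter> exit_after s n}"
  have "(\<integral>\<^sup>+\<omega>. indicator (A \<inter> {\<omega>. ennreal s \<le> exitJ n \<omega> \<and> 0 < exitJ n \<omega>}) \<omega> *
      ennreal (quotJ \<omega> (cap t (exitJ n \<omega>))) \<partial>M) =
      (\<integral>\<^sup>+\<omega>. indicator (D \<inter> exit_after s n) (J \<omega>, \<omega>) * ennreal (quotJ \<omega> (cap t (exitJ n \<omega>))) \<partial>M)"
    by (intro nn_integral_cong) (simp only: ind)
  also have "\<dots> = (\<integral>\<^sup>+x. \<integral>\<^sup>+\<omega>. indicator (?C x) \<omega> * ennreal (X x \<omega> (cap t (exit n x \<omega>))) \<partial>M \<partial>law)"
    by (rule quotJ_conditioning[OF nojump s D(1)])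
  also have "\<dots> = (\<integral>\<^sup>+x. \<integral>\<^sup>+\<omega>. indicator (?C x) \<omega> * ennreal (X x \<omega> (cap s (exit n x \<omega>))) \<partial>M \<partial>law)"
  proof (rule nn_integral_cong_AE, use lm AE_space in eventually_elim)
    case (elim x)
    then have x: "x \<in> topspace E" by simp
    have C: "?C x \<in> sets (F s)" by (rule exit_after_section[OF s(1) D(1) x])
    have Ce: "ennreal s \<le> exit n x \<omega> \<and> 0 < exit n x \<omega>" if "\<omega> \<in> ?C x" for \<omega>
      using that by (simp add: exit_after_def)
    show ?case
      using X_optional_stopping(2)[OF elim(1) x s C Ce] X_optional_stopping(2)[OF elim(1) x s(1) order_refl C Ce]
      by (simp only:)
  qed
  also have "\<dots> = (\<integral>\<^sup>+\<omega>. indicator (D \<inter> exit_after s n) (J \<omega>, \<omega>) * ennreal (quotJ \<omega> (cap s (exitJ n \<omega>))) \<partial>M)"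
    by (rule quotJ_conditioning[OF nojump s(1) order_refl D(1), symmetric])
  also have "\<dots> = (\<integral>\<^sup>+\<omega>. indicator (A \<inter> {\<omega>. ennreal s \<le> exitJ n \<omega> \<and> 0 < exitJ n \<omega>}) \<omega> *
      ennreal (quotJ \<omega> (cap s (exitJ n \<omega>))) \<partial>M)"
    by (intro nn_integral_cong) (simp only: ind)
  finally show ?thesis .
qed

text \<open>
  An event of \<open>G s\<close> is only known to be of the form \<open>(J \<omega>, \<omega>) \<in> D\<close> at times \<open>u > s\<close>; hence the limit \<open>u \<down> s\<close>.
\<close>

lemma quotJ_stopped_eq:
  assumes nojump: "AE x in law. AE \<omega> in M. \<not> jump_to_zero_time (p x \<omega>) < \<infinity>"
    and lm: "AE x in law. local_martingale M F (X x)" and s: "0 \<le> s" "s \<le> t"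
    and A: "A \<in> sets (G s)"
  shows "(\<integral>\<^sup>+\<omega>. indicator (A \<inter> {\<omega>. 0 < exitJ n \<omega>}) \<omega> * ennreal (quotJ \<omega> (cap t (exitJ n \<omega>))) \<partial>M) =
    (\<integral>\<^sup>+\<omega>. indicator (A \<inter> {\<omega>. 0 < exitJ n \<omega>}) \<omega> * ennreal (quotJ \<omega> (cap s (exitJ n \<omega>))) \<partial>M)"
proof (cases "s = t")
  case False
  then have st: "s < t" using s by simp
  have t: "0 \<le> t" using s by simp
  have AM: "A \<in> sets M" by (rule G.sets_F_sets[OF s(1) A])
  define T where "T = exitJ n"
  have T: "ext_stopping_time G T" unfolding T_def by (rule exitJ_stopping_time)
  define u where "u = (\<lambda>m. s + (t - s) / real (Suc m))"
  have u: "s < u m" "u m \<le> t" "0 \<le> u m" for m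
    using st s by (auto simp: u_def field_simps intro!: mult_right_mono)
  have u_lim: "u \<longlonglongrightarrow> s"
    unfolding u_def using tendsto_add[OF tendsto_const[of s] lim_const_over_n[THEN LIMSEQ_Suc, of "t - s"]] by simp
  have u_right: "filterlim u (at_right s) sequentially"
    using u_lim u(1) unfolding filterlim_at by (auto intro!: always_eventually)
  define B where "B = (\<lambda>m. A \<inter> {\<omega>. ennreal (u m) \<le> T \<omega> \<and> 0 < T \<omega>})"
  have TM: "{\<omega>\<in>space M. T \<omega> < ennreal r} \<in> sets M" if "0 \<le> r" for r
    using G.ext_stopping_time_less[OF T that] G.sets_F_sets[OF that] by blast
  have T0M: "{\<omega>\<in>space M. 0 < T \<omega>} \<in> sets M"
    by (rule G.sets_F_sets[OF order_refl G.ext_stopping_time_pos[OF T]])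
  have TsM: "{\<omega>\<in>space M. T \<omega> \<le> ennreal s} \<in> sets M"
  proof -
    have "Measurable.pred (G s) (\<lambda>\<omega>. T \<omega> \<le> ennreal s)" using T s by (simp add: ext_stopping_time_def)
    then have "{\<omega>\<in>space M. T \<omega> \<le> ennreal s} \<in> sets (G s)" by (simp only: pred_def space_G[OF s(1)])
    then show ?thesis by (rule G.sets_F_sets[OF s(1)])
  qed
  have BM: "B m \<in> sets M" for m
  proof -
    have "B m = A \<inter> (space M - {\<omega>\<in>space M. T \<omega> < ennreal (u m)}) \<inter> {\<omega>\<in>space M. 0 < T \<omega>}"
      using sets.sets_into_space[OF AM] by (auto simp: B_def not_less)
    also have "\<dots> \<in> sets M" using AM TM[OF u(3)] T0M by blast
    finally show ?thesis .
  qed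
  \<comment> \<open>The limit of the events \<open>B m\<close>: exit strictly after
    \<open>s\<close>. Points with exit at or before \<open>s\<close> lie in no \<open>B m\<close>,
    because \<open>u m > s\<close>; they are collected in \<open>C'\<close> below, where stopping
    has already frozen the process.\<close>
  define C where "C = A \<inter> {\<omega>. ennreal s < T \<omega>}"
  have CM: "C \<in> sets M"
  proof -
    have "C = A \<inter> (space M - {\<omega>\<in>space M. T \<omega> \<le> ennreal s})"
      using sets.sets_into_space[OF AM] by (auto simp: C_def)
    also have "\<dots> \<in> sets M" using AM TsM by blast
    finally show ?thesis .
  qed
  define Z where "Z = (\<lambda>r \<omega>. quotJ \<omega> (cap r (T \<omega>)))"
  have Zm: "Z r \<in> borel_measurable M" if "0 \<le> r" for r
    unfolding Z_def T_def by (rule G.measurable_F_M[OF that quotJ_sampled[OF that]])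
  have Z0: "0 \<le> Z r \<omega>" if "\<omega> \<in> space M" for r \<omega>
    unfolding Z_def using quotJ_nonneg[OF that cap_nonneg] .
  have step: "(\<integral>\<^sup>+\<omega>. indicator (B m) \<omega> * ennreal (Z t \<omega>) \<partial>M) = (\<integral>\<^sup>+\<omega>. indicator (B m) \<omega> * ennreal (Z (u m) \<omega>) \<partial>M)" for m
  proof -
    have "A \<in> sets (G0 (u m))" using A u(1)[of m] by (simp add: sets_G[OF s(1)])
    from quotJ_exit_eq[OF nojump lm u(3) u(2) this, of n] show ?thesis
      unfolding B_def Z_def T_def .
  qed
  let ?k = "real (Suc n)"
  \<comment> \<open>Dominates both sequences. On \<open>B m\<close> the value at \<open>u m\<close>
    is either taken before the exit, where the two thresholds bound the quotient by
    \<open>(n + 1) * (n + 1)\<close>, or exactly at the exit, where it already equals the value at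
    \<open>t\<close>.\<close>
  define w where "w = (\<lambda>\<omega>. indicator {\<omega>\<in>space M. 0 < T \<omega>} \<omega> * ennreal (?k * ?k + Z t \<omega>))"
  have wm: "w \<in> borel_measurable M"
    unfolding w_def using T0M Zm[OF t]
    by (intro borel_measurable_times_ennreal borel_measurable_indicator measurable_compose[OF _ measurable_ennreal]
        borel_measurable_add) auto
  have w_fin: "(\<integral>\<^sup>+\<omega>. w \<omega> \<partial>M) < \<infinity>"
  proof -
    have "(\<integral>\<^sup>+\<omega>. w \<omega> \<partial>M) \<le> (\<integral>\<^sup>+\<omega>. ennreal (?k * ?k) + indicator {\<omega>\<in>space M. 0 < T \<omega>} \<omega> * ennreal (Z t \<omega>) \<partial>M)"
      using Z0 by (intro nn_integral_mono) (auto simp: w_def indicator_def ennreal_plus)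
    also have "\<dots> = ennreal (?k * ?k) + (\<integral>\<^sup>+\<omega>. indicator {\<omega>\<in>space M. 0 < T \<omega>} \<omega> * ennreal (Z t \<omega>) \<partial>M)"
      using T0M Zm[OF t] by (subst nn_integral_add)
        (auto simp: emeasure_space_1 intro!: borel_measurable_times_ennreal measurable_compose[OF _ measurable_ennreal])
    also have "\<dots> \<le> ennreal (?k * ?k) + ennreal ?k"
      using quotJ_exit_bound[OF nojump lm t, of n] unfolding Z_def T_def by (rule add_left_mono)
    also have "\<dots> < \<infinity>" by (simp flip: ennreal_plus)
    finally show ?thesis .
  qed
  have bound: "Z (u m) \<omega> \<le> ?k * ?k + Z t \<omega>" if w: "\<omega> \<in> B m" for m \<omega>
  proof -
    have ws: "\<omega> \<in> space M" using w BM sets.sets_into_space by blast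
    have uT: "ennreal (u m) \<le> T \<omega>" using w by (simp add: B_def)
    have cu: "cap (u m) (T \<omega>) = u m" by (rule cap_eq_left[OF u(3) uT])
    show ?thesis
    proof (cases "ennreal (u m) < T \<omega>")
      case True
      then have lt: "ennreal (u m) < exit_time (p (J \<omega>) \<omega>) (X (J \<omega>) \<omega>) n" by (simp add: T_def exit_def)
      have "Z (u m) \<omega> \<le> ?k / (1 / ?k)"
        unfolding Z_def cu using exit_time_below[OF u(3) lt] X_nonneg[OF J_in[OF ws] ws u(3)]
        by (intro frac_le) auto
      then show ?thesis using Z0[OF ws, of t] by simp
    next
      case False
      then have Te: "T \<omega> = ennreal (u m)" using uT by simp
      have "cap t (T \<omega>) = u m" unfolding Te using u(2,3) by (simp add: min_absorb2 ennreal_leI)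
      then have "Z (u m) \<omega> = Z t \<omega>" unfolding Z_def by (simp only: cu)
      moreover have "0 \<le> ?k * ?k" by simp
      ultimately show ?thesis by linarith
    qed
  qed
  have ind_lim: "(\<lambda>m. indicator (B m) \<omega> :: ennreal) \<longlonglongrightarrow> indicator C \<omega>" for \<omega>
  proof (cases "ennreal s < T \<omega>")
    case True
    have "\<forall>\<^sub>F m in sequentially. ennreal (u m) < T \<omega>"
      by (rule order_tendstoD(2)[OF tendsto_ennrealI[OF u_lim] True])
    then have "\<forall>\<^sub>F m in sequentially. indicator (B m) \<omega> = (indicator C \<omega> :: ennreal)"
    proof eventually_elim
      case (elim m)
      have "0 < T \<omega>" using True by (rule le_less_trans[rotated]) simp
      then show ?case using elim True by (auto simp: B_def C_def indicator_def)
    qed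
    then show ?thesis by (rule tendsto_eventually)
  next
    case False
    have "\<not> ennreal (u m) \<le> T \<omega>" for m
      using False ennreal_lessI[of "u m" s] u(1)[of m] s(1) by (auto simp: not_less not_le intro: le_less_trans)
    then have "indicator (B m) \<omega> = (indicator C \<omega> :: ennreal)" for m
      using False by (simp add: B_def C_def)
    then show ?thesis by simp
  qed
  have lim1: "(\<lambda>m. \<integral>\<^sup>+\<omega>. indicator (B m) \<omega> * ennreal (Z t \<omega>) \<partial>M) \<longlonglongrightarrow> (\<integral>\<^sup>+\<omega>. indicator C \<omega> * ennreal (Z t \<omega>) \<partial>M)"
  proof (rule nn_integral_dominated_convergence[OF _ _ wm _ w_fin])
    show "AE \<omega> in M. indicator (B m) \<omega> * ennreal (Z t \<omega>) \<le> w \<omega>" for m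
      by (rule AE_I2) (auto simp: w_def B_def indicator_def intro!: ennreal_leI)
    show "AE \<omega> in M. (\<lambda>m. indicator (B m) \<omega> * ennreal (Z t \<omega>)) \<longlonglongrightarrow> indicator C \<omega> * ennreal (Z t \<omega>)"
      by (intro AE_I2 tendsto_mult_ennreal ind_lim tendsto_const) (auto simp: indicator_def)
  qed (intro borel_measurable_times_ennreal borel_measurable_indicator measurable_compose[OF Zm[OF t] measurable_ennreal] BM CM)+
  have lim2: "(\<lambda>m. \<integral>\<^sup>+\<omega>. indicator (B m) \<omega> * ennreal (Z (u m) \<omega>) \<partial>M) \<longlonglongrightarrow> (\<integral>\<^sup>+\<omega>. indicator C \<omega> * ennreal (Z s \<omega>) \<partial>M)"
  proof (rule nn_integral_dominated_convergence[OF _ _ wm _ w_fin])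
    show "AE \<omega> in M. indicator (B m) \<omega> * ennreal (Z (u m) \<omega>) \<le> w \<omega>" for m
    proof (rule AE_I2)
      fix \<omega> assume "\<omega> \<in> space M"
      then show "indicator (B m) \<omega> * ennreal (Z (u m) \<omega>) \<le> w \<omega>"
        using bound[of \<omega> m] by (cases "\<omega> \<in> B m") (auto simp: w_def B_def intro!: ennreal_leI)
    qed
    show "AE \<omega> in M. (\<lambda>m. indicator (B m) \<omega> * ennreal (Z (u m) \<omega>)) \<longlonglongrightarrow> indicator C \<omega> * ennreal (Z s \<omega>)"
      using quotJ_cadlag
    proof eventually_elim
      case (elim \<omega>)
      have "((\<lambda>v. quotJ \<omega> (cap v (T \<omega>))) \<longlongrightarrow> quotJ \<omega> (cap s (T \<omega>))) (at_right s)"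
        by (rule right_continuous_stop[OF cadlag_right[OF elim] s(1)])
      then have "(\<lambda>m. Z (u m) \<omega>) \<longlonglongrightarrow> Z s \<omega>"
        unfolding Z_def by (rule filterlim_compose[OF _ u_right])
      then show ?case by (intro tendsto_mult_ennreal ind_lim tendsto_ennrealI) (auto simp: indicator_def)
    qed
  qed (intro borel_measurable_times_ennreal borel_measurable_indicator
      measurable_compose[OF Zm[OF u(3)] measurable_ennreal] measurable_compose[OF Zm[OF s(1)] measurable_ennreal] BM CM)+
  have C_eq: "(\<integral>\<^sup>+\<omega>. indicator C \<omega> * ennreal (Z t \<omega>) \<partial>M) = (\<integral>\<^sup>+\<omega>. indicator C \<omega> * ennreal (Z s \<omega>) \<partial>M)"
    using LIMSEQ_unique[OF lim1[unfolded step] lim2] .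
  define C' where "C' = A \<inter> {\<omega>. T \<omega> \<le> ennreal s \<and> 0 < T \<omega>}"
  have C'M: "C' \<in> sets M"
  proof -
    have "C' = A \<inter> {\<omega>\<in>space M. T \<omega> \<le> ennreal s} \<inter> {\<omega>\<in>space M. 0 < T \<omega>}"
      using sets.sets_into_space[OF AM] by (auto simp: C'_def)
    also have "\<dots> \<in> sets M" using AM TsM T0M by blast
    finally show ?thesis .
  qed
  have split: "(\<integral>\<^sup>+\<omega>. indicator (A \<inter> {\<omega>. 0 < T \<omega>}) \<omega> * ennreal (Z r \<omega>) \<partial>M) =
      (\<integral>\<^sup>+\<omega>. indicator C \<omega> * ennreal (Z r \<omega>) \<partial>M) + (\<integral>\<^sup>+\<omega>. indicator C' \<omega> * ennreal (Z r \<omega>) \<partial>M)"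
    if r: "0 \<le> r" for r
  proof -
    have "indicator (A \<inter> {\<omega>. 0 < T \<omega>}) \<omega> = (indicator C \<omega> + indicator C' \<omega> :: ennreal)" for \<omega>
      by (auto simp: C_def C'_def indicator_def not_le intro: le_less_trans[of 0 "ennreal s"])
    then show ?thesis
      using CM C'M measurable_compose[OF Zm[OF r] measurable_ennreal]
      by (simp add: distrib_right nn_integral_add)
  qed
  have "(\<integral>\<^sup>+\<omega>. indicator C' \<omega> * ennreal (Z t \<omega>) \<partial>M) = (\<integral>\<^sup>+\<omega>. indicator C' \<omega> * ennreal (Z s \<omega>) \<partial>M)"
  proof (rule nn_integral_cong)
    fix \<omega>
    have "Z t \<omega> = Z s \<omega>" if "T \<omega> \<le> ennreal s"
    proof -
      have "T \<omega> \<le> ennreal t" using that ennreal_leI[OF s(2)] by (rule order_trans)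
      then show ?thesis unfolding Z_def using that by (simp only: min_absorb2)
    qed
    then show "indicator C' \<omega> * ennreal (Z t \<omega>) = indicator C' \<omega> * ennreal (Z s \<omega>)"
      by (auto simp: C'_def indicator_def)
  qed
  then show ?thesis using split[OF t] split[OF s(1)] C_eq unfolding Z_def T_def by simp
qed simp

text \<open>The exit times along \<open>J\<close> localize. The martingale property is tested on
  events of \<open>G s\<close> through nonnegative integrals, whose finiteness allows the return to
  real integrals.\<close>

lemma quotJ_local_martingale:
  assumes nojump: "AE x in law. AE \<omega> in M. \<not> jump_to_zero_time (p x \<omega>) < \<infinity>"
    and lm: "AE x in law. local_martingale M F (X x)"
  shows "local_martingale M G quotJ"
  unfolding local_martingale_def
proof (intro conjI exI[of _ exitJ] allI)
  show "adapted G quotJ" by (rule quotJ_adapted)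
  show "AE \<omega> in M. cadlag (quotJ \<omega>)" by (rule quotJ_cadlag)
  show "ext_stopping_time G (exitJ n)" for n by (rule exitJ_stopping_time)
  show "AE \<omega> in M. incseq (\<lambda>n. exitJ n \<omega>) \<and> (\<lambda>n. exitJ n \<omega>) \<longlonglongrightarrow> \<infinity>" by (rule exitJ_tendsto)
  fix n
  define W where "W = (\<lambda>\<omega> t. stopped quotJ (exitJ n) \<omega> t * indicator {\<omega>. 0 < exitJ n \<omega>} \<omega>)"
  have W: "W \<omega> t = quotJ \<omega> (cap t (exitJ n \<omega>)) * indicator {\<omega>. 0 < exitJ n \<omega>} \<omega>" for \<omega> t
    unfolding W_def stopped_cap ..
  have W0: "0 \<le> W \<omega> t" if "\<omega> \<in> space M" for \<omega> t
    unfolding W by (intro mult_nonneg_nonneg quotJ_nonneg[OF that cap_nonneg]) simp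
  have Wm: "(\<lambda>\<omega>. W \<omega> t) \<in> borel_measurable (G t)" if t: "0 \<le> t" for t
  proof -
    have "{\<omega>\<in>space M. 0 < exitJ n \<omega>} \<in> sets (G t)"
      by (rule G.sets_F_mono[OF order_refl t G.ext_stopping_time_pos[OF exitJ_stopping_time]])
    then have "(\<lambda>\<omega>. quotJ \<omega> (cap t (exitJ n \<omega>)) * indicator {\<omega>\<in>space M. 0 < exitJ n \<omega>} \<omega>) \<in> borel_measurable (G t)"
      by (intro borel_measurable_times quotJ_sampled t borel_measurable_indicator)
    then show ?thesis
      by (rule measurable_cong[THEN iffD1, rotated]) (simp add: W space_G[OF t] indicator_def)
  qed
  have Wn: "ennreal (W \<omega> t) = indicator {\<omega>\<in>space M. 0 < exitJ n \<omega>} \<omega> * ennreal (quotJ \<omega> (cap t (exitJ n \<omega>)))"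
    if "\<omega> \<in> space M" for \<omega> t
    using that by (simp add: W indicator_def)
  have Wi: "integrable M (\<lambda>\<omega>. W \<omega> t)" if t: "0 \<le> t" for t
  proof (rule integrableI_nonneg)
    show "(\<lambda>\<omega>. W \<omega> t) \<in> borel_measurable M" by (rule G.measurable_F_M[OF t Wm[OF t]])
    show "AE \<omega> in M. 0 \<le> W \<omega> t" using W0 by (rule AE_I2)
    have "(\<integral>\<^sup>+\<omega>. ennreal (W \<omega> t) \<partial>M) \<le> ennreal (real (Suc n))"
      using quotJ_exit_bound[OF nojump lm t, of n] by (simp only: Wn cong: nn_integral_cong)
    then show "(\<integral>\<^sup>+\<omega>. ennreal (W \<omega> t) \<partial>M) < \<infinity>" by (rule le_less_trans) simp
  qed
  have "martingale M G W"
    unfolding martingale_def adapted_def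
  proof (intro conjI allI impI)
    show "(\<lambda>\<omega>. W \<omega> t) \<in> borel_measurable (G t)" if "0 \<le> t" for t by (rule Wm[OF that])
    show "integrable M (\<lambda>\<omega>. W \<omega> t)" if "0 \<le> t" for t by (rule Wi[OF that])
    fix s t :: real assume s: "0 \<le> s" "s \<le> t"
    then have t: "0 \<le> t" by simp
    interpret Gs: sigma_finite_subalgebra M "G s" by (rule G.sigma_finite_F[OF s(1)])
    show "AE \<omega> in M. real_cond_exp M (G s) (\<lambda>\<omega>. W \<omega> t) \<omega> = W \<omega> s"
    proof (rule Gs.real_cond_exp_charact)
      fix A assume A: "A \<in> sets (G s)"
      have AM: "A \<in> sets M" by (rule G.sets_F_sets[OF s(1) A])
      have nn: "(\<integral>\<^sup>+\<omega>. indicator A \<omega> * ennreal (W \<omega> r) \<partial>M) =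
          (\<integral>\<^sup>+\<omega>. indicator (A \<inter> {\<omega>. 0 < exitJ n \<omega>}) \<omega> * ennreal (quotJ \<omega> (cap r (exitJ n \<omega>))) \<partial>M)" for r
        by (intro nn_integral_cong) (simp add: W indicator_def)
      have "ennreal (\<integral>\<omega>. indicator A \<omega> * W \<omega> t \<partial>M) = ennreal (\<integral>\<omega>. indicator A \<omega> * W \<omega> s \<partial>M)"
        using nn_integral_indicator_eq_integral[OF AM Wi[OF t] W0]
          nn_integral_indicator_eq_integral[OF AM Wi[OF s(1)] W0]
          quotJ_stopped_eq[OF nojump lm s A, of n] by (simp only: nn)
      moreover have "0 \<le> (\<integral>\<omega>. indicator A \<omega> * W \<omega> r \<partial>M)" for r
        using W0 by (intro integral_nonneg_AE AE_I2) (simp add: indicator_def)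
      ultimately have "(\<integral>\<omega>. indicator A \<omega> * W \<omega> t \<partial>M) = (\<integral>\<omega>. indicator A \<omega> * W \<omega> s \<partial>M)"
        by (simp only: ennreal_inj)
      then show "(\<integral>\<omega>\<in>A. W \<omega> t \<partial>M) = (\<integral>\<omega>\<in>A. W \<omega> s \<partial>M)"
        by (simp add: set_lebesgue_integral_def)
    qed (intro Wi Wm s t)+
  qed
  then show "martingale M G (\<lambda>\<omega> t. stopped quotJ (exitJ n) \<omega> t * indicator {\<omega>. 0 < exitJ n \<omega>} \<omega>)"
    unfolding W_def .
qed

end

section \<open>From local martingales to no jumps\<close>

lemma (in filtered_prob_space) local_martingale_const: "local_martingale M F (\<lambda>_ _. c)"
  unfolding local_martingale_def
proof (intro conjI exI[of _ "\<lambda>_ _. \<infinity>"] allI)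
  show "adapted F (\<lambda>_ _. c)" by (simp add: adapted_def)
  show "AE \<omega> in M. cadlag (\<lambda>_. c)" by (auto simp: cadlag_def)
  show "ext_stopping_time F (\<lambda>_. \<infinity>)" by (simp add: ext_stopping_time_def)
  have "martingale M F (\<lambda>_ _. c)"
    unfolding martingale_def adapted_def
  proof (intro conjI allI impI)
    fix s :: real assume "0 \<le> s"
    then interpret sigma_finite_subalgebra M "F s" by (rule sigma_finite_F)
    show "AE \<omega> in M. real_cond_exp M (F s) (\<lambda>_. c) \<omega> = c" by (rule real_cond_exp_F_meas) auto
  qed auto
  then show "martingale M F (\<lambda>\<omega> t. stopped (\<lambda>_ _. c) (\<lambda>_. \<infinity>) \<omega> t * indicator {\<omega>. 0 < (\<infinity>::ennreal)} \<omega>)"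
    by (simp add: stopped_def)
qed auto

context jacod_setup
begin

interpretation one: jacod_family M F E J \<kappa> p "\<lambda>_ _ _. 1"
  by unfold_locales (auto simp: cadlag_def)

text \<open>Before the exit \<open>1 / p\<close> is at most \<open>n + 1\<close>, so the local
  martingale stopped there keeps its expectation between times 0 and \<open>N\<close>. Conditioning
  expresses the two expectations as masses of the paths with positive density at the respective
  capped time. At time 0 every path with positive exit time qualifies, its density being at least
  \<open>1 / (n + 1)\<close>; equality leaves no mass for paths whose density is zero at the later
  time.\<close>

lemma no_hit_before_exit:
  assumes lm: "local_martingale M G (\<lambda>\<omega> t. 1 / p (J \<omega>) \<omega> t)" and N: "0 \<le> N"
  shows "AE x in law. AE \<omega> in M. 0 < one.exit n x \<omega> \<longrightarrow> 0 < p x \<omega> (cap N (one.exit n x \<omega>))"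
proof -
  \<comment> \<open>One unit after \<open>N\<close>, so that \<open>v\<close> is positive even for
    \<open>N = 0\<close>; joint measurability of the event of a positive exit time requires
    this.\<close>
  define v where "v = N + 1"
  have v: "0 \<le> v" "0 < v" "N \<le> v" using N by (auto simp: v_def)
  let ?k = "real (Suc n)"
  let ?S = "one.exitJ n"
  let ?D = "space (joint 0) \<inter> one.exit_after 0 n"
  have D: "?D = {z\<in>topspace E \<times> space M. 0 < one.exit n (fst z) (snd z)}"
    by (auto simp: one.exit_after_def space_pair_measure)
  have Dm: "?D \<in> sets (joint v)"
    by (rule one.exit_after_joint[OF order_refl v(2) sets.top])
  have bound: "1 / p (J \<omega>) \<omega> u \<le> ?k" if "\<omega> \<in> space M" "0 \<le> u" "ennreal u < ?S \<omega>" for \<omega> u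
  proof -
    have "1 / ?k \<le> p (J \<omega>) \<omega> u"
      using exit_time_below(1)[OF that(2)] that(3) unfolding one.exit_def by blast
    then have "1 / p (J \<omega>) \<omega> u \<le> 1 / (1 / ?k)" by (intro frac_le) auto
    then show ?thesis by simp
  qed
  have meas: "(\<lambda>\<omega>. 1 / p (J \<omega>) \<omega> (R \<omega>)) \<in> borel_measurable M"
    if R: "R \<in> borel_measurable M" "\<And>\<omega>. \<omega> \<in> space M \<Longrightarrow> 0 \<le> R \<omega> \<and> R \<omega> \<le> t" for R t
  proof -
    have "(\<lambda>\<omega>. p (J \<omega>) \<omega> (R \<omega>)) \<in> borel_measurable M"
    proof (rule measurable_sample_right_continuous[OF R])
      show "(\<lambda>\<omega>. p (J \<omega>) \<omega> u) \<in> borel_measurable M" if "0 \<le> u" for u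
        using measurable_compose[OF measurable_J_pair[OF that] p_section[OF that]] by simp
      show "(p (J \<omega>) \<omega> \<longlongrightarrow> p (J \<omega>) \<omega> u) (at_right u)" if "\<omega> \<in> space M" "0 \<le> u" for \<omega> u
        by (rule cadlag_right[OF p_cadlag[OF J_in[OF that(1)] that(1)] that(2)])
    qed
    then show ?thesis by simp
  qed
  note L = G.nonneg_local_martingale_optional_stopping[OF lm one.quotJ_nonneg meas one.exitJ_stopping_time[of n] bound]
  have G0D: "{\<omega>\<in>space M. 0 < ?S \<omega>} \<in> sets (G 0)" by (rule G.ext_stopping_time_pos[OF one.exitJ_stopping_time])
  have stop: "(\<integral>\<^sup>+\<omega>. indicator {\<omega>\<in>space M. 0 < ?S \<omega>} \<omega> * ennreal (1 / p (J \<omega>) \<omega> (cap N (?S \<omega>))) \<partial>M) =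
      (\<integral>\<^sup>+\<omega>. indicator {\<omega>\<in>space M. 0 < ?S \<omega>} \<omega> * ennreal (1 / p (J \<omega>) \<omega> (cap 0 (?S \<omega>))) \<partial>M)"
  proof -
    have "(\<integral>\<^sup>+\<omega>. indicator {\<omega>\<in>space M. 0 < ?S \<omega>} \<omega> * ennreal (1 / p (J \<omega>) \<omega> (cap t (?S \<omega>))) \<partial>M) =
        (\<integral>\<^sup>+\<omega>. indicator {\<omega>\<in>space M. 0 < ?S \<omega>} \<omega> * ennreal (1 / p (J \<omega>) \<omega> 0) \<partial>M)" if "0 \<le> t" for t
      using that G0D by (intro L(2)) auto
    from this[OF N] this[OF order_refl] show ?thesis by (simp only:)
  qed
  \<comment> \<open>Finiteness permits cancelling the common mass in \<open>[0, \<infinity>]\<close>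
    at the end.\<close>
  have fin: "(\<integral>\<^sup>+\<omega>. indicator {\<omega>\<in>space M. 0 < ?S \<omega>} \<omega> * ennreal (1 / p (J \<omega>) \<omega> (cap N (?S \<omega>))) \<partial>M) < \<infinity>"
  proof (rule le_less_trans)
    show "(\<integral>\<^sup>+\<omega>. indicator {\<omega>\<in>space M. 0 < ?S \<omega>} \<omega> * ennreal (1 / p (J \<omega>) \<omega> (cap N (?S \<omega>))) \<partial>M)
        \<le> ennreal ?k"
      using N by (intro L(1)) auto
  qed simp
  have cond: "(\<integral>\<^sup>+\<omega>. indicator {\<omega>\<in>space M. 0 < ?S \<omega>} \<omega> * ennreal (1 / p (J \<omega>) \<omega> (cap t (?S \<omega>))) \<partial>M) =
      (\<integral>\<^sup>+x. \<integral>\<^sup>+\<omega>. indicator ?D (x, \<omega>) * ennreal (if 0 < p x \<omega> (cap t (one.exit n x \<omega>)) then 1 else 0) \<partial>M \<partial>law)"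
    if t: "0 \<le> t" "t \<le> v" for t
  proof -
    have "(\<integral>\<^sup>+\<omega>. indicator {\<omega>\<in>space M. 0 < ?S \<omega>} \<omega> * ennreal (1 / p (J \<omega>) \<omega> (cap t (?S \<omega>))) \<partial>M) =
        (\<integral>\<^sup>+\<omega>. indicator ?D (J \<omega>, \<omega>) * ennreal (1 / p (J \<omega>) \<omega> (cap t (?S \<omega>))) \<partial>M)"
      unfolding D by (intro nn_integral_cong) (use J_in in \<open>auto simp: indicator_def\<close>)
    also have "\<dots> = (\<integral>\<^sup>+x. \<integral>\<^sup>+\<omega>. indicator ?D (x, \<omega>) *
        ennreal (if 0 < p x \<omega> (cap t (one.exit n x \<omega>)) then 1 else 0) \<partial>M \<partial>law)"
      by (rule one.conditioning_at_exit[OF order_refl t Dm one.exit_after_section[OF order_refl sets.top]]) auto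
    finally show ?thesis .
  qed
  \<comment> \<open>\<open>a\<close> and \<open>b\<close> split the paths with positive exit time
    according to whether or not the density is positive at the exit time capped by
    \<open>N\<close>.\<close>
  define a where "a = (\<lambda>z. indicator ?D z * ennreal (if 0 < p (fst z) (snd z) (cap N (one.exit n (fst z) (snd z))) then 1 else 0))"
  define b where "b = (\<lambda>z. indicator ?D z * ennreal (if 0 < p (fst z) (snd z) (cap N (one.exit n (fst z) (snd z))) then 0 else 1))"
  have pN [measurable]: "(\<lambda>z. p (fst z) (snd z) (cap N (one.exit n (fst z) (snd z)))) \<in> borel_measurable (joint v)"
    by (rule measurable_pair_mono[OF N v(3) one.sample_joint[OF N p_meas p_cadlag]])
  have abm: "a \<in> borel_measurable (law \<Otimes>\<^sub>M M)" "b \<in> borel_measurable (law \<Otimes>\<^sub>M M)"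
  proof -
    have "a \<in> borel_measurable (joint v)" "b \<in> borel_measurable (joint v)"
      unfolding a_def b_def using Dm by measurable
    then have "a \<in> borel_measurable (borel_of E \<Otimes>\<^sub>M M)" "b \<in> borel_measurable (borel_of E \<Otimes>\<^sub>M M)"
      by (auto intro: measurable_pair_M[OF v(1)])
    then show "a \<in> borel_measurable (law \<Otimes>\<^sub>M M)" "b \<in> borel_measurable (law \<Otimes>\<^sub>M M)"
      by (simp_all cong: measurable_cong_sets sets_pair_measure_cong)
  qed
  have "(\<integral>\<^sup>+z. a z \<partial>(law \<Otimes>\<^sub>M M)) = (\<integral>\<^sup>+x. \<integral>\<^sup>+\<omega>. a (x, \<omega>) \<partial>M \<partial>law)"
    by (rule nn_integral_fst[OF abm(1), symmetric])
  also have "\<dots> = (\<integral>\<^sup>+\<omega>. indicator {\<omega>\<in>space M. 0 < ?S \<omega>} \<omega> * ennreal (1 / p (J \<omega>) \<omega> (cap N (?S \<omega>))) \<partial>M)"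
    unfolding cond[OF N v(3)] by (simp only: a_def fst_conv snd_conv)
  finally have a_int: "(\<integral>\<^sup>+z. a z \<partial>(law \<Otimes>\<^sub>M M)) =
      (\<integral>\<^sup>+\<omega>. indicator {\<omega>\<in>space M. 0 < ?S \<omega>} \<omega> * ennreal (1 / p (J \<omega>) \<omega> (cap N (?S \<omega>))) \<partial>M)" .
  have "(\<integral>\<^sup>+z. a z \<partial>(law \<Otimes>\<^sub>M M)) =
      (\<integral>\<^sup>+x. \<integral>\<^sup>+\<omega>. indicator ?D (x, \<omega>) * ennreal (if 0 < p x \<omega> (cap 0 (one.exit n x \<omega>)) then 1 else 0) \<partial>M \<partial>law)"
    unfolding a_int stop by (rule cond[OF order_refl v(1)])
  also have "\<dots> = (\<integral>\<^sup>+x. \<integral>\<^sup>+\<omega>. a (x, \<omega>) + b (x, \<omega>) \<partial>M \<partial>law)"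
  proof (intro nn_integral_cong)
    fix x \<omega>
    have "0 < p x \<omega> 0" if "0 < one.exit n x \<omega>"
    proof -
      have "1 / ?k \<le> p x \<omega> 0"
        using exit_time_below(1)[OF order_refl, of "p x \<omega>" "\<lambda>_. 1" n] that by (simp add: one.exit_def)
      then show ?thesis by (rule less_le_trans[rotated]) simp
    qed
    then show "indicator ?D (x, \<omega>) * ennreal (if 0 < p x \<omega> (cap 0 (one.exit n x \<omega>)) then 1 else 0) =
        a (x, \<omega>) + b (x, \<omega>)"
      unfolding a_def b_def D by (cases "0 < one.exit n x \<omega>") (simp_all add: indicator_def)
  qed
  also have "\<dots> = (\<integral>\<^sup>+z. a z + b z \<partial>(law \<Otimes>\<^sub>M M))"
    by (rule nn_integral_fst[OF borel_measurable_add[OF abm]])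
  also have "\<dots> = (\<integral>\<^sup>+z. a z \<partial>(law \<Otimes>\<^sub>M M)) + (\<integral>\<^sup>+z. b z \<partial>(law \<Otimes>\<^sub>M M))"
    by (rule nn_integral_add[OF abm])
  finally have "(\<integral>\<^sup>+z. b z \<partial>(law \<Otimes>\<^sub>M M)) = 0"
    using fin ennreal_add_left_cancel[of "\<integral>\<^sup>+z. a z \<partial>(law \<Otimes>\<^sub>M M)" 0 "\<integral>\<^sup>+z. b z \<partial>(law \<Otimes>\<^sub>M M)"]
    unfolding a_int[symmetric] by auto
  then have "(\<integral>\<^sup>+x. \<integral>\<^sup>+\<omega>. b (x, \<omega>) \<partial>M \<partial>law) = 0" by (simp only: nn_integral_fst[OF abm(2)])
  then have "AE x in law. (\<integral>\<^sup>+\<omega>. b (x, \<omega>) \<partial>M) = 0"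
    using borel_measurable_nn_integral_fst[OF abm(2)] by (subst (asm) nn_integral_0_iff_AE)
  then show ?thesis
    using AE_space
  proof eventually_elim
    case (elim x)
    then have x: "x \<in> topspace E" "x \<in> space law" by auto
    have "(\<lambda>\<omega>. b (x, \<omega>)) \<in> borel_measurable M" by (rule measurable_Pair2[OF abm(2) x(2)])
    then have "AE \<omega> in M. b (x, \<omega>) = 0" using elim(1) by (subst (asm) nn_integral_0_iff_AE)
    then show ?case
      using AE_space
    proof eventually_elim
      case (elim \<omega>)
      show ?case
      proof (rule impI, rule ccontr)
        assume "0 < one.exit n x \<omega>" "\<not> 0 < p x \<omega> (cap N (one.exit n x \<omega>))"
        then have "b (x, \<omega>) = 1" unfolding b_def D using x elim(2) by (simp only: fst_conv snd_conv if_False) simp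
        then show False using elim(1) by simp
      qed
    qed
  qed
qed

text \<open>By absorption, a jump to zero is witnessed by a positive exit time of some index
  \<open>n\<close> and an integer horizon \<open>N\<close> at which the density vanishes. There are
  only countably many such pairs, so the exceptional sets combine.\<close>

lemma no_jump_to_zero:
  assumes lm: "local_martingale M G (\<lambda>\<omega> t. 1 / p (J \<omega>) \<omega> t)"
  shows "AE x in law. AE \<omega> in M. \<not> jump_to_zero_time (p x \<omega>) < \<infinity>"
proof -
  have "AE x in law. \<forall>n N::nat. AE \<omega> in M. 0 < one.exit n x \<omega> \<longrightarrow> 0 < p x \<omega> (cap (real N) (one.exit n x \<omega>))"
    unfolding AE_all_countable using no_hit_before_exit[OF lm] by simp
  then show ?thesis
    using AE_space
  proof eventually_elim
    case (elim x)
    then have x: "x \<in> topspace E" by simp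
    have "AE \<omega> in M. \<forall>n N::nat. 0 < one.exit n x \<omega> \<longrightarrow> 0 < p x \<omega> (cap (real N) (one.exit n x \<omega>))"
      unfolding AE_all_countable using elim(1) by blast
    then show ?case
      using density_absorbed[OF x] AE_space
    proof eventually_elim
      case (elim \<omega>)
      show ?case
      proof
        assume "jump_to_zero_time (p x \<omega>) < \<infinity>"
        then obtain n N :: nat where "0 < exit_time (p x \<omega>) (\<lambda>_. 1) n"
          "p x \<omega> (cap (real N) (exit_time (p x \<omega>) (\<lambda>_. 1) n)) = 0"
          using jump_to_zero_exit_time[OF p_cadlag[OF x elim(3)] p_nonneg[OF x elim(3)]] elim(2) by blast
        then show False using elim(1) unfolding one.exit_def by (metis less_irrefl)
      qed
    qed
  qed
qed

text \<open>Completeness of \<open>M\<close> supplies the measurability of the set, whatever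
  \<open>P\<close> is; it will be applied to the event of a finite jump time.\<close>

lemma AE_iff_null_set:
  "{\<omega>\<in>space M. P \<omega>} \<in> null_sets M \<longleftrightarrow> (AE \<omega> in M. \<not> P \<omega>)"
proof
  assume "AE \<omega> in M. \<not> P \<omega>"
  then obtain N where "{\<omega>\<in>space M. \<not> \<not> P \<omega>} \<subseteq> N" "emeasure M N = 0" "N \<in> sets M" by (rule AE_E)
  then have "N \<in> null_sets M" "{\<omega>\<in>space M. P \<omega>} \<subseteq> N" by auto
  moreover have "complete_measure M" using usual by (simp add: usual_hypotheses_def)
  ultimately show "{\<omega>\<in>space M. P \<omega>} \<in> null_sets M" by (metis complete_measure.complete2)
qed (auto intro: AE_I')

end

theorem proposition3p6:
  fixes M :: "'a measure" and F G :: "real \<Rightarrow> 'a measure"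
    and E :: "'e topology" and J :: "'a \<Rightarrow> 'e" and \<gamma> :: "'e measure"
    and \<kappa> :: "real \<Rightarrow> 'a \<Rightarrow> 'e measure" and p :: "'e \<Rightarrow> 'a \<Rightarrow> real \<Rightarrow> real"
    and \<eta> :: "'e \<Rightarrow> 'a \<Rightarrow> ennreal"
  assumes "prob_space M"
    and "filtered_space M F"
    and "usual_hypotheses M F"
    and "Lusin_space E"
    and "J \<in> M \<rightarrow>\<^sub>M borel_of E"
    and "\<gamma> = distr M (borel_of E) J"
    and "G = initial_enlargement M F E J"
    and "\<And>t. t \<ge> 0 \<Longrightarrow> regular_cond_law M (F t) (borel_of E) J (\<kappa> t)"
    and hypothesis_J: "\<And>t. t \<ge> 0 \<Longrightarrow> AE \<omega> in M. absolutely_continuous \<gamma> (\<kappa> t \<omega>)"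
    and "jacod_density M F E J \<kappa> p"
    and "\<eta> = (\<lambda>x \<omega>. jump_to_zero_time (p x \<omega>))"
  defines "stmt1 \<equiv>
      (\<forall>X :: 'e \<Rightarrow> 'a \<Rightarrow> real \<Rightarrow> real.
         (\<forall>x\<in>topspace E. \<forall>\<omega>\<in>space M. \<forall>t\<ge>0. 0 \<le> X x \<omega> t) \<longrightarrow>
         (\<lambda>(x, \<omega>, t). X x \<omega> t) \<in> borel_measurable (borel_of E \<Otimes>\<^sub>M optional_sigma M F) \<longrightarrow>
         (\<forall>x\<in>topspace E. \<forall>\<omega>\<in>space M. cadlag (X x \<omega>)) \<longrightarrow>
         (AE x in \<gamma>. local_martingale M F (X x)) \<longrightarrow>
         local_martingale M G (\<lambda>\<omega> t. X (J \<omega>) \<omega> t / p (J \<omega>) \<omega> t))"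
    and "stmt2 \<equiv> local_martingale M G (\<lambda>\<omega> t. 1 / p (J \<omega>) \<omega> t)"
    and "stmt3 \<equiv> (AE x in \<gamma>. {\<omega> \<in> space M. \<eta> x \<omega> < \<infinity>} \<in> null_sets M)"
  shows "(stmt1 \<longleftrightarrow> stmt2) \<and> (stmt2 \<longleftrightarrow> stmt3)"
proof -
  interpret prob_space M by fact
  interpret jacod_setup M F E J \<kappa> p
    using assms by unfold_locales auto
  have stmt3: "stmt3 \<longleftrightarrow> (AE x in distr M (borel_of E) J. AE \<omega> in M. \<not> jump_to_zero_time (p x \<omega>) < \<infinity>)"
    unfolding stmt3_def \<open>\<gamma> = _\<close> \<open>\<eta> = _\<close> AE_iff_null_set ..
  \<comment> \<open>The three implications close a cycle. Here the family is the constant 1, which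
    is a local martingale for every \<open>x\<close>.\<close>
  have "stmt2" if stmt1
  proof -
    have "cadlag (\<lambda>_. 1)" by (auto simp: cadlag_def)
    then show ?thesis
      using that[unfolded stmt1_def, rule_format, of "\<lambda>_ _ _. 1"] local_martingale_const
      by (simp add: stmt2_def)
  qed
  moreover have "stmt3" if stmt2
    using that no_jump_to_zero unfolding stmt3 stmt2_def \<open>G = _\<close> by blast
  moreover have "stmt1" if stmt3
    unfolding stmt1_def
  proof (intro allI impI)
    fix X :: "'e \<Rightarrow> 'a \<Rightarrow> real \<Rightarrow> real"
    assume X: "\<forall>x\<in>topspace E. \<forall>\<omega>\<in>space M. \<forall>t\<ge>0. 0 \<le> X x \<omega> t"
      "(\<lambda>(x, \<omega>, t). X x \<omega> t) \<in> borel_measurable (borel_of E \<Otimes>\<^sub>M optional_sigma M F)"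
      "\<forall>x\<in>topspace E. \<forall>\<omega>\<in>space M. cadlag (X x \<omega>)"
      "AE x in \<gamma>. local_martingale M F (X x)"
    interpret jacod_family M F E J \<kappa> p X using X by unfold_locales auto
    show "local_martingale M G (\<lambda>\<omega> t. X (J \<omega>) \<omega> t / p (J \<omega>) \<omega> t)"
      using quotJ_local_martingale that X(4) unfolding stmt3 \<open>G = _\<close> \<open>\<gamma> = _\<close> by blast
  qed
  ultimately show ?thesis by blast
qed

end
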